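(* If the subcomplex $\Delta_{\mathbb{C}}(\mathcal{H})$ of the building $X_{\mathbb{C}(t)}$ is simply connected, then the reduced Burau representation $\beta_{4,r}$ of $B_4$ is faithful.
   Context: **Burau representation.** $B_4$ is the braid group with standard generators $\sigma_1,\sigma_2,\sigma_3$, and $\beta_{4,r}:B_4\to\mathrm{GL}(3,\mathbb{Z}[t,t^{-1}])$ is $$\sigma_1\mapsto\begin{pmatrix}-t&1&0\\0&1&0\\0&0&1\end{pmatrix},\quad \sigma_2\mapsto\begin{pmatrix}1&0&0\\t&-t&1\\0&0&1\end{pmatrix},\quad \sigma_3\mapsto\begin{pmatrix}1&0&0\\0&1&0\\0&t&-t\end{pmatrix}.$$ **Building.** $X_{\mathbb{C}(t)}$ is the two-dimensional Bruhat–Tits building of $\mathrm{PGL}(3,\mathbb{C}(t))$ for the valuation at infinity $v_\infty$, with valuation ring $\mathcal{O}=\{f\in\mathbb{C}(t): v_\infty(f)\ge 0\}$ and uniformizer $\pi=t^{-1}$. Its vertices are the homothety classes of $\mathcal{O}$-lattices in $\mathbb{C}(t)^3$ (column vectors); two distinct classes are joined by an edge iff they have representatives $L,L'$ with $\pi L\subset L'\subset L$; 2-cells are triples of pairwise adjacent vertices. $\mathrm{PGL}(3,\mathbb{C}(t))$ acts by left multiplication. $[I]$ is the class of $\mathcal{O}^3$ and $[A]=A\cdot[I]$. **Unitary group.** The involution $\overline{(\ )}$ of $\mathbb{C}[t,t^{-1}]$ is complex conjugation on coefficients together with $t\mapsto t^{-1}$, applied entrywise to matrices. With $D=\mathrm{diag}(1,\,t+t^{-1},\,t+t^{-1})$,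 let $\mathrm{PU}(\mathbb{C})=\{A\in\mathrm{PGL}(3,\mathbb{C}[t,t^{-1}]):\overline{A}DA^T=D\}$ (equality in the projective group). The unipotent kernel $\mathcal{U}_{\mathbb{C}}$ is the set of $B\in\mathrm{PU}(\mathbb{C})$ such that $B|_{t=-i}$ is (projectively) upper triangular with all diagonal entries equal to $1$. **The subgroup $\mathcal{H}$.** Square brackets around matrices denote projective classes. Let $$\mathbf{k}_{\mathbb{C}}[1]=\left[\begin{pmatrix}\frac{1-t}{\sqrt2}&\frac{-t}{\sqrt2}&0\\ \frac{-(t^{-1}+t)}{\sqrt2}&\frac{1-t}{\sqrt2}&0\\0&0&1\end{pmatrix}\begin{pmatrix}1&0&0\\0&1&0\\0&0&\frac{1+i}{\sqrt2}\end{pmatrix}\right],\qquad \mathbf{k}_{\mathbb{C}}[\infty]=[\mathrm{diag}(1,it,1)],$$ and for $A\in\mathrm{U}(2,\mathbb{C})$ let $u_{\mathbb{C}}[A]$ be the class of the block diagonal matrix $1\oplus A$. Put $P=\begin{pmatrix}0&1\\-1&0\end{pmatrix}$, $Q=\begin{pmatrix}i&0\\0&-i\end{pmatrix}$, $R=\begin{pmatrix}0&i\\i&0\end{pmatrix}$, and $d_1=\mathbf{k}_{\mathbb{C}}[\infty]$, $d_2=u_{\mathbb{C}}[P]\,\mathbf{k}_{\mathbb{C}}[\infty]\,u_{\mathbb{C}}[P]^{-1}$, $g_1=\mathbf{k}_{\mathbb{C}}[1]$, $g_2=u_{\mathbb{C}}[P]\,\mathbf{k}_{\mathbb{C}}[1]\,u_{\mathbb{C}}[P]^{-1}$,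 $g_3=u_{\mathbb{C}}[Q]\,\mathbf{k}_{\mathbb{C}}[1]\,u_{\mathbb{C}}[Q]^{-1}$, $g_4=u_{\mathbb{C}}[R]\,\mathbf{k}_{\mathbb{C}}[1]\,u_{\mathbb{C}}[R]^{-1}$. Then $\mathcal{H}=\langle d_1,d_2,g_1,g_2,g_3,g_4\rangle\subset\mathcal{U}_{\mathbb{C}}$. **Spanning subcomplex.** For a subgroup $G\subset\mathcal{U}_{\mathbb{C}}$, $\Delta_{\mathbb{C}}(G)$ is the full simplicial subcomplex of $X_{\mathbb{C}(t)}$ on the vertex set $\{[g]:g\in G\}$: it contains an edge (resp. 2-cell) of $X_{\mathbb{C}(t)}$ iff it contains its two endpoints (resp. its three sides). *)

theory Defs
  imports
    "HOL-Analysis.Analysis"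
    "HOL-Computational_Algebra.Computational_Algebra"
    "HOL-Library.Poly_Mapping"
    "HOL-Algebra.Generated_Groups"
begin

section \<open>Laurent polynomials and rational functions\<close>

text \<open>
  The Laurent polynomial ring \<open>R[t, 1/t]\<close> is the group ring of the integers: a finitely supported
  function from exponents to coefficients with the convolution product.
\<close>

type_synonym 'a laurent = "int \<Rightarrow>\<^sub>0 'a"

abbreviation lmonom :: "'a::zero \<Rightarrow> int \<Rightarrow> 'a laurent" where
  "lmonom c k \<equiv> Poly_Mapping.single k c"

abbreviation lconst :: "'a::zero \<Rightarrow> 'a laurent" where
  "lconst c \<equiv> lmonom c 0"

abbreviation lT :: "'a::zero_neq_one laurent" where
  "lT \<equiv> lmonom 1 1"

abbreviation lTinv :: "'a::zero_neq_one laurent" where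
  "lTinv \<equiv> lmonom 1 (-1)"

text \<open>The field \<open>\<complex>(t)\<close>.\<close>

type_synonym ratfun = "complex poly fract"

abbreviation rT :: ratfun where
  "rT \<equiv> to_fract [:0, 1:]"

text \<open>The extension of a map \<open>m\<close> on monomials \<open>c t\<^sup>k\<close>, given as a function of \<open>k\<close> and \<open>c\<close>.\<close>

definition laurent_lift :: "(int \<Rightarrow> 'a::zero \<Rightarrow> 'b) \<Rightarrow> 'a laurent \<Rightarrow> 'b::comm_monoid_add" where
  "laurent_lift m f = (\<Sum>k\<in>Poly_Mapping.keys f. m k (Poly_Mapping.lookup f k))"

definition laurent_to_rat :: "complex laurent \<Rightarrow> ratfun" where
  "laurent_to_rat = laurent_lift (\<lambda>k c. to_fract [:c:] * rT powi k)"

definition laurent_eval :: "complex \<Rightarrow> complex laurent \<Rightarrow> complex" where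
  "laurent_eval z = laurent_lift (\<lambda>k c. c * z powi k)"

definition laurent_bar :: "complex laurent \<Rightarrow> complex laurent" where
  "laurent_bar = laurent_lift (\<lambda>k c. lmonom (cnj c) (-k))"

lemma laurent_lift_superset:
  assumes "\<And>k. m k 0 = 0" "finite S" "Poly_Mapping.keys f \<subseteq> S"
  shows "laurent_lift m f = (\<Sum>k\<in>S. m k (Poly_Mapping.lookup f k))"
  unfolding laurent_lift_def using assms
  by (intro sum.mono_neutral_left) (auto simp: not_in_keys_iff_lookup_eq_zero)

lemma laurent_lift_monom:
  assumes "\<And>k. m k 0 = 0"
  shows "laurent_lift m (lmonom c k) = m k c"
  using laurent_lift_superset[of m "{k}" "lmonom c k"] assms by auto

lemma laurent_lift_add:
  assumes "\<And>k. m k 0 = 0" "\<And>k a b. m k (a + b) = m k a + m k b"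
  shows "laurent_lift m (f + g) = laurent_lift m f + laurent_lift m g"
proof -
  let ?S = "Poly_Mapping.keys f \<union> Poly_Mapping.keys g"
  have "laurent_lift m h = (\<Sum>k\<in>?S. m k (Poly_Mapping.lookup h k))" if "h \<in> {f, g, f + g}" for h
    using that keys_add[of f g] by (intro laurent_lift_superset assms(1)) auto
  then show ?thesis by (simp add: lookup_add assms(2) sum.distrib)
qed

locale laurent_ring_hom =
  fixes F :: "'a::comm_ring_1 laurent \<Rightarrow> 'b::comm_ring_1"
  assumes add: "F (f + g) = F f + F g"
    and mult: "F (f * g) = F f * F g"
    and one: "F 1 = 1"
begin

lemma zero: "F 0 = 0"
  using add[of 0 0] by simp

lemma minus: "F (- f) = - F f"
  using add[of f "-f"] zero by (simp add: eq_neg_iff_add_eq_0 add.commute)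

lemma diff: "F (f - g) = F f - F g"
  using add[of f "- g"] minus by simp

lemma map_matrix_mult: "map_matrix F (A ** B) = map_matrix F A ** map_matrix F (B :: _ ^ 3 ^ 3)"
  by (simp add: vec_eq_iff matrix_matrix_mult_def sum_3 add mult)

lemma map_matrix_mat: "map_matrix F (mat c) = (mat (F c) :: _ ^ 3 ^ 3)"
  by (simp add: vec_eq_iff mat_def zero)

lemma dvd_one: "c dvd 1 \<Longrightarrow> F c dvd 1"
  by (metis dvd_def mult one)

lemma invertible: "invertible (A :: _ ^ 3 ^ 3) \<Longrightarrow> invertible (map_matrix F A)"
  unfolding invertible_def by (metis map_matrix_mult map_matrix_mat one)

end

lemma laurent_ring_hom_lift:
  fixes m :: "int \<Rightarrow> 'a::comm_ring_1 \<Rightarrow> 'b::comm_ring_1"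
  assumes m_0: "\<And>k. m k 0 = 0" and m_add: "\<And>k a b. m k (a + b) = m k a + m k b"
    and m_mult: "\<And>j k a b. m (j + k) (a * b) = m j a * m k b" and m_1: "m 0 1 = 1"
  shows "laurent_ring_hom (laurent_lift m)"
proof
  fix f g :: "'a laurent"
  show add: "laurent_lift m (f + g) = laurent_lift m f + laurent_lift m g" for f g
    using m_0 m_add by (rule laurent_lift_add)
  have sum: "laurent_lift m (sum h A) = (\<Sum>x\<in>A. laurent_lift m (h x))" for h and A :: "int set"
    by (induction A rule: infinite_finite_induct) (simp_all add: add, simp_all add: laurent_lift_def)
  have expand: "h = (\<Sum>k\<in>Poly_Mapping.keys h. lmonom (Poly_Mapping.lookup h k) k)" for h :: "'a laurent"
    by (rule poly_mapping_eqI)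
       (simp add: lookup_sum lookup_single when_def sum.delta' not_in_keys_iff_lookup_eq_zero)
  have "f * g = (\<Sum>j\<in>Poly_Mapping.keys f. \<Sum>k\<in>Poly_Mapping.keys g.
           lmonom (Poly_Mapping.lookup f j * Poly_Mapping.lookup g k) (j + k))"
    using arg_cong2[OF expand[of f] expand[of g], of "(*)"] by (simp only: sum_product mult_single)
  then show "laurent_lift m (f * g) = laurent_lift m f * laurent_lift m g"
    by (simp add: sum laurent_lift_monom m_0 m_mult) (simp add: laurent_lift_def sum_product)
  show "laurent_lift m 1 = 1"
    using laurent_lift_monom[of m 0 1] m_0 m_1 by (simp only: single_one)
qed

lemma const_add: "to_fract [:a + b:] = to_fract [:a:] + (to_fract [:b:] :: ratfun)"
  by (simp flip: to_fract_add)

lemma const_mult: "to_fract [:a * b:] = to_fract [:a:] * (to_fract [:b:] :: ratfun)"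
  by (simp flip: to_fract_mult)

interpretation to_rat: laurent_ring_hom laurent_to_rat
  unfolding laurent_to_rat_def
  by (rule laurent_ring_hom_lift)
     (simp_all add: const_add const_mult power_int_add algebra_simps pCons_one)

interpretation bar: laurent_ring_hom laurent_bar
  unfolding laurent_bar_def
  by (rule laurent_ring_hom_lift) (simp_all add: single_add mult_single)

interpretation eval: laurent_ring_hom "laurent_eval (-\<i>)"
  unfolding laurent_eval_def
  by (rule laurent_ring_hom_lift) (simp_all add: power_int_add algebra_simps)

lemma laurent_to_rat_monom: "laurent_to_rat (lmonom c k) = to_fract [:c:] * rT powi k"
  unfolding laurent_to_rat_def by (rule laurent_lift_monom) simp

lemma laurent_eval_monom: "laurent_eval z (lmonom c k) = c * z powi k"
  unfolding laurent_eval_def by (rule laurent_lift_monom) simp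

lemma laurent_bar_monom: "laurent_bar (lmonom c k) = lmonom (cnj c) (-k)"
  unfolding laurent_bar_def by (rule laurent_lift_monom) simp

text \<open>
  The valuation at infinity. Its value at \<open>0\<close> is unspecified (mathematically it is \<open>\<infinity>\<close>), so
  \<open>0\<close> is added to the valuation ring by hand.
\<close>

definition v_inf :: "ratfun \<Rightarrow> int" where
  "v_inf f = (THE n. \<exists>p q. p \<noteq> 0 \<and> q \<noteq> 0 \<and> f = Fraction_Field.Fract p q \<and>
                n = int (Polynomial.degree q) - int (Polynomial.degree p))"

definition val_ring :: "ratfun set" where
  "val_ring = {f. f = 0 \<or> 0 \<le> v_inf f}"

lemma v_inf_Fract:
  assumes "p \<noteq> 0" "q \<noteq> 0"
  shows "v_inf (Fraction_Field.Fract p q) = int (Polynomial.degree q) - int (Polynomial.degree p)"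
  unfolding v_inf_def
proof (rule the_equality)
  fix n
  assume "\<exists>p' q'. p' \<noteq> 0 \<and> q' \<noteq> 0 \<and> Fraction_Field.Fract p q = Fraction_Field.Fract p' q' \<and>
            n = int (Polynomial.degree q') - int (Polynomial.degree p')"
  then obtain p' q' where *: "p' \<noteq> 0" "q' \<noteq> 0" "Fraction_Field.Fract p q = Fraction_Field.Fract p' q'"
      "n = int (Polynomial.degree q') - int (Polynomial.degree p')" by blast
  then have "p * q' = p' * q" using assms by (simp add: eq_fract)
  then have "Polynomial.degree p + Polynomial.degree q' = Polynomial.degree p' + Polynomial.degree q"
    using * assms by (metis degree_mult_eq)
  then show "n = int (Polynomial.degree q) - int (Polynomial.degree p)" using * by linarith
qed (use assms in blast)


section \<open>General and projective linear groups\<close>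

definition GL3 :: "('a::comm_ring_1 ^ 3 ^ 3) monoid" where
  "GL3 = \<lparr>carrier = {A. invertible A}, mult = (**), one = mat 1\<rparr>"

definition scalars3 :: "('a::comm_ring_1 ^ 3 ^ 3) set" where
  "scalars3 = {mat c |c. c dvd 1}"

text \<open>
  For the rings used below (a field, and the principal ideal domain of complex Laurent polynomials)
  the projective group is the group of invertible matrices modulo the invertible scalars.
\<close>

definition PGL3 :: "('a::comm_ring_1 ^ 3 ^ 3) set monoid" where
  "PGL3 = GL3 Mod scalars3"

definition proj :: "'a::comm_ring_1 ^ 3 ^ 3 \<Rightarrow> ('a ^ 3 ^ 3) set" where
  "proj A = scalars3 #>\<^bsub>GL3\<^esub> A"

abbreviation mat3 :: "'a::zero \<Rightarrow> 'a \<Rightarrow> 'a \<Rightarrow> 'a \<Rightarrow> 'a \<Rightarrow> 'a \<Rightarrow> 'a \<Rightarrow> 'a \<Rightarrow> 'a \<Rightarrow> 'a ^ 3 ^ 3" where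
  "mat3 a b c d e f g h i \<equiv> vector [vector [a, b, c], vector [d, e, f], vector [g, h, i]]"

abbreviation diag3 :: "'a::zero \<Rightarrow> 'a \<Rightarrow> 'a \<Rightarrow> 'a ^ 3 ^ 3" where
  "diag3 a b c \<equiv> mat3 a 0 0 0 b 0 0 0 c"

lemma mat_mult_left: "mat c ** (A :: 'a::comm_ring_1 ^ 3 ^ 3) = (\<chi> i j. c * A $ i $ j)"
  unfolding vec_eq_iff matrix_matrix_mult_def mat_def forall_3 sum_3 by simp

lemma mat_mult_commute: "A ** mat c = mat c ** (A :: 'a::comm_ring_1 ^ 3 ^ 3)"
  unfolding vec_eq_iff matrix_matrix_mult_def mat_def forall_3 sum_3 by (simp add: mult.commute)

lemma mat_mult_mat: "mat c ** mat d = (mat (c * d) :: 'a::comm_ring_1 ^ 3 ^ 3)"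
  unfolding vec_eq_iff matrix_matrix_mult_def mat_def forall_3 sum_3 by simp

lemma group_GL3: "group (GL3 :: ('a::comm_ring_1 ^ 3 ^ 3) monoid)"
proof (rule groupI)
  fix x :: "'a ^ 3 ^ 3" assume "x \<in> carrier GL3"
  then show "\<exists>y\<in>carrier GL3. y \<otimes>\<^bsub>GL3\<^esub> x = \<one>\<^bsub>GL3\<^esub>"
    by (auto simp: GL3_def invertible_def)
next
  show "\<one>\<^bsub>GL3\<^esub> \<in> carrier (GL3 :: ('a ^ 3 ^ 3) monoid)"
    by (auto simp: GL3_def invertible_def intro: exI[of _ "mat 1"])
qed (auto simp: GL3_def invertible_mult matrix_mul_assoc)

lemma invertible_scalar: "c dvd 1 \<Longrightarrow> invertible (mat c :: 'a::comm_ring_1 ^ 3 ^ 3)"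
  unfolding invertible_def by (metis dvd_def mat_mult_commute mat_mult_mat)

lemma inv_GL3:
  assumes "A ** B = mat 1" "B ** A = mat 1"
  shows "inv\<^bsub>GL3\<^esub> A = B"
proof -
  interpret group "GL3 :: ('a::comm_ring_1 ^ 3 ^ 3) monoid" by (rule group_GL3)
  show ?thesis using assms
    by (intro inv_equality) (auto simp: GL3_def invertible_def)
qed

lemma normal_scalars3: "scalars3 \<lhd> (GL3 :: ('a::comm_ring_1 ^ 3 ^ 3) monoid)"
proof -
  interpret group "GL3 :: ('a ^ 3 ^ 3) monoid" by (rule group_GL3)
  have sub: "subgroup scalars3 (GL3 :: ('a ^ 3 ^ 3) monoid)"
  proof (rule subgroupI)
    show "scalars3 \<subseteq> carrier (GL3 :: ('a ^ 3 ^ 3) monoid)"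
      by (auto simp: scalars3_def GL3_def invertible_scalar)
    show "(scalars3 :: ('a ^ 3 ^ 3) set) \<noteq> {}"
      by (auto simp: scalars3_def intro: exI[of _ 1])
  next
    fix a :: "'a ^ 3 ^ 3" assume "a \<in> scalars3"
    then obtain c d where cd: "a = mat c" "1 = c * d" by (auto simp: scalars3_def dvd_def)
    then have "inv\<^bsub>GL3\<^esub> a = mat d"
      by (intro inv_GL3) (simp_all add: mat_mult_mat mult.commute)
    then show "inv\<^bsub>GL3\<^esub> a \<in> scalars3"
      using cd by (auto simp: scalars3_def intro!: exI[of _ d] intro: dvdI[of _ _ c] simp: mult.commute)
  next
    fix a b :: "'a ^ 3 ^ 3" assume "a \<in> scalars3" "b \<in> scalars3"
    then obtain c d where "a = mat c" "c dvd 1" "b = mat d" "d dvd 1"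
      by (auto simp: scalars3_def)
    moreover from this have "c * d dvd 1" by (metis mult.right_neutral mult_dvd_mono)
    ultimately show "a \<otimes>\<^bsub>GL3\<^esub> b \<in> scalars3"
      by (auto simp: scalars3_def GL3_def mat_mult_mat)
  qed
  show ?thesis
    unfolding normal_inv_iff
  proof (intro conjI ballI sub)
    fix x h :: "'a ^ 3 ^ 3" assume x: "x \<in> carrier GL3" and h: "h \<in> scalars3"
    then have "x \<otimes>\<^bsub>GL3\<^esub> h = h \<otimes>\<^bsub>GL3\<^esub> x"
      by (auto simp: scalars3_def GL3_def mat_mult_commute)
    moreover have "h \<in> carrier GL3" using h sub by (rule subgroup.mem_carrier[rotated])
    ultimately show "x \<otimes>\<^bsub>GL3\<^esub> h \<otimes>\<^bsub>GL3\<^esub> inv\<^bsub>GL3\<^esub> x \<in> scalars3"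
      using x h by (simp add: m_assoc)
  qed
qed

lemma group_PGL3: "group (PGL3 :: ('a::comm_ring_1 ^ 3 ^ 3) set monoid)"
  unfolding PGL3_def by (rule normal.factorgroup_is_group[OF normal_scalars3])

lemma in_proj_iff: "B \<in> proj A \<longleftrightarrow> (\<exists>c. c dvd 1 \<and> B = mat c ** A)"
  by (auto simp: proj_def r_coset_def scalars3_def GL3_def)

lemma proj_carrier: "invertible A \<Longrightarrow> proj A \<in> carrier PGL3"
  by (auto simp: PGL3_def FactGroup_def RCOSETS_def proj_def GL3_def)

lemma PGL3_cases:
  assumes "X \<in> carrier PGL3"
  obtains A where "invertible A" "X = proj A"
  using assms by (auto simp: PGL3_def FactGroup_def RCOSETS_def proj_def GL3_def)

lemma proj_mult:
  assumes "invertible A" "invertible B"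
  shows "proj A \<otimes>\<^bsub>PGL3\<^esub> proj B = proj (A ** B)"
  using normal.rcos_sum[OF normal_scalars3, of A B] assms
  by (simp add: PGL3_def FactGroup_def proj_def) (simp add: GL3_def)

lemma proj_one: "\<one>\<^bsub>PGL3\<^esub> = proj (mat 1)"
  by (auto simp: PGL3_def FactGroup_def in_proj_iff scalars3_def)

lemma proj_inv:
  fixes A B :: "'a::comm_ring_1 ^ 3 ^ 3"
  assumes "A ** B = mat 1" "B ** A = mat 1"
  shows "inv\<^bsub>PGL3\<^esub> proj A = proj B"
proof -
  interpret group "PGL3 :: ('a ^ 3 ^ 3) set monoid" by (rule group_PGL3)
  have "invertible A" "invertible B" using assms by (auto simp: invertible_def)
  then show ?thesis using assms
    by (intro inv_equality) (simp_all add: proj_mult proj_one proj_carrier)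
qed


section \<open>The braid group on four strands and its reduced Burau representation\<close>

text \<open>
  A word is a list of letters; the letter \<open>(s, True)\<close> stands for the generator \<open>s\<close>, and
  \<open>(s, False)\<close> for its inverse. The group is given by Artin's presentation.
\<close>

datatype artin = Sigma1 | Sigma2 | Sigma3

type_synonym braid_word = "(artin \<times> bool) list"

inductive braid_eq :: "braid_word \<Rightarrow> braid_word \<Rightarrow> bool" where
  braid_eq_refl: "braid_eq u u"
| braid_eq_sym: "braid_eq u v \<Longrightarrow> braid_eq v u"
| braid_eq_trans: "braid_eq u v \<Longrightarrow> braid_eq v w \<Longrightarrow> braid_eq u w"
| braid_eq_cong: "braid_eq u v \<Longrightarrow> braid_eq (x @ u @ y) (x @ v @ y)"
| braid_eq_cancel: "braid_eq [(s, b), (s, \<not> b)] []"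
| braid12: "braid_eq [(Sigma1, True), (Sigma2, True), (Sigma1, True)]
                     [(Sigma2, True), (Sigma1, True), (Sigma2, True)]"
| braid23: "braid_eq [(Sigma2, True), (Sigma3, True), (Sigma2, True)]
                     [(Sigma3, True), (Sigma2, True), (Sigma3, True)]"
| braid13: "braid_eq [(Sigma1, True), (Sigma3, True)] [(Sigma3, True), (Sigma1, True)]"

definition braid_class :: "braid_word \<Rightarrow> braid_word set" where
  "braid_class u = {v. braid_eq u v}"

definition B4 :: "braid_word set monoid" where
  "B4 = \<lparr>carrier = range braid_class,
         mult = (\<lambda>X Y. {w. \<exists>u\<in>X. \<exists>v\<in>Y. braid_eq (u @ v) w}),
         one = braid_class []\<rparr>"

fun burau_gen :: "artin \<Rightarrow> int laurent ^ 3 ^ 3" where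
  "burau_gen Sigma1 = mat3 (-lT) 1 0
                           0     1 0
                           0     0 1"
| "burau_gen Sigma2 = mat3 1  0     0
                           lT (-lT) 1
                           0  0     1"
| "burau_gen Sigma3 = mat3 1 0  0
                           0 1  0
                           0 lT (-lT)"

definition burau_letter :: "artin \<times> bool \<Rightarrow> int laurent ^ 3 ^ 3" where
  "burau_letter l = (if snd l then burau_gen (fst l) else matrix_inv (burau_gen (fst l)))"

definition burau_word :: "braid_word \<Rightarrow> int laurent ^ 3 ^ 3" where
  "burau_word w = foldr (\<lambda>l A. burau_letter l ** A) w (mat 1)"

text \<open>
  The value on a braid is the common value on its words (see \<open>burau_class\<close> below).
\<close>

definition burau :: "braid_word set \<Rightarrow> int laurent ^ 3 ^ 3" where
  "burau X = the_elem (burau_word ` X)"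

lemma braid_eq_append: "braid_eq u u' \<Longrightarrow> braid_eq v v' \<Longrightarrow> braid_eq (u @ v) (u' @ v')"
  using braid_eq_cong[of u u' "[]" v] braid_eq_cong[of v v' u' "[]"] by (auto intro: braid_eq_trans)

lemma braid_class_eq_iff: "braid_class u = braid_class v \<longleftrightarrow> braid_eq u v"
  unfolding braid_class_def by (blast intro: braid_eq_refl braid_eq_sym braid_eq_trans)

lemma braid_class_mult: "braid_class u \<otimes>\<^bsub>B4\<^esub> braid_class v = braid_class (u @ v)"
  unfolding braid_class_def B4_def
  by (auto intro: braid_eq_refl braid_eq_sym braid_eq_trans braid_eq_append)

definition inv_word :: "braid_word \<Rightarrow> braid_word" where
  "inv_word w = rev (map (\<lambda>(s, b). (s, \<not> b)) w)"

lemma inv_word_append: "braid_eq (inv_word w @ w) []"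
proof (induction w)
  case Nil
  then show ?case by (simp add: inv_word_def braid_eq_refl)
next
  case (Cons l w)
  obtain s b where l: "l = (s, b)" by (cases l)
  have "braid_eq (inv_word w @ [(s, \<not> b), (s, \<not> \<not> b)] @ w) (inv_word w @ [] @ w)"
    by (intro braid_eq_cong braid_eq_cancel)
  then have "braid_eq (inv_word (l # w) @ l # w) (inv_word w @ w)"
    by (simp add: l inv_word_def)
  then show ?case using Cons.IH by (rule braid_eq_trans)
qed

lemma group_B4: "group B4"
proof (rule groupI)
  have car: "carrier B4 = range braid_class" and one: "\<one>\<^bsub>B4\<^esub> = braid_class []"
    by (simp_all add: B4_def)
  show "\<one>\<^bsub>B4\<^esub> \<in> carrier B4" by (simp add: car one)
  fix x y z assume "x \<in> carrier B4" "y \<in> carrier B4" "z \<in> carrier B4"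
  then show "x \<otimes>\<^bsub>B4\<^esub> y \<in> carrier B4"
    and "x \<otimes>\<^bsub>B4\<^esub> y \<otimes>\<^bsub>B4\<^esub> z = x \<otimes>\<^bsub>B4\<^esub> (y \<otimes>\<^bsub>B4\<^esub> z)"
    and "\<one>\<^bsub>B4\<^esub> \<otimes>\<^bsub>B4\<^esub> x = x"
    by (auto simp: car one braid_class_mult)
next
  fix x assume "x \<in> carrier B4"
  then obtain u where u: "x = braid_class u" by (auto simp: B4_def)
  have "braid_class (inv_word u) \<otimes>\<^bsub>B4\<^esub> x = \<one>\<^bsub>B4\<^esub>"
    unfolding u braid_class_mult by (simp add: B4_def braid_class_eq_iff inv_word_append)
  then show "\<exists>y\<in>carrier B4. y \<otimes>\<^bsub>B4\<^esub> x = \<one>\<^bsub>B4\<^esub>" by (force simp: B4_def)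
qed

lemma matrix_inv_unique:
  fixes A B :: "'a::comm_ring_1 ^ 3 ^ 3"
  assumes "A ** B = mat 1" "B ** A = mat 1"
  shows "matrix_inv A = B"
proof -
  have "A ** matrix_inv A = mat 1 \<and> matrix_inv A ** A = mat 1"
    unfolding matrix_inv_def by (rule someI[of _ B]) (use assms in simp)
  then show ?thesis using assms by (metis matrix_mul_assoc matrix_mul_lid matrix_mul_rid)
qed

lemma invertible_burau_gen: "invertible (burau_gen s)"
proof (cases s)
  case Sigma1
  show ?thesis unfolding invertible_def Sigma1
    by (rule exI[of _ "mat3 (-lTinv) lTinv 0 0 1 0 0 0 1"])
       (simp add: vec_eq_iff forall_3 matrix_matrix_mult_def sum_3 mat_def mult_single)
next
  case Sigma2
  show ?thesis unfolding invertible_def Sigma2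
    by (rule exI[of _ "mat3 1 0 0 1 (-lTinv) lTinv 0 0 1"])
       (simp add: vec_eq_iff forall_3 matrix_matrix_mult_def sum_3 mat_def mult_single)
next
  case Sigma3
  show ?thesis unfolding invertible_def Sigma3
    by (rule exI[of _ "mat3 1 0 0 0 1 0 0 1 (-lTinv)"])
       (simp add: vec_eq_iff forall_3 matrix_matrix_mult_def sum_3 mat_def mult_single)
qed

lemma burau_gen_inv:
  "burau_gen s ** matrix_inv (burau_gen s) = mat 1"
  "matrix_inv (burau_gen s) ** burau_gen s = mat 1"
  using invertible_burau_gen[of s] matrix_inv_unique[of "burau_gen s"]
  unfolding invertible_def by metis+

lemma burau_word_Nil: "burau_word [] = mat 1"
  and burau_word_Cons: "burau_word (l # w) = burau_letter l ** burau_word w"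
  by (simp_all add: burau_word_def)

lemma burau_word_append: "burau_word (u @ v) = burau_word u ** burau_word v"
  by (induction u) (simp_all add: burau_word_Nil burau_word_Cons matrix_mul_assoc)

lemma invertible_burau_word: "invertible (burau_word w)"
proof (induction w)
  case Nil
  show ?case by (auto simp: burau_word_Nil invertible_def intro: exI[of _ "mat 1"])
next
  case (Cons l w)
  have "invertible (burau_letter l)"
    using burau_gen_inv by (auto simp: burau_letter_def invertible_def)
  then show ?case using Cons by (simp add: burau_word_Cons invertible_mult)
qed

lemma burau_word_cong: "braid_eq u v \<Longrightarrow> burau_word u = burau_word v"
proof (induction rule: braid_eq.induct)
  case (braid_eq_cancel s b)
  show ?case
    by (cases b) (simp_all add: burau_word_Nil burau_word_Cons burau_letter_def burau_gen_inv)
next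
  case braid12
  show ?case by (simp add: burau_word_Nil burau_word_Cons burau_letter_def
      vec_eq_iff forall_3 matrix_matrix_mult_def sum_3 mult_single algebra_simps)
next
  case braid23
  show ?case by (simp add: burau_word_Nil burau_word_Cons burau_letter_def
      vec_eq_iff forall_3 matrix_matrix_mult_def sum_3 mult_single algebra_simps)
next
  case braid13
  show ?case by (simp add: burau_word_Nil burau_word_Cons burau_letter_def
      vec_eq_iff forall_3 matrix_matrix_mult_def sum_3 mult_single)
qed (simp_all add: burau_word_append)

lemma burau_class: "burau (braid_class w) = burau_word w"
proof -
  have "burau_word ` braid_class w = {burau_word w}"
    by (auto simp: braid_class_def burau_word_cong[symmetric] intro: braid_eq_refl image_eqI[of _ _ w])
  then show ?thesis by (simp add: burau_def)
qed

lemma burau_generator: "burau (braid_class [(s, True)]) = burau_gen s"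
  by (simp add: burau_class burau_word_Cons burau_word_Nil burau_letter_def)

lemma burau_hom: "burau \<in> hom B4 GL3"
proof (rule homI)
  fix x y assume "x \<in> carrier B4" "y \<in> carrier B4"
  then obtain u v where "x = braid_class u" "y = braid_class v" by (auto simp: B4_def)
  then show "burau (x \<otimes>\<^bsub>B4\<^esub> y) = burau x \<otimes>\<^bsub>GL3\<^esub> burau y"
    by (simp add: braid_class_mult burau_class burau_word_append GL3_def)
qed (auto simp: B4_def GL3_def burau_class invertible_burau_word)


section \<open>The building\<close>

text \<open>A lattice is the span, over the valuation ring, of a basis: here the columns of a matrix.\<close>

definition lattice_of :: "ratfun ^ 3 ^ 3 \<Rightarrow> (ratfun ^ 3) set" where
  "lattice_of A = {A *v x |x. \<forall>i. x $ i \<in> val_ring}"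

definition is_lattice :: "(ratfun ^ 3) set \<Rightarrow> bool" where
  "is_lattice L \<longleftrightarrow> (\<exists>A. invertible A \<and> L = lattice_of A)"

definition homothety_class :: "(ratfun ^ 3) set \<Rightarrow> (ratfun ^ 3) set set" where
  "homothety_class L = {(\<lambda>v. c *s v) ` L |c. c \<noteq> 0}"

definition building_vertices :: "(ratfun ^ 3) set set set" where
  "building_vertices = homothety_class ` {L. is_lattice L}"

definition building_adjacent :: "(ratfun ^ 3) set set \<Rightarrow> (ratfun ^ 3) set set \<Rightarrow> bool" where
  "building_adjacent x y \<longleftrightarrow> x \<noteq> y \<and>
     (\<exists>L\<in>x. \<exists>L'\<in>y. (\<lambda>v. inverse rT *s v) ` L \<subset> L' \<and> L' \<subset> L)"

text \<open>A simplicial complex is represented by its set of simplices, each a finite nonempty vertex set.\<close>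

definition building :: "(ratfun ^ 3) set set set set" where
  "building = {\<sigma>. finite \<sigma> \<and> \<sigma> \<noteq> {} \<and> card \<sigma> \<le> 3 \<and> \<sigma> \<subseteq> building_vertices \<and>
                  (\<forall>x\<in>\<sigma>. \<forall>y\<in>\<sigma>. x \<noteq> y \<longrightarrow> building_adjacent x y)}"

definition full_subcomplex :: "'v set set \<Rightarrow> 'v set \<Rightarrow> 'v set set" where
  "full_subcomplex K V = {\<sigma>\<in>K. \<sigma> \<subseteq> V}"

definition rat_matrix :: "complex laurent ^ 3 ^ 3 \<Rightarrow> ratfun ^ 3 ^ 3" where
  "rat_matrix A = map_matrix laurent_to_rat A"

definition vertex_act ::
  "(complex laurent ^ 3 ^ 3) set \<Rightarrow> (ratfun ^ 3) set set \<Rightarrow> (ratfun ^ 3) set set" where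
  "vertex_act g x = {(\<lambda>v. rat_matrix A *v v) ` L |A L. A \<in> g \<and> L \<in> x}"

definition base_vertex :: "(ratfun ^ 3) set set" where
  "base_vertex = homothety_class (lattice_of (mat 1))"

lemma homothety_class_self: "L \<in> homothety_class L"
  by (auto simp: homothety_class_def intro!: exI[of _ 1])

lemma vertex_act_proj:
  "vertex_act (proj A) (homothety_class (lattice_of B)) =
     homothety_class (lattice_of (rat_matrix A ** B))"
proof -
  have img: "(\<lambda>v. rat_matrix (mat c ** A) *v v) ` (\<lambda>v. d *s v) ` lattice_of B =
      (\<lambda>v. (laurent_to_rat c * d) *s v) ` lattice_of (rat_matrix A ** B)" for c d
  proof -
    have "rat_matrix (mat c ** A) *v (d *s (B *v x)) =
        (laurent_to_rat c * d) *s ((rat_matrix A ** B) *v x)" for x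
      unfolding rat_matrix_def to_rat.map_matrix_mult to_rat.map_matrix_mat
      by (simp add: vec_eq_iff forall_3 matrix_vector_mult_def matrix_matrix_mult_def mat_def sum_3
          algebra_simps)
    then have eq: "(\<lambda>x. rat_matrix (mat c ** A) *v (d *s (B *v x))) =
        (\<lambda>x. (laurent_to_rat c * d) *s ((rat_matrix A ** B) *v x))"
      by (rule ext)
    show ?thesis
      unfolding lattice_of_def setcompr_eq_image image_image eq ..
  qed
  show ?thesis
  proof (intro equalityI subsetI)
    fix Y assume "Y \<in> vertex_act (proj A) (homothety_class (lattice_of B))"
    then obtain c d where "c dvd 1" "d \<noteq> 0"
      and Y: "Y = (\<lambda>v. rat_matrix (mat c ** A) *v v) ` (\<lambda>v. d *s v) ` lattice_of B"
      by (auto simp: vertex_act_def homothety_class_def in_proj_iff)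
    moreover from \<open>c dvd 1\<close> have "laurent_to_rat c \<noteq> 0" using to_rat.dvd_one by fastforce
    ultimately show "Y \<in> homothety_class (lattice_of (rat_matrix A ** B))"
      unfolding Y img homothety_class_def by auto
  next
    fix Y assume "Y \<in> homothety_class (lattice_of (rat_matrix A ** B))"
    then obtain d where d: "d \<noteq> 0"
        "Y = (\<lambda>v. (laurent_to_rat 1 * d) *s v) ` lattice_of (rat_matrix A ** B)"
      by (auto simp: homothety_class_def to_rat.one)
    then have "Y = (\<lambda>v. rat_matrix (mat 1 ** A) *v v) ` (\<lambda>v. d *s v) ` lattice_of B"
      by (simp only: img)
    moreover have "mat 1 ** A \<in> proj A" unfolding in_proj_iff by (rule exI[of _ 1]) simp
    ultimately show "Y \<in> vertex_act (proj A) (homothety_class (lattice_of B))"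
      using d unfolding vertex_act_def homothety_class_def by blast
  qed
qed

lemma vertex_act_building_vertices:
  assumes "g \<in> carrier PGL3" "x \<in> building_vertices"
  shows "vertex_act g x \<in> building_vertices"
proof -
  obtain A where A: "invertible A" "g = proj A" using assms PGL3_cases by blast
  obtain B where B: "invertible B" "x = homothety_class (lattice_of B)"
    using assms by (auto simp: building_vertices_def is_lattice_def)
  have "invertible (rat_matrix A ** B)"
    using A B to_rat.invertible by (simp add: rat_matrix_def invertible_mult)
  then show ?thesis
    unfolding A B vertex_act_proj by (auto simp: building_vertices_def is_lattice_def)
qed

lemma base_vertex_building_vertices: "base_vertex \<in> building_vertices"
  by (auto simp: base_vertex_def building_vertices_def is_lattice_def invertible_def
      intro!: imageI exI[of _ "mat 1"])

definition Delta :: "(complex laurent ^ 3 ^ 3) set set \<Rightarrow> (ratfun ^ 3) set set set set" where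
  "Delta G = full_subcomplex building ((\<lambda>g. vertex_act g base_vertex) ` G)"


section \<open>Simple connectivity of simplicial complexes\<close>

text \<open>
  Points of the geometric realization are given by barycentric coordinates. The realization carries
  the weak topology, which is coherent with the Euclidean topology of the closed simplices; as the
  building is not locally finite, it is in general finer than the topology of pointwise convergence
  of the coordinates.
\<close>

definition cell :: "'v set \<Rightarrow> ('v \<Rightarrow> real) set" where
  "cell \<sigma> = {x. (\<forall>v. 0 \<le> x v) \<and> (\<forall>v. v \<notin> \<sigma> \<longrightarrow> x v = 0) \<and> sum x \<sigma> = 1}"

definition realization :: "'v set set \<Rightarrow> ('v \<Rightarrow> real) topology" where
  "realization K = topology (\<lambda>U. U \<subseteq> (\<Union>\<sigma>\<in>K. cell \<sigma>) \<and>
                      (\<forall>\<sigma>\<in>K. openin (top_of_set (cell \<sigma>)) (U \<inter> cell \<sigma>)))"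

lemma openin_realization:
  "openin (realization K) U \<longleftrightarrow> U \<subseteq> (\<Union>\<sigma>\<in>K. cell \<sigma>) \<and>
     (\<forall>\<sigma>\<in>K. openin (top_of_set (cell \<sigma>)) (U \<inter> cell \<sigma>))"
proof -
  have "istopology (\<lambda>U. U \<subseteq> (\<Union>\<sigma>\<in>K. cell \<sigma>) \<and>
          (\<forall>\<sigma>\<in>K. openin (top_of_set (cell \<sigma>)) (U \<inter> cell \<sigma>)))"
    unfolding istopology_def
  proof (intro conjI allI impI ballI)
    fix S T :: "('a \<Rightarrow> real) set" and \<sigma>
    assume "S \<subseteq> (\<Union>\<sigma>\<in>K. cell \<sigma>) \<and> (\<forall>\<sigma>\<in>K. openin (top_of_set (cell \<sigma>)) (S \<inter> cell \<sigma>))"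
      and "T \<subseteq> (\<Union>\<sigma>\<in>K. cell \<sigma>) \<and> (\<forall>\<sigma>\<in>K. openin (top_of_set (cell \<sigma>)) (T \<inter> cell \<sigma>))"
      and "\<sigma> \<in> K"
    then have "openin (top_of_set (cell \<sigma>)) ((S \<inter> cell \<sigma>) \<inter> (T \<inter> cell \<sigma>))"
      by (meson openin_Int)
    then show "openin (top_of_set (cell \<sigma>)) (S \<inter> T \<inter> cell \<sigma>)"
      by (simp add: Int_ac)
  next
    fix \<U> :: "('a \<Rightarrow> real) set set" and \<sigma>
    assume "\<forall>S\<in>\<U>. S \<subseteq> (\<Union>\<sigma>\<in>K. cell \<sigma>) \<and> (\<forall>\<sigma>\<in>K. openin (top_of_set (cell \<sigma>)) (S \<inter> cell \<sigma>))"
      and "\<sigma> \<in> K"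
    then have "openin (top_of_set (cell \<sigma>)) (\<Union>S\<in>\<U>. S \<inter> cell \<sigma>)" by (intro openin_Union) auto
    then show "openin (top_of_set (cell \<sigma>)) (\<Union>\<U> \<inter> cell \<sigma>)"
      by (simp only: Int_Union2)
  qed blast+
  then show ?thesis by (simp add: realization_def)
qed

text \<open>
  Path connected with trivial fundamental group: every loop is null-homotopic relative to its endpoints.
  Only the restriction of \<open>q\<close> to the unit interval matters.
\<close>

definition simply_connected_space :: "'a topology \<Rightarrow> bool" where
  "simply_connected_space X \<longleftrightarrow> path_connected_space X \<and>
     (\<forall>p. pathin X p \<and> p 0 = p 1 \<longrightarrow>
        homotopic_with (\<lambda>q. q 0 = p 0 \<and> q 1 = p 0) (top_of_set {0..1}) X p (\<lambda>_. p 0))"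


section \<open>The unitary group and its unipotent kernel\<close>

definition bar_matrix :: "complex laurent ^ 3 ^ 3 \<Rightarrow> complex laurent ^ 3 ^ 3" where
  "bar_matrix A = map_matrix laurent_bar A"

definition D_form :: "complex laurent ^ 3 ^ 3" where
  "D_form = diag3 1 (lT + lTinv) (lT + lTinv)"

text \<open>
  The entries of \<open>D_form\<close> are not all units in the Laurent polynomial ring, so the projective
  equality in the definition of the unitary group is one of classes over \<open>\<complex>(t)\<close>.
\<close>

definition PU :: "(complex laurent ^ 3 ^ 3) set set" where
  "PU = {X \<in> carrier PGL3. \<exists>A\<in>X. proj (rat_matrix (bar_matrix A ** D_form ** transpose A)) =
                                  proj (rat_matrix D_form)}"

definition upper_unitriangular :: "complex ^ 3 ^ 3 \<Rightarrow> bool" where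
  "upper_unitriangular M \<longleftrightarrow> (\<forall>i. M $ i $ i = 1) \<and> M $ 2 $ 1 = 0 \<and> M $ 3 $ 1 = 0 \<and> M $ 3 $ 2 = 0"

definition unipotent_kernel :: "(complex laurent ^ 3 ^ 3) set set" where
  "unipotent_kernel =
     {X \<in> PU. \<exists>B\<in>X. upper_unitriangular (map_matrix (laurent_eval (-\<i>)) B)}"


section \<open>The subgroup \<open>\<H>\<close>\<close>

definition k_one_left :: "complex laurent ^ 3 ^ 3" where
  "k_one_left = mat3
     (lconst (1 / sqrt 2) * (1 - lT))            (lconst (1 / sqrt 2) * (-lT))      0
     (lconst (1 / sqrt 2) * (-(lTinv + lT)))     (lconst (1 / sqrt 2) * (1 - lT))   0
     0                                           0                                  1"

definition k_one :: "(complex laurent ^ 3 ^ 3) set" where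
  "k_one = proj (k_one_left ** diag3 1 1 (lconst ((1 + \<i>) / sqrt 2)))"

definition k_infinity :: "(complex laurent ^ 3 ^ 3) set" where
  "k_infinity = proj (diag3 1 (lmonom \<i> 1) 1)"

text \<open>Only applied to unitary matrices (see \<open>unitary_u\<close>).\<close>

definition u_matrix :: "complex ^ 2 ^ 2 \<Rightarrow> complex laurent ^ 3 ^ 3" where
  "u_matrix A = mat3 1 0                     0
                     0 (lconst (A $ 1 $ 1))  (lconst (A $ 1 $ 2))
                     0 (lconst (A $ 2 $ 1))  (lconst (A $ 2 $ 2))"

definition u_class :: "complex ^ 2 ^ 2 \<Rightarrow> (complex laurent ^ 3 ^ 3) set" where
  "u_class A = proj (u_matrix A)"

definition P_mat :: "complex ^ 2 ^ 2" where
  "P_mat = vector [vector [0, 1], vector [-1, 0]]"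

definition Q_mat :: "complex ^ 2 ^ 2" where
  "Q_mat = vector [vector [\<i>, 0], vector [0, -\<i>]]"

definition R_mat :: "complex ^ 2 ^ 2" where
  "R_mat = vector [vector [0, \<i>], vector [\<i>, 0]]"

definition conj_by_u ::
  "complex ^ 2 ^ 2 \<Rightarrow> (complex laurent ^ 3 ^ 3) set \<Rightarrow> (complex laurent ^ 3 ^ 3) set" where
  "conj_by_u A X = u_class A \<otimes>\<^bsub>PGL3\<^esub> X \<otimes>\<^bsub>PGL3\<^esub> inv\<^bsub>PGL3\<^esub> (u_class A)"

definition H_gens :: "(complex laurent ^ 3 ^ 3) set set" where
  "H_gens = {k_infinity, conj_by_u P_mat k_infinity,
             k_one, conj_by_u P_mat k_one, conj_by_u Q_mat k_one, conj_by_u R_mat k_one}"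

definition H_group :: "(complex laurent ^ 3 ^ 3) set set" where
  "H_group = generate PGL3 H_gens"


subsection \<open>\<open>\<H>\<close> lies in the unipotent kernel\<close>

definition unitary_upto :: "complex laurent ^ 3 ^ 3 \<Rightarrow> bool" where
  "unitary_upto A \<longleftrightarrow> (\<exists>c. c \<noteq> 0 \<and> rat_matrix (bar_matrix A ** D_form ** transpose A) =
                                mat c ** rat_matrix D_form)"

definition unipotent_upto :: "complex laurent ^ 3 ^ 3 \<Rightarrow> bool" where
  "unipotent_upto A \<longleftrightarrow> (\<exists>c. c dvd 1 \<and>
     upper_unitriangular (map_matrix (laurent_eval (-\<i>)) (mat c ** A)))"

lemma proj_eq_iff: "proj A = proj B \<longleftrightarrow> (\<exists>c. c dvd 1 \<and> A = mat c ** B)"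
proof
  assume "proj A = proj B"
  moreover have "A \<in> proj A" unfolding in_proj_iff by (rule exI[of _ 1]) simp
  ultimately show "\<exists>c. c dvd 1 \<and> A = mat c ** B" by (simp add: in_proj_iff)
next
  assume "\<exists>c. c dvd 1 \<and> A = mat c ** B"
  then obtain c d where cd: "1 = c * d" "A = mat c ** B" by (auto simp: dvd_def)
  then have B: "B = mat d ** A"
    by (metis matrix_mul_assoc mat_mult_mat matrix_mul_lid mult.commute)
  have "e dvd 1 \<Longrightarrow> \<exists>c'. c' dvd 1 \<and> mat e ** A = mat c' ** B" for e
    by (rule exI[of _ "e * c"]) (metis cd dvd_def matrix_mul_assoc mat_mult_mat mult_dvd_mono mult_1)
  moreover have "e dvd 1 \<Longrightarrow> \<exists>c'. c' dvd 1 \<and> mat e ** B = mat c' ** A" for e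
    by (rule exI[of _ "e * d"])
      (metis B cd dvd_def matrix_mul_assoc mat_mult_mat mult_dvd_mono mult_1 mult.commute)
  ultimately show "proj A = proj B" by (auto simp: in_proj_iff set_eq_iff)
qed

lemma PU_proj:
  assumes "invertible A" "unitary_upto A"
  shows "proj A \<in> PU"
proof -
  have "A \<in> proj A" unfolding in_proj_iff by (rule exI[of _ 1]) simp
  then show ?thesis using assms
    by (auto simp: PU_def proj_carrier proj_eq_iff unitary_upto_def dvd_field_iff intro!: bexI[of _ A])
qed

lemma unipotent_kernel_proj:
  assumes "invertible A" "unitary_upto A" "unipotent_upto A"
  shows "proj A \<in> unipotent_kernel"
proof -
  obtain c where "c dvd 1" "upper_unitriangular (map_matrix (laurent_eval (-\<i>)) (mat c ** A))"
    using assms(3) by (auto simp: unipotent_upto_def)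
  moreover from this(1) have "mat c ** A \<in> proj A" unfolding in_proj_iff by (intro exI[of _ c] conjI refl)
  ultimately show ?thesis
    using PU_proj[OF assms(1,2)] unfolding unipotent_kernel_def by (intro CollectI conjI bexI[of _ "mat c ** A"])
qed

lemma mat_left_commute: "(A :: 'a::comm_ring_1 ^ 3 ^ 3) ** (mat c ** B) = mat c ** (A ** B)"
  by (simp only: matrix_mul_assoc mat_mult_commute[of A])

lemma rat_matrix_mult: "rat_matrix (A ** B) = rat_matrix A ** rat_matrix B"
  by (simp add: rat_matrix_def to_rat.map_matrix_mult)

lemma rat_matrix_scalar: "rat_matrix (mat c ** A) = mat (laurent_to_rat c) ** rat_matrix A"
  by (simp add: rat_matrix_def to_rat.map_matrix_mult to_rat.map_matrix_mat)

lemma unitary_upto_scalar: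
  assumes "c dvd 1" "unitary_upto A"
  shows "unitary_upto (mat c ** A)"
proof -
  obtain e where e: "e \<noteq> 0"
      "rat_matrix (bar_matrix A ** D_form ** transpose A) = mat e ** rat_matrix D_form"
    using assms by (auto simp: unitary_upto_def)
  have "transpose (mat c ** A) = mat c ** transpose A"
    by (metis mat_mult_commute matrix_transpose_mul transpose_mat)
  then have "bar_matrix (mat c ** A) ** D_form ** transpose (mat c ** A) =
      mat (laurent_bar c) ** (bar_matrix A ** D_form) ** (mat c ** transpose A)"
    by (simp add: bar_matrix_def bar.map_matrix_mult bar.map_matrix_mat matrix_mul_assoc)
  also have "\<dots> = mat c ** (mat (laurent_bar c) ** (bar_matrix A ** D_form) ** transpose A)"
    by (rule mat_left_commute)
  also have "\<dots> = mat (laurent_bar c * c) ** (bar_matrix A ** D_form ** transpose A)"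
    by (simp only: matrix_mul_assoc mat_mult_mat mult.commute)
  finally have "bar_matrix (mat c ** A) ** D_form ** transpose (mat c ** A) =
      mat (laurent_bar c * c) ** (bar_matrix A ** D_form ** transpose A)" .
  then have "rat_matrix (bar_matrix (mat c ** A) ** D_form ** transpose (mat c ** A)) =
      mat (laurent_to_rat (laurent_bar c * c) * e) ** rat_matrix D_form"
    by (simp only: rat_matrix_scalar e(2)) (simp only: matrix_mul_assoc mat_mult_mat)
  moreover have "laurent_to_rat (laurent_bar c * c) dvd 1"
    using assms(1) bar.dvd_one to_rat.dvd_one by (metis mult_dvd_mono mult_1)
  ultimately show ?thesis using e(1) unfolding unitary_upto_def
    by (metis dvd_field_iff mult_eq_0_iff zero_neq_one)
qed

lemma unipotent_kernel_cases:
  assumes "X \<in> unipotent_kernel"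
  obtains A where "invertible A" "X = proj A" "unitary_upto A"
    "upper_unitriangular (map_matrix (laurent_eval (-\<i>)) A)"
proof -
  have "X \<in> carrier PGL3" using assms by (auto simp: unipotent_kernel_def PU_def)
  then obtain A0 where A0: "invertible A0" "X = proj A0" by (rule PGL3_cases)
  from assms obtain B where B: "B \<in> proj A0"
      "proj (rat_matrix (bar_matrix B ** D_form ** transpose B)) = proj (rat_matrix D_form)"
    by (auto simp: unipotent_kernel_def PU_def A0)
  have "unitary_upto B"
    using B(2) unfolding proj_eq_iff unitary_upto_def by (metis dvd_field_iff zero_neq_one)
  then obtain b where b: "b dvd 1" "unitary_upto (mat b ** A0)"
    using B(1) unfolding in_proj_iff by blast
  from assms obtain c where c: "c dvd 1"
      "upper_unitriangular (map_matrix (laurent_eval (-\<i>)) (mat c ** A0))"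
    unfolding unipotent_kernel_def A0 by (auto simp: in_proj_iff)
  from b(1) obtain b' where b': "b * b' = 1" by (auto simp: dvd_def)
  have "unitary_upto (mat (c * b') ** (mat b ** A0))"
  proof (rule unitary_upto_scalar[OF _ b(2)])
    have "b' dvd 1" using b' by (metis dvd_triv_right)
    then show "c * b' dvd 1" using c(1) mult_dvd_mono[of c 1 b' 1] by simp
  qed
  moreover have "mat (c * b') ** (mat b ** A0) = mat c ** A0"
    using b' by (simp add: matrix_mul_assoc mat_mult_mat mult.assoc mult.commute[of b'])
  ultimately have "unitary_upto (mat c ** A0)" by simp
  moreover have "invertible (mat c ** A0)"
    using A0(1) c(1) by (simp add: invertible_mult invertible_scalar)
  moreover have "proj (mat c ** A0) = X"
    using c(1) unfolding A0(2) proj_eq_iff by blast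
  ultimately show ?thesis using c(2) that by blast
qed

lemma unitary_upto_mult:
  assumes "unitary_upto A" "unitary_upto B"
  shows "unitary_upto (A ** B)"
proof -
  obtain a b where ab: "a \<noteq> 0" "b \<noteq> 0"
      "rat_matrix (bar_matrix A ** D_form ** transpose A) = mat a ** rat_matrix D_form"
      "rat_matrix (bar_matrix B ** D_form ** transpose B) = mat b ** rat_matrix D_form"
    using assms by (auto simp: unitary_upto_def)
  have "rat_matrix (bar_matrix (A ** B) ** D_form ** transpose (A ** B)) =
      rat_matrix (bar_matrix A) ** rat_matrix (bar_matrix B ** D_form ** transpose B) **
        rat_matrix (transpose A)"
    by (simp add: rat_matrix_def bar_matrix_def bar.map_matrix_mult to_rat.map_matrix_mult
        matrix_transpose_mul matrix_mul_assoc)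
  also have "\<dots> = mat b ** rat_matrix (bar_matrix A ** D_form ** transpose A)"
    unfolding ab(4) mat_left_commute by (simp only: rat_matrix_mult matrix_mul_assoc)
  also have "\<dots> = mat (b * a) ** rat_matrix D_form"
    unfolding ab(3) by (simp add: matrix_mul_assoc mat_mult_mat)
  finally show ?thesis using ab(1,2) unfolding unitary_upto_def by (metis mult_eq_0_iff)
qed

lemma unitary_upto_inverse:
  assumes "unitary_upto A" "A ** B = mat 1" "B ** A = mat 1"
  shows "unitary_upto B"
proof -
  obtain a where a: "a \<noteq> 0"
      "rat_matrix (bar_matrix A ** D_form ** transpose A) = mat a ** rat_matrix D_form"
    using assms by (auto simp: unitary_upto_def)
  have 1: "bar_matrix B ** bar_matrix A = mat 1" "transpose A ** transpose B = mat 1"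
    using bar.map_matrix_mult[of B A] matrix_transpose_mul[of B A]
    unfolding assms(3) bar_matrix_def transpose_mat bar.map_matrix_mat bar.one by metis+
  have "bar_matrix B ** (bar_matrix A ** D_form ** transpose A) ** transpose B =
      (bar_matrix B ** bar_matrix A) ** D_form ** (transpose A ** transpose B)"
    by (simp only: matrix_mul_assoc)
  also have "\<dots> = D_form" by (simp add: 1)
  finally have "rat_matrix D_form = rat_matrix (bar_matrix B) **
      rat_matrix (bar_matrix A ** D_form ** transpose A) ** rat_matrix (transpose B)"
    by (simp only: rat_matrix_mult[symmetric])
  also have "\<dots> = mat a ** (rat_matrix (bar_matrix B) ** rat_matrix D_form) ** rat_matrix (transpose B)"
    unfolding a(2) mat_left_commute ..
  also have "\<dots> = mat a ** rat_matrix (bar_matrix B ** D_form ** transpose B)"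
    by (simp only: rat_matrix_mult matrix_mul_assoc)
  finally have "mat (inverse a) ** rat_matrix D_form = 
      mat (inverse a) ** (mat a ** rat_matrix (bar_matrix B ** D_form ** transpose B))"
    by simp
  also have "\<dots> = rat_matrix (bar_matrix B ** D_form ** transpose B)"
    using a(1) by (simp add: matrix_mul_assoc mat_mult_mat)
  finally show ?thesis using a(1) unfolding unitary_upto_def by (metis inverse_nonzero_iff_nonzero)
qed

lemma subgroup_unipotent_kernel: "subgroup unipotent_kernel PGL3"
proof -
  interpret group "PGL3 :: (complex laurent ^ 3 ^ 3) set monoid" by (rule group_PGL3)
  have one_unit: "(1 :: complex laurent) dvd 1" by simp
  show ?thesis
  proof (rule subgroupI)
    show "unipotent_kernel \<subseteq> carrier PGL3" by (auto simp: unipotent_kernel_def PU_def)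
    have "unitary_upto (mat 1)"
      unfolding unitary_upto_def
      by (rule exI[of _ 1]) (simp add: bar_matrix_def bar.map_matrix_mat bar.one transpose_mat)
    moreover have "unipotent_upto (mat 1)"
      unfolding unipotent_upto_def
      by (rule exI[of _ 1])
         (simp add: eval.map_matrix_mat eval.one, simp add: upper_unitriangular_def mat_def)
    moreover have "invertible (mat 1 :: complex laurent ^ 3 ^ 3)" by (simp add: invertible_scalar)
    ultimately show "unipotent_kernel \<noteq> {}" using unipotent_kernel_proj by blast
  next
    fix X assume "X \<in> unipotent_kernel"
    then obtain A where A: "invertible A" "X = proj A" "unitary_upto A"
      "upper_unitriangular (map_matrix (laurent_eval (-\<i>)) A)" by (rule unipotent_kernel_cases)
    then obtain B where B: "A ** B = mat 1" "B ** A = mat 1" by (auto simp: invertible_def)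
    have "map_matrix (laurent_eval (-\<i>)) B ** map_matrix (laurent_eval (-\<i>)) A = mat 1"
      by (simp add: B eval.map_matrix_mat eval.one flip: eval.map_matrix_mult)
    then have "upper_unitriangular (map_matrix (laurent_eval (-\<i>)) B)"
      using A(4) unfolding upper_unitriangular_def
      by (clarsimp simp: vec_eq_iff forall_3 matrix_matrix_mult_def sum_3 mat_def)
    then have "unipotent_upto B" unfolding unipotent_upto_def by (intro exI[of _ 1]) simp
    moreover have "invertible B" using B by (auto simp: invertible_def)
    ultimately show "inv\<^bsub>PGL3\<^esub> X \<in> unipotent_kernel"
      unfolding A(2) proj_inv[OF B] using unitary_upto_inverse[OF A(3) B]
      by (intro unipotent_kernel_proj)
  next
    fix X Y assume "X \<in> unipotent_kernel" "Y \<in> unipotent_kernel"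
    then obtain A B where A: "invertible A" "X = proj A" "unitary_upto A"
      "upper_unitriangular (map_matrix (laurent_eval (-\<i>)) A)"
      and B: "invertible B" "Y = proj B" "unitary_upto B"
      "upper_unitriangular (map_matrix (laurent_eval (-\<i>)) B)"
      using unipotent_kernel_cases by metis
    have "upper_unitriangular (map_matrix (laurent_eval (-\<i>)) (A ** B))"
      using A(4) B(4) unfolding upper_unitriangular_def eval.map_matrix_mult
      by (simp add: forall_3 matrix_matrix_mult_def sum_3)
    then have "unipotent_upto (A ** B)" unfolding unipotent_upto_def by (intro exI[of _ 1]) simp
    then show "X \<otimes>\<^bsub>PGL3\<^esub> Y \<in> unipotent_kernel"
      unfolding A(2) B(2) proj_mult[OF A(1) B(1)] using A(1,3) B(1,3)
      by (intro unipotent_kernel_proj unitary_upto_mult) (simp_all add: invertible_mult)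
  qed
qed

definition strictly_unipotent :: "complex laurent ^ 3 ^ 3 \<Rightarrow> bool" where
  "strictly_unipotent A \<longleftrightarrow> (\<exists>c. c dvd 1 \<and>
     upper_unitriangular (map_matrix (laurent_eval (-\<i>)) (mat c ** A)) \<and>
     map_matrix (laurent_eval (-\<i>)) (mat c ** A) $ 2 $ 3 = 0)"

lemma upper_unitriangular_conj:
  fixes a b :: "complex ^ 2 ^ 2" and M :: "complex ^ 3 ^ 3"
  assumes "upper_unitriangular M" "M $ 2 $ 3 = 0" "a ** b = mat 1"
  shows "upper_unitriangular
    (map_matrix (laurent_eval (-\<i>)) (u_matrix a) ** M ** map_matrix (laurent_eval (-\<i>)) (u_matrix b))"
  using assms
  unfolding upper_unitriangular_def vec_eq_iff forall_3 forall_2 matrix_matrix_mult_def mat_def u_matrix_def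
  by (simp add: sum_3 sum_2 laurent_eval_monom eval.zero eval.one)

lemma conj_by_u_unipotent_kernel:
  assumes K: "invertible K" "unitary_upto K" "strictly_unipotent K"
    and ab: "a ** b = mat 1" and ua: "unitary_upto (u_matrix a)"
  shows "conj_by_u a (proj K) \<in> unipotent_kernel"
proof -
  have u_mult: "u_matrix x ** u_matrix y = mat 1" if "x ** y = mat 1" for x y
    using that
    by (simp add: u_matrix_def vec_eq_iff forall_3 forall_2 matrix_matrix_mult_def sum_3 sum_2 mat_def
        mult_single flip: single_add)
  have "b ** a = mat 1" using ab by (simp add: matrix_left_right_inverse)
  with ab have u: "u_matrix a ** u_matrix b = mat 1" "u_matrix b ** u_matrix a = mat 1"
    by (simp_all add: u_mult)
  then have inv: "invertible (u_matrix a)" "invertible (u_matrix b)" by (auto simp: invertible_def)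
  have eq: "conj_by_u a (proj K) = proj (u_matrix a ** K ** u_matrix b)"
    unfolding conj_by_u_def u_class_def proj_inv[OF u] using inv K(1)
    by (simp add: proj_mult invertible_mult)
  from K(3) obtain c where c: "c dvd 1"
      "upper_unitriangular (map_matrix (laurent_eval (-\<i>)) (mat c ** K))"
      "map_matrix (laurent_eval (-\<i>)) (mat c ** K) $ 2 $ 3 = 0"
    by (auto simp: strictly_unipotent_def)
  have "mat c ** (u_matrix a ** K ** u_matrix b) = u_matrix a ** (mat c ** K) ** u_matrix b"
    by (simp only: matrix_mul_assoc mat_mult_commute[of "u_matrix a"])
  then have "unipotent_upto (u_matrix a ** K ** u_matrix b)"
    unfolding unipotent_upto_def using c(1) upper_unitriangular_conj[OF c(2,3) ab]
    by (intro exI[of _ c]) (simp add: eval.map_matrix_mult)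
  then show ?thesis
    unfolding eq using inv K(1,2) ua unitary_upto_inverse[OF ua u]
    by (intro unipotent_kernel_proj) (simp_all add: invertible_mult unitary_upto_mult)
qed

lemma unitary_uptoI:
  assumes "bar_matrix A ** D_form ** transpose A = D_form"
  shows "unitary_upto A"
  unfolding unitary_upto_def assms by (rule exI[of _ 1]) simp

lemma T_Tinv: "lT * lTinv = (1 :: 'a::comm_ring_1 laurent)"
  by (simp add: mult_single)

lemmas bar_simps = bar.add bar.mult bar.minus bar.diff bar.zero bar.one laurent_bar_monom
lemmas eval_simps = eval.add eval.mult eval.minus eval.diff eval.zero eval.one laurent_eval_monom

lemma unitary_u:
  "unitary_upto (u_matrix P_mat)" "unitary_upto (u_matrix Q_mat)" "unitary_upto (u_matrix R_mat)"
  by (rule unitary_uptoI,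
      simp add: vec_eq_iff forall_3 matrix_matrix_mult_def sum_3 transpose_def bar_matrix_def
        D_form_def u_matrix_def P_mat_def Q_mat_def R_mat_def bar_simps mult_single algebra_simps)+

lemma k_infinity_props:
  fixes K :: "complex laurent ^ 3 ^ 3" defines "K \<equiv> diag3 1 (lmonom \<i> 1) 1"
  shows "invertible K" "unitary_upto K" "strictly_unipotent K"
proof -
  show "invertible K" unfolding invertible_def K_def
    by (rule exI[of _ "diag3 1 (lmonom (-\<i>) (-1)) 1"])
       (simp add: vec_eq_iff forall_3 matrix_matrix_mult_def sum_3 mat_def mult_single)
  show "unitary_upto K" unfolding K_def
    by (rule unitary_uptoI)
       (simp add: vec_eq_iff forall_3 matrix_matrix_mult_def sum_3 transpose_def bar_matrix_def
        D_form_def bar_simps mult_single algebra_simps)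
  show "strictly_unipotent K" unfolding strictly_unipotent_def K_def
    by (rule exI[of _ 1]) (simp add: upper_unitriangular_def forall_3 eval_simps)
qed

lemma k_one_props:
  fixes K :: "complex laurent ^ 3 ^ 3" defines "K \<equiv> k_one_left ** diag3 1 1 (lconst ((1 + \<i>) / sqrt 2))"
  shows "invertible K" "unitary_upto K" "strictly_unipotent K"
proof -
  define r :: complex where "r = 1 / complex_of_real (sqrt 2)"
  have r2: "2 * (r * r) = 1" unfolding r_def
    by (simp flip: of_real_mult)
  have cnj_r: "cnj r = r" by (simp add: r_def)
  define s where "s = lconst r"
  define w where "w = lconst ((1 + \<i>) * r)"
  define w' where "w' = lconst ((1 - \<i>) * r)"
  have "(1 + \<i>) * r * ((1 - \<i>) * r) = 2 * (r * r)" by (simp add: algebra_simps)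
  then have ww': "w * w' = 1" unfolding w_def w'_def mult_single r2 by simp
  have "lconst (2 :: complex) = 2" by (metis single_numeral)
  then have s2: "2 * (s * s) = 1" unfolding s_def mult_single
    by (metis mult_single r2 add_0 single_one)
  have bar: "laurent_bar s = s" "laurent_bar w = w'"
    by (simp_all add: s_def w_def w'_def laurent_bar_monom cnj_r)
  have K: "K = mat3 (s * (1 - lT)) (s * (- lT)) 0
                    (s * (-(lTinv + lT))) (s * (1 - lT)) 0
                    0 0 w"
    unfolding K_def k_one_left_def s_def w_def r_def
    by (simp add: vec_eq_iff forall_3 matrix_matrix_mult_def sum_3)
  obtain x y :: "complex laurent" where xy: "x = lT" "y = lTinv" by blast
  have xy1: "x * y = 1" unfolding xy by (rule T_Tinv)
  have barxy: "laurent_bar x = y" "laurent_bar y = x" by (simp_all add: xy laurent_bar_monom)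
  note K = K[folded xy]
  show "invertible K" unfolding invertible_def K
    using xy1 s2 ww'
    by (intro exI[of _ "mat3 (s * (1 - y)) (- s) 0 (s * (-(y * y + 1))) (s * (1 - y)) 0 0 0 w'"])
       (auto simp: vec_eq_iff forall_3 matrix_matrix_mult_def sum_3 mat_def; algebra)
  show "unitary_upto K" unfolding K
    by (rule unitary_uptoI, unfold D_form_def, fold xy)
       (auto simp: vec_eq_iff forall_3 matrix_matrix_mult_def sum_3 transpose_def bar_matrix_def
        bar barxy bar_simps; use xy1 s2 ww' in algebra)
  show "strictly_unipotent K" unfolding strictly_unipotent_def K
  proof (intro exI[of _ w'] conjI)
    show "w' dvd 1" using ww' by (metis dvd_triv_right)
  qed (use r2 in \<open>simp_all add: upper_unitriangular_def forall_3 eval_simps xy w'_def s_def w_def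
          mat_mult_left algebra_simps\<close>)
qed

lemma H_group_unipotent_kernel: "H_group \<subseteq> unipotent_kernel"
proof -
  have strict: "proj K \<in> unipotent_kernel"
    if "invertible K" "unitary_upto K" "strictly_unipotent K" for K
    using that by (intro unipotent_kernel_proj) (auto simp: unipotent_upto_def strictly_unipotent_def)
  have inv: "P_mat ** - P_mat = mat 1" "Q_mat ** - Q_mat = mat 1" "R_mat ** - R_mat = mat 1"
    by (simp_all add: P_mat_def Q_mat_def R_mat_def vec_eq_iff forall_2 matrix_matrix_mult_def
        sum_2 mat_def)
  have "H_gens \<subseteq> unipotent_kernel"
    unfolding H_gens_def k_infinity_def k_one_def
    using strict[OF k_infinity_props] strict[OF k_one_props]
      conj_by_u_unipotent_kernel[OF k_infinity_props inv(1) unitary_u(1)]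
      conj_by_u_unipotent_kernel[OF k_one_props inv(1) unitary_u(1)]
      conj_by_u_unipotent_kernel[OF k_one_props inv(2) unitary_u(2)]
      conj_by_u_unipotent_kernel[OF k_one_props inv(3) unitary_u(3)]
    by simp
  then show ?thesis
    unfolding H_group_def
    by (intro group.generate_subgroup_incl group_PGL3 subgroup_unipotent_kernel)
qed

end

theory Submission
  imports Defs
begin

text \<open>
  The braids \<open>a = \<sigma>\<^sub>1 \<sigma>\<^sub>3\<^sup>-\<^sup>1\<close> and \<open>b = \<sigma>\<^sub>2 a \<sigma>\<^sub>2\<^sup>-\<^sup>1\<close> generate a normal subgroup \<open>F\<close> with \<open>B\<^sub>4 = F \<langle>\<sigma>\<^sub>1, \<sigma>\<^sub>2\<rangle>\<close>.
  If the kernel of the Burau representation meets \<open>F\<close> trivially, then it centralises \<open>F\<close>; its elements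
  then act trivially on the abelianisation of \<open>F\<close> and have exponent sum \<open>0\<close>, which forces them to be
  trivial.

  In a suitable basis the matrices of \<open>a\<close> and \<open>b\<close> are, up to scalars, products of elements of \<open>H\<close> and
  of the quaternion group generated by \<open>u[P]\<close> and \<open>u[Q]\<close>, so a reduced word in \<open>a, b\<close> that lies in the
  kernel yields a closed edge path in \<open>\<Delta>(H)\<close>. The transition matrices of the edges of \<open>\<Delta>(H)\<close> are classified, and a
  cocycle on them with values in the permutations of the free group on \<open>D, Y, Z\<close> is defined; being a
  cocycle on a simply connected complex, its product along the closed path is the identity. For the
  path of a reduced word the product maps \<open>1\<close> to a word without cancellation in the squares of
  \<open>D\<^sup>\<plusminus>\<^sup>1, Y\<^sup>\<plusminus>\<^sup>1, Z\<^sup>\<plusminus>\<^sup>1\<close>, with one factor per letter, so the word is empty.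
\<close>

text \<open>The target of the cocycle is the right-angled Artin group of the path Y - W - V - Z: its
  only relations are that neighbours commute. With D = V W^-1 it is the free group on D, Y, Z
  extended by W, so it acts on that free group: D, Y, Z by left multiplication, W by an
  automorphism. The three commutations are what the triangles demand: complementary projections give
  V^2 W^2 V^-2 W^-2 = 1, and two opposite edges with a nonzero off-diagonal entry in the first row
  give W^-1 Y^e W^-1 Y^-e W^2 = 1, or the same with V and Z. The squares of D, Y and Z nevertheless
  remain free. The obstacle is a triangle with three edges of the latter kind, which would impose a
  further relation. It is excluded because at t = -i the first rows of the matrices from H lie in
  the discrete set (1+i)/2 Z[i], where a parity argument applies. The same discreteness keeps the
  list of edge matrices short. The quaternion factors are in general not unipotent at t = -i, so
  they cannot be edges of the path; they are pushed to the right end of the word, where the value at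
  t = -i shows that nothing is left of them.\<close>

section \<open>Cocycles on simply connected complexes\<close>

lemma topspace_realization: "topspace (realization K) = (\<Union>\<sigma>\<in>K. cell \<sigma>)"
proof (rule antisym)
  show "topspace (realization K) \<subseteq> (\<Union>\<sigma>\<in>K. cell \<sigma>)"
    using openin_topspace[of "realization K"] unfolding openin_realization by blast
  have "openin (realization K) (\<Union>\<sigma>\<in>K. cell \<sigma>)"
    unfolding openin_realization
    by (metis Int_absorb1 UN_upper openin_subtopology_self subset_refl)
  then show "(\<Union>\<sigma>\<in>K. cell \<sigma>) \<subseteq> topspace (realization K)"
    by (rule openin_subset)
qed

text \<open>Open vertex stars are the cover to which the Lebesgue number is applied. By
  \<open>cell_support\<close>, vertices whose stars share a point lie in one simplex, and there the
  cocycle identity is available.\<close>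

lemma openin_realization_star:
  "openin (realization K) {x \<in> topspace (realization K). 0 < x v}"
  unfolding openin_realization topspace_realization
proof (intro conjI ballI)
  fix \<sigma> assume "\<sigma> \<in> K"
  have "open {x :: 'a \<Rightarrow> real. 0 < x v}"
    by (intro open_Collect_less continuous_intros continuous_on_product_coordinates)
  then have "openin (top_of_set (cell \<sigma>)) (cell \<sigma> \<inter> {x. 0 < x v})"
    by (rule openin_open_Int)
  moreover have "{x \<in> \<Union>\<sigma>\<in>K. cell \<sigma>. 0 < x v} \<inter> cell \<sigma> = cell \<sigma> \<inter> {x. 0 < x v}"
    using \<open>\<sigma> \<in> K\<close> by auto
  ultimately show "openin (top_of_set (cell \<sigma>)) ({x \<in> \<Union>\<sigma>\<in>K. cell \<sigma>. 0 < x v} \<inter> cell \<sigma>)"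
    by simp
qed blast

lemma continuous_map_cell_realization:
  "\<sigma> \<in> K \<Longrightarrow> continuous_map (top_of_set (cell \<sigma>)) (realization K) (\<lambda>x. x)"
  unfolding continuous_map_def topspace_realization
proof (intro conjI allI impI)
  fix U assume "\<sigma> \<in> K" "openin (realization K) U"
  then have "openin (top_of_set (cell \<sigma>)) (U \<inter> cell \<sigma>)"
    unfolding openin_realization by blast
  moreover have "{x \<in> topspace (top_of_set (cell \<sigma>)). x \<in> U} = U \<inter> cell \<sigma>" by auto
  ultimately show "openin (top_of_set (cell \<sigma>)) {x \<in> topspace (top_of_set (cell \<sigma>)). x \<in> U}"
    by simp
qed auto

lemma cell_support:
  assumes "x \<in> cell \<sigma>" "0 < x v"
  shows "v \<in> \<sigma>"
  using assms by (auto simp: cell_def)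

text \<open>Two summands rather than a case distinction, so that a = b is allowed and gives the
  vertex itself: constant steps of a path need no separate treatment.\<close>

definition edge_point :: "'v \<Rightarrow> 'v \<Rightarrow> real \<Rightarrow> 'v \<Rightarrow> real" where
  "edge_point a b s = (\<lambda>v. (if v = a then 1 - s else 0) + (if v = b then s else 0))"

lemma continuous_on_if_const:
  "continuous_on S f \<Longrightarrow> continuous_on S (\<lambda>x. if b then f x else (0 :: real))"
  by (cases b) simp_all

lemma edge_point_cell:
  assumes "finite \<sigma>" "a \<in> \<sigma>" "b \<in> \<sigma>" "0 \<le> s" "s \<le> 1"
  shows "edge_point a b s \<in> cell \<sigma>"
  using assms by (auto simp: cell_def edge_point_def sum.distrib)

lemma edge_point_0: "edge_point a b 0 = (\<lambda>v. if v = a then 1 else 0)"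
  and edge_point_1: "edge_point a b 1 = (\<lambda>v. if v = b then 1 else 0)"
  by (auto simp: edge_point_def)

lemma edge_point_pos: "0 < edge_point a b s v \<Longrightarrow> v = a \<or> v = b"
  by (auto simp: edge_point_def split: if_splits)

definition edge_loop :: "(nat \<Rightarrow> 'v) \<Rightarrow> nat \<Rightarrow> real \<Rightarrow> 'v \<Rightarrow> real" where
  "edge_loop x m s = (let k = nat \<lfloor>real m * s\<rfloor> in edge_point (x k) (x (Suc k)) (real m * s - real k))"

text \<open>At the right end of the interval the floor already selects the next piece; both formulas
  give the vertex \<open>x (Suc k)\<close>, so the closed pieces can be pasted.\<close>

lemma edge_loop_piece:
  assumes "real k \<le> real m * s" "real m * s \<le> real (Suc k)"
  shows "edge_loop x m s = edge_point (x k) (x (Suc k)) (real m * s - real k)"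
proof (cases "real m * s = real (Suc k)")
  case True
  then have "nat \<lfloor>real m * s\<rfloor> = Suc k" by (simp only: floor_of_nat nat_int)
  then show ?thesis unfolding edge_loop_def Let_def True
    by (simp add: edge_point_0 edge_point_1)
next
  case False
  then have "\<lfloor>real m * s\<rfloor> = int k" using assms by (intro floor_unique) auto
  then show ?thesis unfolding edge_loop_def Let_def by simp
qed

lemma pathin_edge_loop:
  assumes m: "0 < m"
    and \<sigma>: "\<And>k. k < m \<Longrightarrow> \<exists>\<sigma>\<in>K. finite \<sigma> \<and> x k \<in> \<sigma> \<and> x (Suc k) \<in> \<sigma>"
  shows "pathin (realization K) (edge_loop x m)"
  unfolding pathin_def
proof (rule pasting_lemma_closed[of "{..<m}" _ "\<lambda>k. {real k / m .. real (Suc k) / m}"])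
  fix k assume k: "k \<in> {..<m}"
  show "closedin (top_of_set {0..1}) {real k / m .. real (Suc k) / m}"
    using m k by (intro closed_subset) (auto simp: field_simps)
  obtain \<sigma> where s: "\<sigma> \<in> K" "finite \<sigma>" "x k \<in> \<sigma>" "x (Suc k) \<in> \<sigma>"
    using \<sigma> k by auto
  let ?S = "{0..1} \<inter> {real k / m .. real (Suc k) / m}"
  have *: "edge_loop x m s = edge_point (x k) (x (Suc k)) (m * s - k)" if "s \<in> ?S" for s :: real
    using that m by (intro edge_loop_piece) (auto simp: field_simps)
  have "continuous_on ?S (\<lambda>s. edge_point (x k) (x (Suc k)) (m * s - k))"
    unfolding edge_point_def
    by (intro continuous_on_coordinatewise_then_product continuous_on_add continuous_on_if_const) (auto intro!: continuous_intros simp del: Int_atLeastAtMost)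
  then have cont: "continuous_on ?S (edge_loop x m)"
    by (rule continuous_on_eq) (use * in auto)
  have "edge_loop x m ` ?S \<subseteq> cell \<sigma>"
    using * s m by (auto intro!: edge_point_cell simp: field_simps)
  then have "continuous_map (top_of_set ?S) (top_of_set (cell \<sigma>)) (edge_loop x m)"
    using cont by (auto simp: continuous_map_in_subtopology)
  then have "continuous_map (top_of_set ?S) (realization K) ((\<lambda>x. x) \<circ> edge_loop x m)"
    using continuous_map_cell_realization[OF s(1)] by (rule continuous_map_compose)
  then show "continuous_map (subtopology (top_of_set {0..1}) {real k / m .. real (Suc k) / m})
      (realization K) (edge_loop x m)"
    by (simp add: subtopology_subtopology o_def)
next
  fix s assume s: "s \<in> topspace (top_of_set {0..1::real})"
  show "\<exists>j. j \<in> {..<m} \<and> s \<in> {real j / m .. real (Suc j) / m} \<and> edge_loop x m s = edge_loop x m s"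
  proof (cases "s = 1")
    case True
    \<comment> \<open>At the right endpoint the floor of \<open>m * s\<close> is \<open>m\<close>,
      which indexes no piece; the point belongs to the last one.\<close>
    then show ?thesis using m by (intro exI[of _ "m - 1"]) (auto simp: field_simps of_nat_diff)
  next
    case False
    define j where "j = nat \<lfloor>m * s\<rfloor>"
    have ms: "0 \<le> m * s" "m * s < m" using s False m by auto
    then have "real j \<le> m * s" "m * s < real j + 1" unfolding j_def by linarith+
    moreover from this ms have "j < m" by linarith
    ultimately show ?thesis using m by (intro exI[of _ j]) (auto simp: field_simps)
  qed
qed (rule finite_lessThan refl)+

lemma edge_loop_grid: "0 < m \<Longrightarrow> edge_loop x m (real k / real m) = (\<lambda>v. if v = x k then 1 else 0)"
  by (subst edge_loop_piece[of k]) (auto simp: edge_point_0)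

text \<open>The discrete form of a homotopy: a fine grid on the square, each of whose cells is mapped
  into an open vertex star.\<close>

lemma homotopy_grid:
  fixes q :: "real \<times> real \<Rightarrow> 'v \<Rightarrow> real"
  assumes q: "continuous_map (top_of_set ({0..1} \<times> {0..1})) (realization K) q"
    and pos: "\<And>s. s \<in> {0..1} \<times> {0..1} \<Longrightarrow> \<exists>v. 0 < q s v"
  obtains n v where "0 < n"
    "\<And>i j s. i < m * n \<Longrightarrow> j < m * n \<Longrightarrow> s \<in> {real i / (m * n) .. real (Suc i) / (m * n)} \<times>
       {real j / (m * n) .. real (Suc j) / (m * n)} \<Longrightarrow> 0 < q s (v i j)"
proof (cases "m = 0")
  case True
  then show ?thesis using that[of 1] by simp
next
  case False
  let ?S = "{0..1} \<times> {0..1} :: (real \<times> real) set"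
  define \<C> where "\<C> = {W. open W \<and> (\<exists>v. ?S \<inter> W \<subseteq> {s. 0 < q s v})}"
  have cover: "?S \<subseteq> \<Union>\<C>"
  proof
    fix s assume s: "s \<in> ?S"
    then obtain v where v: "0 < q s v" using pos by blast
    have qs: "q s \<in> topspace (realization K)" if "s \<in> ?S" for s
      using q that unfolding continuous_map_def by auto
    have "openin (top_of_set ?S) {s \<in> ?S. q s \<in> {x \<in> topspace (realization K). 0 < x v}}"
      using openin_continuous_map_preimage[OF q openin_realization_star[of K v]] by simp
    then obtain W where W: "open W" "{s \<in> ?S. q s \<in> {x \<in> topspace (realization K). 0 < x v}} = ?S \<inter> W"
      unfolding openin_open by blast
    have "s \<in> W" using W(2) s v qs[OF s] by blast
    moreover have "W \<in> \<C>" unfolding \<C>_def using W by blast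
    ultimately show "s \<in> \<Union>\<C>" by blast
  qed
  have ne: "\<C> \<noteq> {}" unfolding \<C>_def by blast
  have "open B" if "B \<in> \<C>" for B using that unfolding \<C>_def by blast
  then obtain \<delta> where \<delta>: "0 < \<delta>" "\<And>T. T \<subseteq> ?S \<Longrightarrow> diameter T < \<delta> \<Longrightarrow> \<exists>B\<in>\<C>. T \<subseteq> B"
    using Lebesgue_number_lemma[OF compact_Times[OF compact_Icc compact_Icc] ne cover] by metis
  obtain n where n': "2 / \<delta> < real n" using reals_Archimedean2 by blast
  have n: "n \<noteq> 0" "2 / real n < \<delta>"
  proof -
    have "0 < real n" using n' \<delta>(1) by (smt (verit) divide_pos_pos)
    then show "n \<noteq> 0" "2 / real n < \<delta>" using n' \<delta>(1) by (auto simp: field_simps)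
  qed
  \<comment> \<open>The factor \<open>m\<close> makes the grid refine the subdivision of the loop
    into its \<open>m\<close> edges.\<close>
  let ?N = "real (m * n)"
  have N: "0 < ?N" "2 / ?N < \<delta>"
  proof -
    show "0 < ?N" using n False by simp
    have "real n \<le> ?N" using False by (simp only: of_nat_le_iff) simp
    then have "2 / ?N \<le> 2 / real n" using n by (intro divide_left_mono) auto
    then show "2 / ?N < \<delta>" using n by simp
  qed
  define Q where "Q i j = {real i / ?N .. real (Suc i) / ?N} \<times> {real j / ?N .. real (Suc j) / ?N}" for i j
  have "\<exists>v. \<forall>s\<in>Q i j. 0 < q s v" if ij: "i < m * n" "j < m * n" for i j
  proof -
    have 1: "{real i / ?N .. real (Suc i) / ?N} \<subseteq> {0..1}" if "i < m * n" for i
      using that N by (auto simp: field_simps simp del: of_nat_mult)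
    then have "Q i j \<subseteq> ?S" unfolding Q_def using ij by blast
    moreover have "diameter (Q i j) < \<delta>"
    proof -
      have "dist a b \<le> 2 / ?N" if "a \<in> Q i j" "b \<in> Q i j" for a b
      proof -
        have "dist (fst a) (fst b) \<le> 1 / ?N" "dist (snd a) (snd b) \<le> 1 / ?N"
          using that N unfolding Q_def dist_real_def
          by (auto simp: add_divide_distrib abs_le_iff simp del: of_nat_mult)
        moreover have "dist a b \<le> dist (fst a) (fst b) + dist (snd a) (snd b)"
          unfolding dist_prod_def by (intro sqrt_sum_squares_le_sum) auto
        ultimately show ?thesis by simp
      qed
      then have "diameter (Q i j) \<le> 2 / ?N"
        using N by (intro diameter_le) (auto simp: dist_norm)
      then show ?thesis using N by simp
    qed
    ultimately obtain B where B: "B \<in> \<C>" "Q i j \<subseteq> B" using \<delta>(2) by blast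
    then show ?thesis unfolding \<C>_def using \<open>Q i j \<subseteq> ?S\<close> by blast
  qed
  then obtain v where "\<And>i j. i < m * n \<Longrightarrow> j < m * n \<Longrightarrow> \<forall>s\<in>Q i j. 0 < q s (v i j)"
    by metis
  then show ?thesis using that[of n v] n unfolding Q_def by auto
qed

fun chain_prod :: "('v \<Rightarrow> 'v \<Rightarrow> 'x \<Rightarrow> 'x) \<Rightarrow> (nat \<Rightarrow> 'v) \<Rightarrow> nat \<Rightarrow> 'x \<Rightarrow> 'x" where
  "chain_prod \<phi> f 0 = id"
| "chain_prod \<phi> f (Suc n) = chain_prod \<phi> f n \<circ> \<phi> (f n) (f (Suc n))"

text \<open>Commuting squares side by side, with \<open>f\<close> and \<open>g\<close> as rails and
  the maps \<open>\<phi> (f i) (g i)\<close> as rungs.\<close>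

lemma chain_prod_ladder:
  assumes "\<And>i. i < n \<Longrightarrow> \<phi> (f i) (f (Suc i)) \<circ> \<phi> (f (Suc i)) (g (Suc i)) = \<phi> (f i) (g i) \<circ> \<phi> (g i) (g (Suc i))"
  shows "chain_prod \<phi> f n \<circ> \<phi> (f n) (g n) = \<phi> (f 0) (g 0) \<circ> chain_prod \<phi> g n"
  using assms
proof (induction n)
  case (Suc n)
  have "chain_prod \<phi> f (Suc n) \<circ> \<phi> (f (Suc n)) (g (Suc n)) =
      chain_prod \<phi> f n \<circ> (\<phi> (f n) (f (Suc n)) \<circ> \<phi> (f (Suc n)) (g (Suc n)))"
    by (simp add: comp_assoc)
  also have "\<dots> = (chain_prod \<phi> f n \<circ> \<phi> (f n) (g n)) \<circ> \<phi> (g n) (g (Suc n))"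
    unfolding Suc.prems[OF lessI] by (simp only: comp_assoc)
  also have "\<dots> = (\<phi> (f 0) (g 0) \<circ> chain_prod \<phi> g n) \<circ> \<phi> (g n) (g (Suc n))"
    by (rule arg_cong[where f = "\<lambda>h. h \<circ> _"], rule Suc.IH, rule Suc.prems) simp
  finally show ?case by (simp only: chain_prod.simps comp_assoc)
qed simp

text \<open>Label each cell of a fine grid on the homotopy square by a vertex whose star contains
  the image of the cell. Adjacent rows then have the same product; the last row is constant, and the
  first row is compared with the path itself.\<close>

theorem simply_connected_cocycle:
  fixes K :: "'v set set" and \<phi> :: "'v \<Rightarrow> 'v \<Rightarrow> 'x \<Rightarrow> 'x"
  assumes sc: "simply_connected_space (realization K)"
    and fin: "\<And>\<sigma>. \<sigma> \<in> K \<Longrightarrow> finite \<sigma>"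
    and id: "\<And>a. \<phi> a a = id"
    and tri: "\<And>\<sigma> a b c. \<sigma> \<in> K \<Longrightarrow> a \<in> \<sigma> \<Longrightarrow> b \<in> \<sigma> \<Longrightarrow> c \<in> \<sigma> \<Longrightarrow> \<phi> a b \<circ> \<phi> b c = \<phi> a c"
    and path: "\<And>k. k < m \<Longrightarrow> \<exists>\<sigma>\<in>K. x k \<in> \<sigma> \<and> x (Suc k) \<in> \<sigma>"
    and loop: "x m = x 0"
  shows "chain_prod \<phi> x m = id"
proof (cases "m = 0")
  case False
  let ?p = "edge_loop x m"
  have ends: "?p 0 = (\<lambda>v. if v = x 0 then 1 else 0)" "?p 1 = (\<lambda>v. if v = x 0 then 1 else 0)"
    using edge_loop_grid[of m x 0] edge_loop_grid[of m x m] False loop by simp_all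
  have "pathin (realization K) ?p"
    using False path fin by (intro pathin_edge_loop) blast+
  then have "homotopic_with (\<lambda>q. q 0 = ?p 0 \<and> q 1 = ?p 0) (top_of_set {0..1}) (realization K) ?p (\<lambda>_. ?p 0)"
  proof -
    have "\<forall>p. pathin (realization K) p \<and> p 0 = p 1 \<longrightarrow>
        homotopic_with (\<lambda>q. q 0 = p 0 \<and> q 1 = p 0) (top_of_set {0..1}) (realization K) p (\<lambda>_. p 0)"
      using sc unfolding simply_connected_space_def by blast
    then show ?thesis
      by (rule allE[of _ ?p]) (erule impE, intro conjI \<open>pathin (realization K) ?p\<close> ends(2)[folded ends(1), symmetric])
  qed
  then obtain q :: "real \<times> real \<Rightarrow> 'v \<Rightarrow> real"
    where q: "continuous_map (prod_topology (top_of_set {0..1}) (top_of_set {0..1})) (realization K) q"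
    and "\<forall>s. q (0, s) = ?p s" "\<forall>s. q (1, s) = ?p 0" "\<forall>t\<in>{0..1}. q (t, 0) = ?p 0 \<and> q (t, 1) = ?p 0"
    unfolding homotopic_with_def by (elim exE conjE) (rule that, assumption+)
  then have q0: "q (0, s) = ?p s" and q1: "q (1, s) = ?p 0"
    and qs: "t \<in> {0..1} \<Longrightarrow> q (t, 0) = ?p 0 \<and> q (t, 1) = ?p 0" for s t by blast+
  have prod: "prod_topology (top_of_set {0..1::real}) (top_of_set {0..1::real}) = top_of_set ({0..1} \<times> {0..1})"
    by (simp add: prod_topology_subtopology_eu)
  have qS: "continuous_map (top_of_set ({0..1} \<times> {0..1})) (realization K) q" using q unfolding prod .
  have qcell: "\<exists>\<sigma>\<in>K. q s \<in> cell \<sigma>" if "s \<in> {0..1} \<times> {0..1}" for s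
    using qS that unfolding continuous_map_def topspace_realization by auto
  have qpos: "\<exists>v. 0 < q s v" if s: "s \<in> {0..1} \<times> {0..1}" for s
  proof -
    obtain \<sigma> where \<sigma>: "q s \<in> cell \<sigma>" using qcell[OF s] by blast
    show ?thesis
    proof (rule ccontr)
      assume "\<nexists>v. 0 < q s v"
      then have "sum (q s) \<sigma> \<le> 0" by (intro sum_nonpos) (simp add: not_less)
      then show False using \<sigma> by (simp add: cell_def)
    qed
  qed
  obtain n v where n: "0 < n" and v: "\<And>i j s. i < m * n \<Longrightarrow> j < m * n \<Longrightarrow>
      s \<in> {real i / (m * n) .. real (Suc i) / (m * n)} \<times> {real j / (m * n) .. real (Suc j) / (m * n)} \<Longrightarrow>
      0 < q s (v i j)"
    by (rule homotopy_grid[OF qS qpos, of m]) auto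
  \<comment> \<open>The \<open>m * n\<close> cells in a row are indexed by 0 to \<open>M\<close>, so
    a row is a chain with \<open>M\<close> steps.\<close>
  define M where "M = m * n - 1"
  have M: "m * n = Suc M" using False n by (simp add: M_def)
  have grid: "real a / real (Suc M) \<in> {0..1}" if "a \<le> Suc M" for a using that by simp
  have v: "0 < q (real a / Suc M, real b / Suc M) (v i j)"
    if "i \<le> M" "j \<le> M" "a = i \<or> a = Suc i" "b = j \<or> b = Suc j" for i j a b
    using that by (intro v) (auto simp: M field_simps simp flip: of_nat_mult)
  have vertex: "w = x 0" if "0 < (if w = x 0 then 1 else 0 :: real)" for w
    using that by (auto split: if_splits)
  \<comment> \<open>The homotopy is constant on these sides, and the only vertex whose star contains
    the base point is \<open>x 0\<close>.\<close>
  have left: "v i 0 = x 0" and right: "v i M = x 0" if "i \<le> M" for i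
    using v[of i 0 i 0] v[of i M i "Suc M"] that qs[OF grid[of i]] ends by (auto intro!: vertex)
  have top: "v M j = x 0" if "j \<le> M" for j
    using v[of M j "Suc M" j] that q1 ends by (auto intro!: vertex)
  have step: "chain_prod \<phi> (v i) M = chain_prod \<phi> (v (Suc i)) M" if i: "Suc i \<le> M" for i
  proof -
    have "chain_prod \<phi> (v i) M \<circ> \<phi> (v i M) (v (Suc i) M) = \<phi> (v i 0) (v (Suc i) 0) \<circ> chain_prod \<phi> (v (Suc i)) M"
    proof (rule chain_prod_ladder)
      fix j assume j: "j < M"
      \<comment> \<open>The corner shared by four cells: the simplex carrying its image contains all
        four labels.\<close>
      let ?s = "(real (Suc i) / Suc M, real (Suc j) / Suc M)"
      obtain \<sigma> where \<sigma>: "\<sigma> \<in> K" "q ?s \<in> cell \<sigma>"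
        using qcell[of ?s] i j grid by auto
      have "v a b \<in> \<sigma>" if "a = i \<or> a = Suc i" "b = j \<or> b = Suc j" for a b
        using that i j by (intro cell_support[OF \<sigma>(2)] v) auto
      then show "\<phi> (v i j) (v i (Suc j)) \<circ> \<phi> (v i (Suc j)) (v (Suc i) (Suc j)) =
          \<phi> (v i j) (v (Suc i) j) \<circ> \<phi> (v (Suc i) j) (v (Suc i) (Suc j))"
        using tri[OF \<sigma>(1)] by metis
    qed
    then show ?thesis using i by (simp add: left right id)
  qed
  have const: "chain_prod \<phi> f k = id" if "\<And>j. j \<le> k \<Longrightarrow> f j = x 0" for f k
    using that by (induction k) (simp_all add: id)
  have "chain_prod \<phi> (v i) M = id" if "i \<le> M" for i
    using that by (induction i rule: inc_induct) (use const[of M "v M"] top step in auto)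
  then have row: "chain_prod \<phi> (v 0) M = id" by simp
  \<comment> \<open>The path slowed down by the factor \<open>n\<close>, so that it runs parallel to
    the first row.\<close>
  define g where "g j = x (j div n)" for j
  have chain_g: "chain_prod \<phi> g j = chain_prod \<phi> x (j div n)" for j
    by (induction j) (auto simp: g_def div_Suc id)
  have "chain_prod \<phi> (v 0) M \<circ> \<phi> (v 0 M) (g M) = \<phi> (v 0 0) (g 0) \<circ> chain_prod \<phi> g M"
  proof (rule chain_prod_ladder)
    fix j assume j: "j < M"
    define k where "k = j div n"
    have km: "k < m" unfolding k_def using j M by (simp add: less_mult_imp_div_less)
    obtain \<sigma> where \<sigma>: "\<sigma> \<in> K" "x k \<in> \<sigma>" "x (Suc k) \<in> \<sigma>"
      using path[OF km] by blast
    let ?s = "real (Suc j) / Suc M"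
    have "real m * ?s = real (Suc j) / real n" using M n False
      by (simp add: field_simps flip: of_nat_mult del: of_nat_Suc)
    moreover have "k * n \<le> Suc j" "Suc j \<le> Suc k * n"
      unfolding k_def using dividend_less_div_times[OF n, of j] le_SucI[OF div_times_less_eq_dividend[of j n]]
      by (simp_all del: div_times_less_eq_dividend)
    then have "real k \<le> real (Suc j) / real n" "real (Suc j) / real n \<le> real (Suc k)"
      using n by (simp_all add: field_simps flip: of_nat_mult of_nat_Suc of_nat_add of_nat_le_iff del: of_nat_Suc of_nat_mult of_nat_add)
    ultimately have "?p ?s = edge_point (x k) (x (Suc k)) (real m * ?s - real k)"
      by (intro edge_loop_piece) simp_all
    then have supp: "w = x k \<or> w = x (Suc k)" if "0 < ?p ?s w" for w
      using that by (metis edge_point_pos)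
    have "v 0 j = x k \<or> v 0 j = x (Suc k)" "v 0 (Suc j) = x k \<or> v 0 (Suc j) = x (Suc k)"
      using v[of 0 j 0 "Suc j"] v[of 0 "Suc j" 0 "Suc j"] j by (auto intro!: supp simp: q0)
    then have "v 0 j \<in> \<sigma>" "v 0 (Suc j) \<in> \<sigma>" "g j \<in> \<sigma>" "g (Suc j) \<in> \<sigma>"
      using \<sigma> by (auto simp: g_def k_def div_Suc)
    then show "\<phi> (v 0 j) (v 0 (Suc j)) \<circ> \<phi> (v 0 (Suc j)) (g (Suc j)) =
        \<phi> (v 0 j) (g j) \<circ> \<phi> (g j) (g (Suc j))"
      using tri[OF \<sigma>(1)] by metis
  qed
  moreover have "M div n = m - 1"
  proof -
    have "M = (m - 1) * n + (n - 1)" unfolding M_def using n False by (cases m) auto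
    moreover have "(n - 1) div n = 0" using n by (intro div_less) simp
    ultimately show ?thesis using n by (simp only: div_mult_self3)
  qed
  moreover have "g 0 = x 0" by (simp add: g_def)
  \<comment> \<open>The ladder ends at \<open>x (m - 1)\<close>; the last edge back to
    \<open>x 0\<close> is supplied by the cocycle identity in its own simplex.\<close>
  ultimately have "\<phi> (x 0) (x (m - 1)) = chain_prod \<phi> x (m - 1)"
    using row left[of 0] right[of 0] id chain_g[of M] by (simp add: g_def)
  moreover have "chain_prod \<phi> x m = chain_prod \<phi> x (m - 1) \<circ> \<phi> (x (m - 1)) (x m)"
    using False by (cases m) auto
  moreover obtain \<sigma> where "\<sigma> \<in> K" "x (m - 1) \<in> \<sigma>" "x m \<in> \<sigma>"
    using path[of "m - 1"] False by auto
  ultimately show ?thesis using tri[of \<sigma> "x 0" "x (m - 1)" "x 0"] loop id by simp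
qed simp

section \<open>Reduced words\<close>

definition letter_inv :: "'g \<times> bool \<Rightarrow> 'g \<times> bool" where
  "letter_inv l = (fst l, \<not> snd l)"

lemma letter_inv_inv [simp]: "letter_inv (letter_inv l) = l"
  by (simp add: letter_inv_def)

fun reduced :: "('g \<times> bool) list \<Rightarrow> bool" where
  "reduced (l # m # w) \<longleftrightarrow> m \<noteq> letter_inv l \<and> reduced (m # w)"
| "reduced _ \<longleftrightarrow> True"

lemma reduced_tl: "reduced (l # w) \<Longrightarrow> reduced w"
  by (cases w) auto

definition cancel_cons :: "'g \<times> bool \<Rightarrow> ('g \<times> bool) list \<Rightarrow> ('g \<times> bool) list" where
  "cancel_cons l w = (case w of m # v \<Rightarrow> if m = letter_inv l then v else l # w | [] \<Rightarrow> [l])"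

lemma reduced_cancel_cons: "reduced w \<Longrightarrow> reduced (cancel_cons l w)"
  by (cases w) (auto simp: cancel_cons_def dest: reduced_tl)

text \<open>If the first letter cancels, the letter put back must not cancel with the next one; this
  is where \<open>w\<close> being reduced enters.\<close>

lemma cancel_cons_inv: "reduced w \<Longrightarrow> cancel_cons (letter_inv l) (cancel_cons l w) = w"
  by (cases w rule: reduced.cases) (auto simp: cancel_cons_def split: list.splits)

typedef 'g free_word = "{w :: ('g \<times> bool) list. reduced w}"
  by (rule exI[of _ "[]"]) simp

setup_lifting type_definition_free_word

lift_definition word_Nil :: "'g free_word" is "[]" by simp

lift_definition lmult :: "'g \<times> bool \<Rightarrow> 'g free_word \<Rightarrow> 'g free_word" is cancel_cons
  by (simp add: reduced_cancel_cons)

lift_definition word_letters :: "'g free_word \<Rightarrow> ('g \<times> bool) list" is "\<lambda>w. w" .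

lemma word_letters_lmult: "word_letters (lmult l x) = cancel_cons l (word_letters x)"
  by transfer simp

lemma lmult_inv [simp]: "lmult (letter_inv l) (lmult l x) = x"
  by transfer (rule cancel_cons_inv)

lemma lmult_inv' [simp]: "lmult (g, \<not> b) (lmult (g, b) x) = x" "lmult (g, b) (lmult (g, \<not> b) x) = x"
  "lmult (g, True) (lmult (g, False) x) = x" "lmult (g, False) (lmult (g, True) x) = x"
  using lmult_inv[of "(g, b)" x] lmult_inv[of "(g, \<not> b)" x] lmult_inv[of "(g, False)" x] lmult_inv[of "(g, True)" x]
  by (simp_all add: letter_inv_def)

lemma free_word_induct [case_names Nil lmult]:
  assumes "P word_Nil" "\<And>l x. P x \<Longrightarrow> P (lmult l x)"
  shows "P x"
proof -
  have "P (Abs_free_word w)" if "reduced w" for w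
    using that
  proof (induction w)
    case Nil
    then show ?case using assms(1) by (simp add: word_Nil_def)
  next
    case (Cons l w)
    then have "lmult l (Abs_free_word w) = Abs_free_word (l # w)"
      unfolding lmult_def using reduced_tl[OF Cons.prems]
      by (cases w) (auto simp: Abs_free_word_inverse cancel_cons_def)
    then show ?case using Cons assms(2) by (metis reduced_tl)
  qed
  then show ?thesis by (metis Rep_free_word Rep_free_word_inverse mem_Collect_eq)
qed

section \<open>The right-angled Artin group acting on the free group\<close>

datatype gen3 = GD | GY | GZ

text \<open>
  For \<open>b = True\<close> this is the automorphism of the free group fixing \<open>GD\<close> and \<open>GY\<close> and mapping \<open>GZ\<close> to
  \<open>GD\<^sup>-\<^sup>1 GZ GD\<close>; for \<open>b = False\<close> it is the inverse automorphism.
\<close>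

definition twist_letter :: "bool \<Rightarrow> gen3 \<times> bool \<Rightarrow> gen3 free_word \<Rightarrow> gen3 free_word" where
  "twist_letter b l x = (if fst l = GZ then lmult (GD, \<not> b) (lmult l (lmult (GD, b) x)) else lmult l x)"

definition twist :: "bool \<Rightarrow> gen3 free_word \<Rightarrow> gen3 free_word" where
  "twist b x = foldr (twist_letter b) (word_letters x) word_Nil"

lemma twist_letter_inv: "twist_letter b l (twist_letter b (letter_inv l) x) = x"
  using lmult_inv[of "letter_inv l"] by (auto simp: twist_letter_def letter_inv_def)

lemma twist_lmult: "twist b (lmult l x) = twist_letter b l (twist b x)"
  unfolding twist_def word_letters_lmult
  by (auto simp: cancel_cons_def twist_letter_inv split: list.splits)

lemma twist_Nil [simp]: "twist b word_Nil = word_Nil"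
  by (simp add: twist_def word_letters.rep_eq word_Nil.rep_eq)

lemma twist_D [simp]: "twist b (lmult (GD, c) x) = lmult (GD, c) (twist b x)"
  and twist_Y [simp]: "twist b (lmult (GY, c) x) = lmult (GY, c) (twist b x)"
  and twist_Z: "twist b (lmult (GZ, c) x) = lmult (GD, \<not> b) (lmult (GZ, c) (lmult (GD, b) (twist b x)))"
  by (simp_all add: twist_lmult twist_letter_def)

lemma twist_twist [simp]: "twist (\<not> b) (twist b x) = x" "twist b (twist (\<not> b) x) = x"
proof -
  have *: "twist (\<not> b) (twist b x) = x" for b
  proof (induction x rule: free_word_induct)
    case (lmult l x)
    then show ?case by (cases l; cases "fst l") (auto simp: twist_Z)
  qed simp
  show "twist (\<not> b) (twist b x) = x" "twist b (twist (\<not> b) x) = x"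
    using *[of b] *[of "\<not> b"] by simp_all
qed

lemma twist_twist' [simp]: "twist False (twist True x) = x" "twist True (twist False x) = x"
  using twist_twist[of True] by simp_all

abbreviation Wx :: "gen3 free_word \<Rightarrow> gen3 free_word" where "Wx \<equiv> twist True"
abbreviation Wx' :: "gen3 free_word \<Rightarrow> gen3 free_word" where "Wx' \<equiv> twist False"

text \<open>V = D W. Since W turns Z into D^-1 Z D, the factor D in front restores Z, and V commutes
  with Z.\<close>

definition Vx :: "gen3 free_word \<Rightarrow> gen3 free_word" where "Vx x = lmult (GD, True) (Wx x)"
definition Vx' :: "gen3 free_word \<Rightarrow> gen3 free_word" where "Vx' x = lmult (GD, False) (Wx' x)"

lemma V_inv [simp]: "Vx (Vx' x) = x" "Vx' (Vx x) = x"
  by (simp_all add: Vx_def Vx'_def)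

lemma V_W [simp]: "Vx (twist b x) = twist b (Vx x)" "Vx' (twist b x) = twist b (Vx' x)"
  by (cases b; simp add: Vx_def Vx'_def)+

lemma V_Z [simp]: "Vx (lmult (GZ, c) x) = lmult (GZ, c) (Vx x)" "Vx' (lmult (GZ, c) x) = lmult (GZ, c) (Vx' x)"
  by (simp_all add: Vx_def Vx'_def twist_Z)

lemma VW_D: "Vx (Vx (Wx' (Wx' x))) = lmult (GD, True) (lmult (GD, True) x)"
  "Wx (Wx (Vx' (Vx' x))) = lmult (GD, False) (lmult (GD, False) x)"
  by (simp_all add: Vx_def Vx'_def)

text \<open>
  A letter \<open>(c, \<epsilon>)\<close> stands for \<open>b\<^sup>\<plusminus>\<^sup>1\<close> if \<open>c\<close> holds and for \<open>a\<^sup>\<plusminus>\<^sup>1\<close> otherwise. The flag \<open>q\<close> records the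
  parity of the number of letters \<open>b\<^sup>\<plusminus>\<^sup>1\<close> read so far; it alternates the roles of \<open>GY\<close> and \<open>GZ\<close>.
\<close>

definition block_letter :: "bool \<Rightarrow> bool \<times> bool \<Rightarrow> gen3 \<times> bool \<Rightarrow> bool" where
  "block_letter q l m \<longleftrightarrow>
     (if fst l then fst m = (if snd l = q then GY else GZ) else m = (GD, snd l \<noteq> q))"

inductive block_image :: "bool \<Rightarrow> (bool \<times> bool) list \<Rightarrow> gen3 free_word \<Rightarrow> bool" where
  "block_image q [] word_Nil"
| "block_letter q l m \<Longrightarrow> block_image (q \<noteq> fst l) w x \<Longrightarrow> block_image q (l # w) (lmult m (lmult m x))"

text \<open>A block can only cancel against the next one if both use the same generator with
  opposite exponents. Between two letters b of equal sign the flag flips, so GY and GZ alternate,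
  whatever the exponents; adjacent letters of opposite sign do not occur in a reduced word. Hence
  \<open>block_letter\<close> may leave the exponents of GY and GZ open.\<close>

lemma block_image_reduced:
  assumes "block_image q w x" "reduced w"
  shows "case w of [] \<Rightarrow> x = word_Nil
    | l # v \<Rightarrow> \<exists>m u. word_letters x = m # u \<and> block_letter q l m"
  using assms
proof (induction rule: block_image.induct)
  case (2 q l m w x)
  have "word_letters x = [] \<or> (\<exists>m' u. word_letters x = m' # u \<and> m' \<noteq> letter_inv m)"
  proof (cases w)
    case Nil
    then show ?thesis using 2 by (auto simp: word_letters.rep_eq word_Nil.rep_eq)
  next
    case (Cons l' v)
    then obtain m' u where m': "word_letters x = m' # u" "block_letter (q \<noteq> fst l) l' m'"
      using 2 reduced_tl by fastforce
    have "l' \<noteq> letter_inv l" using 2 Cons by simp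
    then have "m' \<noteq> letter_inv m"
      using m'(2) 2(1) by (auto simp: block_letter_def letter_inv_def prod_eq_iff split: if_splits)
    then show ?thesis using m' by blast
  qed
  then have "\<exists>u. word_letters (lmult m (lmult m x)) = m # u"
    by (auto simp: word_letters_lmult cancel_cons_def letter_inv_def prod_eq_iff)
  then show ?case using 2(1) by (cases m) auto
qed simp

lemma block_image_Nil:
  assumes "block_image q w word_Nil" "reduced w"
  shows "w = []"
  using block_image_reduced[OF assms]
  by (auto simp: word_letters.rep_eq word_Nil.rep_eq split: list.splits)

section \<open>Reduction to a free subgroup of the braid group\<close>

\<comment> \<open>The group \<open>B4\<close> as a type, so that equations between braids follow
  from the monoid laws.\<close>
quotient_type braid = braid_word / braid_eq
  by (rule equivpI) (auto simp: reflp_def symp_def transp_def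
      intro: braid_eq_refl braid_eq_sym braid_eq_trans)

instantiation braid :: monoid_mult
begin

lift_definition one_braid :: braid is "[]" .

lift_definition times_braid :: "braid \<Rightarrow> braid \<Rightarrow> braid" is "(@)"
  by (rule braid_eq_append)

instance
  by standard (transfer, simp add: braid_eq_refl)+

end

lift_definition braid_gen :: "artin \<Rightarrow> bool \<Rightarrow> braid" is "\<lambda>s b. [(s, b)]" .

lemma braid_induct:
  assumes "P 1" "\<And>s b x. P x \<Longrightarrow> P (braid_gen s b * x)"
  shows "P x"
proof -
  have "P (abs_braid w)" for w
  proof (induction w)
    case Nil
    then show ?case using assms(1) by (simp add: one_braid_def)
  next
    case (Cons l w)
    have "abs_braid (l # w) = braid_gen (fst l) (snd l) * abs_braid w"
      by (simp add: braid_gen.abs_eq times_braid.abs_eq)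
    then show ?case using Cons assms(2) by simp
  qed
  then show ?thesis by (metis Quotient3_abs_rep Quotient3_braid)
qed

lemma sigma_cancel [simp]: "braid_gen s b * braid_gen s (\<not> b) = 1" "braid_gen s True * braid_gen s False = 1"
  "braid_gen s False * braid_gen s True = 1"
  using braid_eq_cancel[of s b] braid_eq_cancel[of s True] braid_eq_cancel[of s False]
  by (transfer, simp)+

lemma sigma_cancel_left [simp]: "braid_gen s b * (braid_gen s (\<not> b) * x) = x"
  "braid_gen s True * (braid_gen s False * x) = x" "braid_gen s False * (braid_gen s True * x) = x"
  by (simp_all flip: mult.assoc)

abbreviation "s1 \<equiv> braid_gen Sigma1 True"
abbreviation "s2 \<equiv> braid_gen Sigma2 True"
abbreviation "s3 \<equiv> braid_gen Sigma3 True"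
abbreviation "s1' \<equiv> braid_gen Sigma1 False"
abbreviation "s2' \<equiv> braid_gen Sigma2 False"
abbreviation "s3' \<equiv> braid_gen Sigma3 False"

lemma braid_rel_12: "s1 * s2 * s1 = s2 * s1 * s2"
  and braid_rel_23: "s2 * s3 * s2 = s3 * s2 * s3"
  and braid_rel_13: "s1 * s3 = s3 * s1"
  using braid12 braid23 braid13 by (transfer, simp)+

definition burau_braid :: "braid \<Rightarrow> int laurent ^ 3 ^ 3" where
  "burau_braid x = burau_word (rep_braid x)"

lemma burau_braid_abs: "burau_braid (abs_braid w) = burau_word w"
  unfolding burau_braid_def
  by (rule burau_word_cong) (metis Quotient3_braid Quotient3_rel_abs Quotient3_rep_abs braid_eq_refl)

lemma burau_braid_1 [simp]: "burau_braid 1 = mat 1"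
  by (simp add: one_braid_def burau_braid_abs burau_word_Nil)

lemma burau_braid_mult: "burau_braid (x * y) = burau_braid x ** burau_braid y"
proof -
  obtain u v where "x = abs_braid u" "y = abs_braid v"
    by (metis Quotient3_abs_rep Quotient3_braid)
  then show ?thesis by (simp add: times_braid.abs_eq burau_braid_abs burau_word_append)
qed

lemma burau_braid_sigma: "burau_braid (braid_gen s b) = burau_letter (s, b)"
  by (simp add: braid_gen.abs_eq burau_braid_abs burau_word_Cons burau_word_Nil)

lemma burau_injectiveI:
  assumes "\<And>x. burau_braid x = mat 1 \<Longrightarrow> x = 1"
  shows "burau \<in> mon B4 GL3"
  unfolding mon_def
proof (intro CollectI conjI burau_hom inj_onI)
  fix X Y assume "X \<in> carrier B4" "Y \<in> carrier B4" and eq: "burau X = burau Y"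
  then obtain u v where uv: "X = braid_class u" "Y = braid_class v" by (auto simp: B4_def)
  have "burau_word (inv_word u @ v) = burau_word (inv_word u @ u)"
    using eq by (simp add: uv burau_class burau_word_append)
  also have "\<dots> = mat 1"
    using burau_word_cong[OF inv_word_append[of u]] by (simp add: burau_word_Nil)
  finally have "abs_braid (inv_word u @ v) = 1" by (intro assms) (simp add: burau_braid_abs)
  moreover have "abs_braid (inv_word u @ u) = 1"
    using inv_word_append[of u] by (simp add: one_braid_def braid.abs_eq_iff)
  ultimately have "abs_braid (inv_word u) * abs_braid v = 1" and 1: "abs_braid (inv_word u) * abs_braid u = 1"
    by (simp_all add: times_braid.abs_eq)
  moreover have "abs_braid (inv_word (inv_word u)) * abs_braid (inv_word u) = 1"
    using inv_word_append[of "inv_word u"] by (simp add: one_braid_def braid.abs_eq_iff times_braid.abs_eq)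
  ultimately have "abs_braid u = abs_braid v"
    by (metis mult.assoc mult_1_left)
  then show "X = Y" by (simp add: uv braid_class_eq_iff braid.abs_eq_iff)
qed

section \<open>Exponent sum and determinant\<close>

definition exp_word :: "braid_word \<Rightarrow> int" where
  "exp_word w = (\<Sum>l\<leftarrow>w. if snd l then 1 else -1)"

lemma exp_word_cong: "braid_eq u v \<Longrightarrow> exp_word u = exp_word v"
  by (induction rule: braid_eq.induct) (auto simp: exp_word_def)

lift_definition exp_sum :: "braid \<Rightarrow> int" is exp_word by (rule exp_word_cong)

lemma exp_sum_simps [simp]: "exp_sum 1 = 0" "exp_sum (x * y) = exp_sum x + exp_sum y"
  "exp_sum (braid_gen s b) = (if b then 1 else -1)"
  by (transfer, simp add: exp_word_def)+

lemma exp_sum_power [simp]: "exp_sum (x ^ n) = int n * exp_sum x"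
  by (induction n) (simp_all add: algebra_simps)

text \<open>At t = 2 the determinant (-t)^e of a braid with exponent sum e is 1 only for e =
  0.\<close>

interpretation eval2: laurent_ring_hom "laurent_lift (\<lambda>k c. of_int c * (2 :: real) powi k)"
  by (rule laurent_ring_hom_lift) (simp_all add: power_int_add algebra_simps)

lemma det_burau_eval:
  "det (map_matrix (laurent_lift (\<lambda>k c. of_int c * (2 :: real) powi k)) (burau_braid x)) = (-2) powi exp_sum x"
proof (induction x rule: braid_induct)
  case 1
  show ?case by (simp add: eval2.map_matrix_mat eval2.one)
next
  case (2 s b x)
  let ?E = "laurent_lift (\<lambda>k c. of_int c * (2 :: real) powi k)"
  have gen: "det (map_matrix ?E (burau_gen s)) = -2"
    by (cases s) (simp_all add: det_3 laurent_lift_monom eval2.zero eval2.one eval2.minus)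
  have "map_matrix ?E (burau_gen s) ** map_matrix ?E (matrix_inv (burau_gen s)) = mat 1"
    by (simp only: burau_gen_inv eval2.map_matrix_mat eval2.one flip: eval2.map_matrix_mult)
  then have "det (map_matrix ?E (burau_gen s)) * det (map_matrix ?E (matrix_inv (burau_gen s))) = 1"
    by (metis det_I det_mul)
  then have "det (map_matrix ?E (matrix_inv (burau_gen s))) = -1/2" using gen by simp
  then have "det (map_matrix ?E (burau_letter (s, b))) = (-2) powi exp_sum (braid_gen s b)"
    using gen by (simp add: burau_letter_def power_int_minus)
  then show ?case
    using 2 by (simp add: burau_braid_mult eval2.map_matrix_mult det_mul burau_braid_sigma power_int_add)
qed

lemma exp_sum_kernel:
  assumes "burau_braid x = mat 1"
  shows "exp_sum x = 0"
proof -
  have "(-2 :: real) powi exp_sum x = 1"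
    using det_burau_eval[of x] by (simp add: assms eval2.map_matrix_mat eval2.one)
  then have "\<bar>(-2 :: real) powi exp_sum x\<bar> = 1" by simp
  then have "(2 :: real) powi exp_sum x = 1" by (simp add: power_int_abs)
  moreover have "1 < (2 :: real) powi exp_sum x" if "0 < exp_sum x"
    using that by (simp add: power_int_def)
  moreover have "(2 :: real) powi exp_sum x < 1" if "exp_sum x < 0"
    using that by (simp add: power_int_def power_less_one_iff)
  ultimately show ?thesis by linarith
qed

text \<open>
  An action of \<open>B\<^sub>4\<close> on \<open>\<int>\<^sup>2\<close> by affine maps; \<open>a\<close> and \<open>b\<close> act as the translations by \<open>(1, 0)\<close> and \<open>(1, -1)\<close>.
\<close>

fun affine_letter :: "artin \<times> bool \<Rightarrow> int \<times> int \<Rightarrow> int \<times> int" where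
  "affine_letter (Sigma1, b) (x, y) = (if b then (x + y, y) else (x - y, y))"
| "affine_letter (Sigma2, b) (x, y) = (if b then (x, y - x) else (x, y + x))"
| "affine_letter (Sigma3, b) (x, y) = (if b then (x + y - 1, y) else (x - y + 1, y))"

definition affine_word :: "braid_word \<Rightarrow> int \<times> int \<Rightarrow> int \<times> int" where
  "affine_word w = foldr (\<lambda>l f. affine_letter l \<circ> f) w id"

lemma affine_word_append: "affine_word (u @ v) = affine_word u \<circ> affine_word v"
  by (induction u) (simp_all add: affine_word_def comp_assoc)

lemma affine_word_cong: "braid_eq u v \<Longrightarrow> affine_word u = affine_word v"
proof (induction rule: braid_eq.induct)
  case (braid_eq_cancel s b)
  show ?case by (cases s) (auto simp: affine_word_def)
next
  case (braid_eq_cong u v x y)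
  then show ?case by (simp add: affine_word_append)
qed (auto simp: fun_eq_iff affine_word_def)

lift_definition affine_action :: "braid \<Rightarrow> int \<times> int \<Rightarrow> int \<times> int" is affine_word
  by (rule affine_word_cong)

lemma affine_1 [simp]: "affine_action 1 = id"
  and affine_mult [simp]: "affine_action (x * y) = affine_action x \<circ> affine_action y"
  and affine_sigma [simp]: "affine_action (braid_gen s b) = affine_letter (s, b)"
proof -
  show "affine_action 1 = id" by transfer (simp add: affine_word_def)
  show "affine_action (x * y) = affine_action x \<circ> affine_action y"
    by transfer (rule affine_word_append)
  show "affine_action (braid_gen s b) = affine_letter (s, b)"
    by transfer (simp add: affine_word_def)
qed

lemma affine_form: "\<exists>A B C D E F. \<forall>u v. affine_action x (u, v) = (A * u + B * v + E, C * u + D * v + F)"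
proof (induction x rule: braid_induct)
  case 1
  show ?case by (intro exI[of _ 1] exI[of _ 0] exI) auto
next
  case (2 s b x)
  then obtain A B C D E F where x: "affine_action x (u, v) = (A * u + B * v + E, C * u + D * v + F)" for u v by blast
  define r where "r = (if b then 1 else -1 :: int)"
  show ?case
  proof (cases s)
    case Sigma1
    show ?thesis
      by (rule exI[of _ "A + r * C"], rule exI[of _ "B + r * D"], rule exI[of _ C], rule exI[of _ D],
          rule exI[of _ "E + r * F"], rule exI[of _ F]) (simp add: x Sigma1 r_def algebra_simps)
  next
    case Sigma2
    show ?thesis
      by (rule exI[of _ A], rule exI[of _ B], rule exI[of _ "C - r * A"], rule exI[of _ "D - r * B"],
          rule exI[of _ E], rule exI[of _ "F - r * E"]) (simp add: x Sigma2 r_def algebra_simps)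
  next
    case Sigma3
    show ?thesis
      by (rule exI[of _ "A + r * C"], rule exI[of _ "B + r * D"], rule exI[of _ C], rule exI[of _ D],
          rule exI[of _ "E + r * F - r"], rule exI[of _ F]) (simp add: x Sigma3 r_def algebra_simps)
  qed
qed

section \<open>The normal subgroup generated by a and b\<close>

definition fa :: "bool \<Rightarrow> braid" where
  "fa e = (if e then s1 * s3' else s3 * s1')"

definition fb :: "bool \<Rightarrow> braid" where
  "fb e = s2 * fa e * s2'"

primrec free_braid :: "(bool \<times> bool) list \<Rightarrow> braid" where
  "free_braid [] = 1"
| "free_braid (l # w) = (if fst l then fb (snd l) else fa (snd l)) * free_braid w"

lemma free_braid_append: "free_braid (u @ v) = free_braid u * free_braid v"
  by (induction u) (simp_all add: mult.assoc)

lemma fa_cancel [simp]: "fa e * fa (\<not> e) = 1"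
  by (auto simp: fa_def mult.assoc)

lemma fb_cancel [simp]: "fb e * fb (\<not> e) = 1"
proof -
  have "fb e * fb (\<not> e) = s2 * (fa e * fa (\<not> e)) * s2'"
    unfolding fb_def by (simp only: mult.assoc sigma_cancel_left)
  then show ?thesis by simp
qed

lemma free_braid_cancel_cons: "free_braid (cancel_cons l w) = free_braid (l # w)"
proof (cases w)
  case (Cons m v)
  have "(if fst l then fb (snd l) else fa (snd l)) * (if fst l then fb (\<not> snd l) else fa (\<not> snd l)) = 1"
    by simp
  then show ?thesis unfolding Cons
    by (simp add: cancel_cons_def letter_inv_def flip: mult.assoc)
qed (simp add: cancel_cons_def)

lemma free_braid_reduced: "\<exists>v. reduced v \<and> free_braid v = free_braid w"
proof (induction w)
  case Nil
  show ?case by (rule exI[of _ "[]"]) simp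
next
  case (Cons l w)
  then obtain v where "reduced v" "free_braid v = free_braid w" by blast
  then show ?case
    by (intro exI[of _ "cancel_cons l v"]) (simp add: reduced_cancel_cons free_braid_cancel_cons)
qed

lemma free_braid_inverse: "\<exists>v. free_braid v * free_braid w = 1 \<and> free_braid w * free_braid v = 1"
proof (induction w)
  case Nil
  show ?case by (rule exI[of _ "[]"]) simp
next
  case (Cons l w)
  then obtain v where v: "free_braid v * free_braid w = 1" "free_braid w * free_braid v = 1" by blast
  let ?g = "\<lambda>l. if fst l then fb (snd l) else fa (snd l)"
  have g: "?g (letter_inv l) * ?g l = 1" "?g l * ?g (letter_inv l) = 1"
    using fa_cancel[of "snd l"] fa_cancel[of "\<not> snd l"] fb_cancel[of "snd l"] fb_cancel[of "\<not> snd l"]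
    by (simp_all add: letter_inv_def)
  have *: "(x * y) * (z * u) = 1" if "y * z = 1" "x * u = 1" for x y z u :: braid
    using that by (metis mult.assoc mult_1_left)
  have "free_braid (v @ [letter_inv l]) * free_braid (l # w) = 1"
    using *[OF g(1) v(1)] by (simp add: free_braid_append)
  moreover have "free_braid (l # w) * free_braid (v @ [letter_inv l]) = 1"
    using *[OF v(2) g(2)] by (simp add: free_braid_append)
  ultimately show ?case by blast
qed

text \<open>The equation x f = w x stands for x f x^-1 = w, as \<open>braid\<close> carries only a
  monoid structure.\<close>

definition normalizes :: "braid \<Rightarrow> braid \<Rightarrow> bool" where
  "normalizes x f \<longleftrightarrow> (\<exists>w. x * f = free_braid w * x)"

lemma normalizes_mult: "normalizes x f \<Longrightarrow> normalizes x g \<Longrightarrow> normalizes x (f * g)"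
  unfolding normalizes_def by (metis mult.assoc free_braid_append)

lemma normalizes_inverse:
  assumes "normalizes x f" "f * g = 1"
  shows "normalizes x g"
proof -
  obtain w where w: "x * f = free_braid w * x" using assms unfolding normalizes_def by blast
  obtain v where v: "free_braid v * free_braid w = 1" using free_braid_inverse by blast
  have "free_braid v * x = free_braid v * (x * f) * g" using assms(2) by (simp add: mult.assoc)
  also have "\<dots> = x * g" using v unfolding w by (simp flip: mult.assoc)
  finally show ?thesis unfolding normalizes_def by metis
qed

lemma normalizes_free:
  assumes "normalizes x (fa True)" "normalizes x (fb True)"
  shows "normalizes x (free_braid w)"
proof (induction w)
  case Nil
  show ?case unfolding normalizes_def by (rule exI[of _ "[]"]) simp
next
  case (Cons l w)
  have "normalizes x (fa e)" "normalizes x (fb e)" for e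
    using assms normalizes_inverse[of x _ "fa False"] normalizes_inverse[of x _ "fb False"]
      fa_cancel[of True] fb_cancel[of True] by (cases e; auto)+
  then show ?case using Cons normalizes_mult by simp
qed

lemma s3_eq: "s3 = fa False * s1" "s3' = s1' * fa True"
  by (simp_all add: fa_def mult.assoc)

lemma s13_comm: "s1' * s3 = s3 * s1'" "s1 * s3' = s3' * s1" "s1' * s3' = s3' * s1'"
proof -
  have "s1' * s3 = s1' * (s3 * s1) * s1'" by (simp add: mult.assoc)
  also have "\<dots> = s3 * s1'" unfolding braid_rel_13[symmetric] by (simp add: mult.assoc)
  finally show 1: "s1' * s3 = s3 * s1'" .
  have "s1 * s3' = s3' * (s3 * s1) * s3'" by (simp add: mult.assoc)
  also have "\<dots> = s3' * s1" unfolding braid_rel_13[symmetric] by (simp add: mult.assoc)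
  finally show "s1 * s3' = s3' * s1" .
  have "s1' * s3' = s3' * (s3 * s1') * s3'" by (simp add: mult.assoc)
  also have "\<dots> = s3' * s1'" unfolding 1[symmetric] by (simp add: mult.assoc)
  finally show "s1' * s3' = s3' * s1'" .
qed

lemma s2_s3'_s2': "s2 * s3' * s2' = s3' * s2' * s3"
proof -
  have "s2 * s3' * s2' = s3' * s2' * (s2 * s3 * s2) * s3' * s2'" by (simp add: mult.assoc)
  also have "\<dots> = s3' * s2' * s3" unfolding braid_rel_23 by (simp add: mult.assoc)
  finally show ?thesis .
qed

lemma s1'_s2_s1: "s1' * s2 * s1 = s2 * s1 * s2'"
proof -
  have "s1' * s2 * s1 = s1' * (s2 * s1 * s2) * s2'" by (simp add: mult.assoc)
  also have "\<dots> = s2 * s1 * s2'" unfolding braid_rel_12[symmetric] by (simp add: mult.assoc)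
  finally show ?thesis .
qed

lemma s3'_s2'_s3': "s3' * s2' * s3' = s2' * s3' * s2'"
proof -
  have "s3' * s2' * s3' = s3' * s2' * s3' * (s2 * s3 * s2) * s2' * s3' * s2'" by (simp add: mult.assoc)
  also have "\<dots> = s2' * s3' * s2'" unfolding braid_rel_23 by (simp add: mult.assoc)
  finally show ?thesis .
qed

lemma s1_conj_a: "s1 * fa True = fa True * s1"
  by (simp add: fa_def mult.assoc flip: s13_comm(2))

text \<open>Together with \<open>s1_conj_a\<close> and \<open>s2_conj_b\<close> this describes
  conjugation by s1 and s2 on F. On the abelianisation, with a and b read as (1, 0) and (1, -1),
  these are the linear maps of the affine action above.\<close>

lemma s1_conj_b: "s1 * fb True = fb True * fa False * s1"
proof -
  have "s1 * fb True = (s1 * s2 * s1) * s3' * s2'" by (simp add: fb_def fa_def mult.assoc)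
  also have "\<dots> = s2 * s1 * (s2 * s3' * s2')" unfolding braid_rel_12 by (simp add: mult.assoc)
  also have "\<dots> = fb True * fa False * s1" unfolding s2_s3'_s2' by (simp add: fb_def fa_def mult.assoc)
  finally show ?thesis .
qed

lemma s2_conj_b: "s2 * fb True = fb True * fa False * fb True * s2"
proof -
  have "fb True * fa False * fb True * s2 = s2 * s1 * (s3' * s2' * s3) * (s1' * s2 * s1) * s3'"
    by (simp add: fb_def fa_def mult.assoc)
  also have "\<dots> = s2 * s1 * s2 * (s3' * s1) * s2' * s3'"
    unfolding s2_s3'_s2'[symmetric] s1'_s2_s1 by (simp add: mult.assoc)
  also have "\<dots> = s2 * (s1 * s2 * s1) * (s3' * s2' * s3')"
    unfolding s13_comm(2)[symmetric] by (simp add: mult.assoc)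
  also have "\<dots> = s2 * fb True" unfolding s3'_s2'_s3' braid_rel_12
    by (simp add: fb_def fa_def mult.assoc)
  finally show ?thesis ..
qed

lemma conj_inverse: "y * x = 1 \<Longrightarrow> x * y = 1 \<Longrightarrow> x * f = g * x \<Longrightarrow> y * g = f * (y :: braid)"
  by (metis mult.assoc mult_1_left mult_1_right)

lemma normalizesI: "x * f = free_braid w * x \<Longrightarrow> normalizes x f"
  unfolding normalizes_def by blast

lemma fa_left_cancel [simp]: "fa e * (fa (\<not> e) * x) = x" "fa False * (fa True * x) = x" "fa True * (fa False * x) = x"
  and fb_left_cancel [simp]: "fb e * (fb (\<not> e) * x) = x" "fb False * (fb True * x) = x" "fb True * (fb False * x) = x"
  using fa_cancel[of e] fb_cancel[of e] fa_cancel[of False] fa_cancel[of True] fb_cancel[of True] fb_cancel[of False]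
  by (simp_all flip: mult.assoc)

lemma normalizes_sigma12:
  assumes "s \<noteq> Sigma3"
  shows "normalizes (braid_gen s e) (free_braid w)"
proof (rule normalizes_free)
  have 1: "s1' * fb True = fb True * fa True * s1'"
  proof -
    have "s1' * (fb True * fa False) = fb True * s1'" by (rule conj_inverse[OF _ _ s1_conj_b]) simp_all
    moreover have "s1' * fa True = fa True * s1'" by (rule conj_inverse[OF _ _ s1_conj_a]) simp_all
    ultimately show ?thesis
      using fa_left_cancel(2)[of 1] by (metis mult.assoc mult_1_right)
  qed
  have 2: "s2' * fb True = fa True * s2'" by (simp add: fb_def mult.assoc)
  \<comment> \<open>Conjugation by s2^-1 sends b to a, so \<open>s2_conj_b\<close> reads b = a
    (s2^-1 a^-1 s2) a, which is solved for s2^-1 a s2.\<close>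
  have 3: "s2' * fa True = fa True * fb False * fa True * s2'"
  proof -
    have "s2' * (fb True * fa False * fb True) = fb True * s2'"
      by (rule conj_inverse[OF _ _ s2_conj_b]) simp_all
    then have "fa True * (s2' * fa False * fb True) = fb True * s2'" using 2 by (simp flip: mult.assoc)
    then have "fb False * (fa True * (s2' * fa False * fb True)) = s2'" by simp
    then have "fb False * (fa True * (s2' * fa False * fb True)) * fb False = s2' * fb False" by simp
    moreover have "fb True * fb False = 1" using fb_cancel[of True] by simp
    ultimately have "fb False * (fa True * (s2' * fa False)) = s2' * fb False" by (simp add: mult.assoc)
    moreover have "s2' * fb False = fa False * s2'" by (simp add: fb_def mult.assoc)
    ultimately have "fb False * (fa True * (s2' * fa False)) = fa False * s2'" by simp
    then have "fa False * (fb True * (fb False * (fa True * (s2' * fa False)))) * fa True =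
        fa False * (fb True * (fa False * s2')) * fa True" by simp
    then have "s2' = fa False * (fb True * (fa False * s2')) * fa True"
      using fa_cancel[of False] by (simp add: mult.assoc)
    then have "fa True * (fb False * (fa True * s2')) =
       fa True * (fb False * (fa True * (fa False * (fb True * (fa False * s2')) * fa True)))" by simp
    then show ?thesis by (simp add: mult.assoc)
  qed
  show "normalizes (braid_gen s e) (fa True)"
  proof (cases s)
    case Sigma1
    have "s1' * fa True = fa True * s1'" by (rule conj_inverse[OF _ _ s1_conj_a]) simp_all
    then show ?thesis using s1_conj_a
      by (cases e) (auto simp: Sigma1 intro!: normalizesI[where w = "[(False, True)]"])
  next
    case Sigma2
    have "s2 * fa True = fb True * s2" by (simp add: fb_def mult.assoc)
    then have "normalizes s2 (fa True)" by (intro normalizesI[where w = "[(True, True)]"]) simp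
    moreover have "normalizes s2' (fa True)"
      using 3 by (intro normalizesI[where w = "[(False, True), (True, False), (False, True)]"]) (simp add: mult.assoc)
    ultimately show ?thesis by (cases e) (simp_all add: Sigma2)
  qed (use assms in simp)
  show "normalizes (braid_gen s e) (fb True)"
  proof (cases s)
    case Sigma1
    have "normalizes s1 (fb True)"
      using s1_conj_b by (intro normalizesI[where w = "[(True, True), (False, False)]"]) (simp add: mult.assoc)
    moreover have "normalizes s1' (fb True)"
      using 1 by (intro normalizesI[where w = "[(True, True), (False, True)]"]) (simp add: mult.assoc)
    ultimately show ?thesis by (cases e) (simp_all add: Sigma1)
  next
    case Sigma2
    have "normalizes s2 (fb True)"
      using s2_conj_b by (intro normalizesI[where w = "[(True, True), (False, False), (True, True)]"]) (simp add: mult.assoc)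
    moreover have "normalizes s2' (fb True)"
      using 2 by (intro normalizesI[where w = "[(False, True)]"]) simp
    ultimately show ?thesis by (cases e) (simp_all add: Sigma2)
  qed (use assms in simp)
qed

lemma normalizes_comp: "normalizes x f \<Longrightarrow> (\<And>w. normalizes y (free_braid w)) \<Longrightarrow> normalizes (y * x) f"
  unfolding normalizes_def by (metis mult.assoc)

lemma normalizes_free_self: "normalizes (free_braid v) (free_braid w)"
proof -
  obtain u where "free_braid u * free_braid v = 1" using free_braid_inverse by blast
  then have "free_braid v * free_braid w = free_braid (v @ w @ u) * free_braid v"
    by (simp add: free_braid_append mult.assoc)
  then show ?thesis unfolding normalizes_def by blast
qed

lemma fa_free: "fa e = free_braid [(False, e)]" and fb_free: "fb e = free_braid [(True, e)]"
  by simp_all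

lemma normalizes_sigma: "normalizes (braid_gen s e) (free_braid w)"
proof (cases "s = Sigma3")
  case True
  show ?thesis
  proof (cases e)
    case True
    have "normalizes s3 (free_braid w)"
      unfolding s3_eq(1) fa_free by (intro normalizes_comp normalizes_sigma12 normalizes_free_self) simp
    then show ?thesis using \<open>s = Sigma3\<close> True by simp
  next
    case False
    have "normalizes s3' (free_braid w)"
      unfolding s3_eq(2) fa_free by (intro normalizes_comp normalizes_sigma12 normalizes_free_self) simp
    then show ?thesis using \<open>s = Sigma3\<close> False by simp
  qed
qed (rule normalizes_sigma12)

lemma normalizes_all: "normalizes x (free_braid w)"
proof (induction x arbitrary: w rule: braid_induct)
  case 1
  show ?case unfolding normalizes_def by (metis mult_1_left mult_1_right)
qed (intro normalizes_comp normalizes_sigma)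

inductive_set B3 :: "braid set" where
  "1 \<in> B3"
| "x \<in> B3 \<Longrightarrow> s \<noteq> Sigma3 \<Longrightarrow> braid_gen s e * x \<in> B3"

text \<open>Since s3 = a^-1 s1, each letter s3 is traded for s1 and an element of F, which normality
  moves to the left.\<close>

lemma braid_decompose: "\<exists>w y. y \<in> B3 \<and> x = free_braid w * y"
proof (induction x rule: braid_induct)
  case 1
  show ?case by (intro exI[of _ "[]"] exI[of _ 1]) (simp add: B3.intros)
next
  case (2 s e x)
  then obtain w y where y: "y \<in> B3" "x = free_braid w * y" by blast
  obtain v where v: "braid_gen s e * free_braid w = free_braid v * braid_gen s e"
    using normalizes_sigma unfolding normalizes_def by blast
  then have eq: "braid_gen s e * x = free_braid v * (braid_gen s e * y)" by (simp add: y flip: mult.assoc)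
  consider "s \<noteq> Sigma3" | "s = Sigma3" "e" | "s = Sigma3" "\<not> e" by blast
  then show ?case
  proof cases
    case 1
    then show ?thesis using eq y(1) B3.intros(2) by blast
  next
    case 2
    have "braid_gen s e * x = free_braid (v @ [(False, False)]) * (s1 * y)"
      using 2 unfolding eq by (simp add: s3_eq free_braid_append mult.assoc)
    then show ?thesis using y(1) B3.intros(2)[of y Sigma1] by blast
  next
    case 3
    obtain u where "s1' * fa True = free_braid u * s1'"
      using normalizes_sigma unfolding normalizes_def fa_free by metis
    then have "braid_gen s e * x = free_braid (v @ u) * (s1' * y)"
      using 3 unfolding eq by (simp add: s3_eq free_braid_append mult.assoc)
    then show ?thesis using y(1) B3.intros(2)[of y Sigma1] by blast
  qed
qed

section \<open>Normal forms in the braid group on three strands\<close>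

definition dU :: braid where "dU = s1 * s2"
definition dDelta :: braid where "dDelta = s1 * s2 * s1"
definition dc :: braid where "dc = dDelta * dDelta"

primrec pos_word :: "bool list \<Rightarrow> braid" where
  "pos_word [] = 1"
| "pos_word (b # w) = (if b then s1 else s2') * pos_word w"

lemma delta_s1: "dDelta * s1 = s2 * dDelta" and delta_s2: "dDelta * s2 = s1 * dDelta"
proof -
  show "dDelta * s1 = s2 * dDelta"
    unfolding dDelta_def by (subst braid_rel_12) (simp add: mult.assoc)
  show "dDelta * s2 = s1 * dDelta"
    unfolding dDelta_def by (subst (2) braid_rel_12) (simp add: mult.assoc)
qed

lemma dc_comm: "dc * s1 = s1 * dc" "dc * s2 = s2 * dc" "dc * s2' = s2' * dc" "dc * s1' = s1' * dc"
proof -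
  have *: "dc * s1 = dDelta * (dDelta * s1)" "dc * s2 = dDelta * (dDelta * s2)"
    by (simp_all add: dc_def mult.assoc)
  show 1: "dc * s1 = s1 * dc" unfolding * delta_s1 by (simp add: delta_s2 dc_def flip: mult.assoc)
  show 2: "dc * s2 = s2 * dc" unfolding * delta_s2 by (simp add: delta_s1 dc_def flip: mult.assoc)
  show "dc * s2' = s2' * dc" using conj_inverse[of s2' s2 dc dc] 2 by simp
  show "dc * s1' = s1' * dc" using conj_inverse[of s1' s1 dc dc] 1 by simp
qed

lemma dU_cube: "dU * dU * dU = dc"
proof -
  have "dU * dU * dU = s1 * s2 * s1 * (s2 * s1 * s2)" by (simp add: dU_def mult.assoc)
  then show ?thesis unfolding braid_rel_12[symmetric] by (simp add: dc_def dDelta_def)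
qed

lemma dU_simps: "dU * s1 = dDelta" "dU * s2' = s1" "dU * dDelta = dc * s2'"
proof -
  show "dU * s1 = dDelta" "dU * s2' = s1" by (simp_all add: dU_def dDelta_def mult.assoc)
  have "dU * dDelta * s2 = dU * s1 * dDelta" by (simp add: delta_s2 mult.assoc)
  also have "\<dots> = dc" by (simp add: dU_def dc_def dDelta_def mult.assoc)
  finally have "dU * dDelta * s2 * s2' = dc * s2'" by simp
  then show "dU * dDelta = dc * s2'" by (simp add: mult.assoc)
qed

lemma dc_cancel: "dc * x = dc * y \<Longrightarrow> x = y"
proof -
  assume "dc * x = dc * y"
  moreover have "s1' * s2' * s1' * s1' * s2' * s1' * dc = 1"
    by (simp add: dc_def dDelta_def mult.assoc)
  ultimately show ?thesis by (metis mult.assoc mult_1_left)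
qed

lemma dc_power_cancel: "dc ^ n * x = dc ^ n * y \<Longrightarrow> x = y"
  by (induction n) (auto simp: mult.assoc dest: dc_cancel)

text \<open>In \<open>PSL\<^sub>2(\<int>)\<close> the elements \<open>dDelta\<close> and \<open>dU\<close> generate the free factors of order 2 and 3; an
  alternating word in them collapses to a positive word in \<open>s1\<close> and \<open>s2\<^sup>-\<^sup>1\<close>.\<close>

definition normal_form :: "braid \<Rightarrow> bool" where
  "normal_form x \<longleftrightarrow> (\<exists>m n i w j. i < 2 \<and> j < 3 \<and>
     dc ^ m * x = dc ^ n * dDelta ^ i * pos_word w * dU ^ j)"

lemma dc_power_comm:
  "dc ^ n * s1 = s1 * dc ^ n" "dc ^ n * s2 = s2 * dc ^ n" "dc ^ n * s2' = s2' * dc ^ n"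
  "dc ^ n * dU = dU * dc ^ n" "dc ^ n * dDelta = dDelta * dc ^ n"
proof -
  have *: "dc ^ n * x = x * dc ^ n" if "dc * x = x * dc" for x
    using that by (metis power_commuting_commutes)
  have "dc * dU = dU * dc" unfolding dU_def by (metis dc_comm mult.assoc)
  moreover have "dc * dDelta = dDelta * dc" by (simp add: dc_def mult.assoc)
  ultimately show "dc ^ n * s1 = s1 * dc ^ n" "dc ^ n * s2 = s2 * dc ^ n" "dc ^ n * s2' = s2' * dc ^ n"
    "dc ^ n * dU = dU * dc ^ n" "dc ^ n * dDelta = dDelta * dc ^ n"
    using dc_comm by (auto intro!: *)
qed

lemma normal_form_Delta:
  assumes "normal_form x"
  shows "normal_form (dDelta * x)"
proof -
  obtain m n i w j where x: "i < 2" "j < 3" "dc ^ m * x = dc ^ n * dDelta ^ i * pos_word w * dU ^ j"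
    using assms unfolding normal_form_def by blast
  have "dc ^ m * (dDelta * x) = dDelta * (dc ^ m * x)"
    using dc_power_comm(5)[of m] by (metis mult.assoc)
  also have "\<dots> = dc ^ n * (dDelta * dDelta ^ i) * pos_word w * dU ^ j"
    unfolding x using dc_power_comm(5)[of n] by (metis mult.assoc)
  finally have eq: "dc ^ m * (dDelta * x) = dc ^ n * (dDelta * dDelta ^ i) * pos_word w * dU ^ j" .
  consider "i = 0" | "i = 1" using x(1) by linarith
  then show ?thesis
  proof cases
    case 1
    then have "dc ^ m * (dDelta * x) = dc ^ n * dDelta ^ 1 * pos_word w * dU ^ j" using eq by simp
    then show ?thesis unfolding normal_form_def using x(2) one_less_numeral_iff semiring_norm(76) by blast
  next
    case 2
    then have "dc ^ m * (dDelta * x) = dc ^ Suc n * dDelta ^ 0 * pos_word w * dU ^ j"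
      using eq by (simp add: dc_def power_commutes mult.assoc flip: power_Suc2)
    then show ?thesis unfolding normal_form_def using x(2) zero_less_numeral by blast
  qed
qed

lemma normal_form_U:
  assumes "normal_form x"
  shows "normal_form (dU * x)"
proof -
  obtain m n i w j where x: "i < 2" "j < 3" "dc ^ m * x = dc ^ n * dDelta ^ i * pos_word w * dU ^ j"
    using assms unfolding normal_form_def by blast
  have "dc ^ m * (dU * x) = dU * (dc ^ m * x)"
    using dc_power_comm(4)[of m] by (metis mult.assoc)
  also have "\<dots> = dc ^ n * (dU * dDelta ^ i) * pos_word w * dU ^ j"
    unfolding x using dc_power_comm(4)[of n] by (metis mult.assoc)
  finally have eq: "dc ^ m * (dU * x) = dc ^ n * (dU * dDelta ^ i) * pos_word w * dU ^ j" .
  \<comment> \<open>A leading Delta becomes s2^-1, since U Delta = c s2^-1; a leading letter is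
    rewritten by U s1 = Delta or U s2^-1 = s1. Only for the empty word does the power of U grow, and
    U^3 = c bounds it.\<close>
  consider "i = 1" | b v where "i = 0" "w = b # v" | "i = 0" "w = []" using x(1)
    by (cases w) (auto simp: less_2_cases_iff)
  then show ?thesis
  proof cases
    case 1
    have "dc ^ m * (dU * x) = dc ^ Suc n * dDelta ^ 0 * pos_word (False # w) * dU ^ j"
      using eq 1 by (simp add: dU_simps mult.assoc power_Suc2 del: power_Suc)
    then show ?thesis unfolding normal_form_def using x(2) zero_less_numeral by blast
  next
    case (2 b v)
    have "dc ^ m * (dU * x) = dc ^ n * dDelta ^ (if b then 1 else 0) * pos_word (if b then v else True # v) * dU ^ j"
      using eq 2 dU_simps by (auto simp: mult.assoc) (metis mult.assoc)+
    moreover have "(if b then 1 else 0) < (2::nat)" by simp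
    ultimately show ?thesis unfolding normal_form_def using x(2) by blast
  next
    case 3
    show ?thesis
    proof (cases "j = 2")
      case True
      have "dc ^ m * (dU * x) = dc ^ Suc n * dDelta ^ 0 * pos_word [] * dU ^ 0"
        using eq 3 True dU_cube by (simp add: mult.assoc power2_eq_square flip: power_Suc2)
      then show ?thesis unfolding normal_form_def using zero_less_numeral by blast
    next
      case False
      have "dc ^ m * (dU * x) = dc ^ n * dDelta ^ 0 * pos_word [] * dU ^ Suc j"
        using eq 3 by (simp add: mult.assoc)
      moreover have "Suc j < 3" using x(2) False by linarith
      ultimately show ?thesis unfolding normal_form_def using zero_less_numeral by blast
    qed
  qed
qed

lemma normal_form_dc:
  assumes "normal_form (dc * x)"
  shows "normal_form x"
proof -
  obtain m n i w j where x: "i < 2" "j < 3" "dc ^ m * (dc * x) = dc ^ n * dDelta ^ i * pos_word w * dU ^ j"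
    using assms unfolding normal_form_def by blast
  then have "dc ^ Suc m * x = dc ^ n * dDelta ^ i * pos_word w * dU ^ j"
    by (simp only: power_Suc2 mult.assoc)
  then show ?thesis unfolding normal_form_def using x by blast
qed

text \<open>Multiplied by c, each of s1, s2 and their inverses is a positive word in Delta and U.
  This is why powers of c stand on both sides in \<open>normal_form\<close>.\<close>

lemma normal_form_B3: "x \<in> B3 \<Longrightarrow> normal_form x"
proof (induction rule: B3.induct)
  case 1
  have "dc ^ 0 * 1 = dc ^ 0 * dDelta ^ 0 * pos_word [] * dU ^ 0" by simp
  then show ?case unfolding normal_form_def using zero_less_numeral by blast
next
  case (2 x s e)
  have "dc * s1 = dU * (dU * dDelta)"
    using dU_cube dU_simps(1) dU_def by (metis mult.assoc dU_simps(3) dc_comm(1,3) dU_simps(2))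
  moreover have "dc * s1' = dDelta * dU" by (simp add: dc_def dDelta_def dU_def mult.assoc)
  moreover have "dc * s2 = dDelta * (dU * dU)"
    by (simp add: dc_def dDelta_def dU_def mult.assoc)
  moreover note dU_simps(3)[symmetric]
  ultimately have "\<exists>y. dc * braid_gen s e = y \<and> y \<in> {dU * (dU * dDelta), dDelta * dU, dDelta * (dU * dU), dU * dDelta}"
    using 2(2) by (cases s; cases e) auto
  then obtain y where y: "dc * braid_gen s e = y"
    "y \<in> {dU * (dU * dDelta), dDelta * dU, dDelta * (dU * dU), dU * dDelta}" by blast
  have "normal_form (y * x)"
    using y(2) 2(3) by (auto simp: mult.assoc intro!: normal_form_U normal_form_Delta)
  then have "normal_form (dc * braid_gen s e * x)" unfolding y .
  then show ?case by (simp only: mult.assoc) (rule normal_form_dc)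
qed

text \<open>The elements s1 and s2^-1 act by the two elementary matrices with nonnegative entries,
  so nothing cancels and each letter makes an off-diagonal entry positive for good.\<close>

lemma pos_word_affine:
  "\<exists>A B C D. (\<forall>u v. affine_action (pos_word w) (u, v) = (A * u + B * v, C * u + D * v)) \<and>
     1 \<le> A \<and> 0 \<le> B \<and> 0 \<le> C \<and> 1 \<le> D \<and> (w = [] \<or> 1 \<le> B + C)"
proof (induction w)
  case Nil
  show ?case by (intro exI[of _ 1] exI[of _ 0] exI) auto
next
  case (Cons b w)
  then obtain A B C D where *: "\<And>u v. affine_action (pos_word w) (u, v) = (A * u + B * v, C * u + D * v)"
    "1 \<le> A" "0 \<le> B" "0 \<le> C" "1 \<le> D" by blast
  show ?case
  proof (cases b)
    case True
    show ?thesis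
      by (rule exI[of _ "A + C"], rule exI[of _ "B + D"], rule exI[of _ C], rule exI[of _ D])
         (use * True in \<open>auto simp: algebra_simps\<close>)
  next
    case False
    show ?thesis
      by (rule exI[of _ A], rule exI[of _ B], rule exI[of _ "C + A"], rule exI[of _ "D + B"])
         (use * False in \<open>auto simp: algebra_simps\<close>)
  qed
qed

lemma affine_dc_power: "affine_action (dc ^ n) (u, v) = ((-1) ^ n * u, (-1) ^ n * v)"
  by (induction n arbitrary: u v) (simp_all add: dc_def dDelta_def)

text \<open>The central c acts as -1, and the matrix of Delta^i times a positive word times U^j is 1
  or -1 only in the trivial case. What remains is c^m x = c^n, and the exponent sum, which is 6 on
  c, gives m = n.\<close>

lemma B3_trivial:
  assumes x: "x \<in> B3" "affine_action x = id" "exp_sum x = 0"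
  shows "x = 1"
proof -
  obtain m n i w j where nf: "i < 2" "j < 3" "dc ^ m * x = dc ^ n * dDelta ^ i * pos_word w * dU ^ j"
    using normal_form_B3[OF x(1)] unfolding normal_form_def by blast
  obtain A B C D where w: "\<And>u v. affine_action (pos_word w) (u, v) = (A * u + B * v, C * u + D * v)"
    "1 \<le> A" "0 \<le> B" "0 \<le> C" "1 \<le> D" "w = [] \<or> 1 \<le> B + C"
      using pos_word_affine[of w] by blast
  have "affine_action (dc ^ m * x) p = affine_action (dc ^ n * dDelta ^ i * pos_word w * dU ^ j) p" for p
    unfolding nf ..
  from this[of "(1, 0)"] this[of "(0, 1)"]
  have eq: "((-1) ^ m * 1, (-1) ^ m * 0) = affine_action (dc ^ n * dDelta ^ i * pos_word w * dU ^ j) (1, 0)"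
    "((-1) ^ m * 0, (-1) ^ m * 1) = affine_action (dc ^ n * dDelta ^ i * pos_word w * dU ^ j) (0, 1)"
    using x(2) by (simp_all add: affine_dc_power)
  have sgn: "(-1 :: int) ^ k = 1 \<or> (-1 :: int) ^ k = -1" for k by (cases "even k") auto
  have "i = 0 \<and> j = 0 \<and> w = []"
    using eq w(2-) nf(1,2) sgn[of m] sgn[of n]
    by (auto simp: less_2_cases_iff numeral_3_eq_3 less_Suc_eq w(1) affine_dc_power dDelta_def dU_def)
  then have *: "dc ^ m * x = dc ^ n" using nf(3) by simp
  have "int m * exp_sum dc = int n * exp_sum dc"
    using arg_cong[OF *, of exp_sum] x(3) by simp
  then have "m = n" by (simp add: dc_def dDelta_def)
  then show ?thesis using * dc_power_cancel[of m x 1] by simp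
qed

section \<open>From freeness to faithfulness\<close>

lemma affine_free: "\<exists>E F. \<forall>u v. affine_action (free_braid w) (u, v) = (u + E, v + F)"
proof (induction w)
  case Nil
  show ?case by (intro exI[of _ 0]) simp
next
  case (Cons l w)
  then obtain E F where "\<And>u v. affine_action (free_braid w) (u, v) = (u + E, v + F)" by blast
  then show ?case
    by (intro exI[of _ "(if snd l then 1 else -1) + E"] exI[of _ "(if fst l then if snd l then -1 else 1 else 0) + F"])
       (auto simp: fa_def fb_def)
qed

lemma affine_B3_zero: "x \<in> B3 \<Longrightarrow> affine_action x (0, 0) = (0, 0)"
proof (induction rule: B3.induct)
  case (2 x s e)
  then show ?case by (cases s) auto
qed simp

lemma exp_sum_free: "exp_sum (free_braid w) = 0"
  by (induction w) (auto simp: fa_def fb_def)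

theorem burau_faithful_if_free:
  assumes free: "\<And>w. reduced w \<Longrightarrow> burau_braid (free_braid w) = mat 1 \<Longrightarrow> w = []"
    and x: "burau_braid x = mat 1"
  shows "x = 1"
proof -
  have free1: "free_braid w = 1" if "burau_braid (free_braid w) = mat 1" for w
    by (metis free free_braid.simps(1) free_braid_reduced that)
  have comm: "x * free_braid w = free_braid w * x" for w
  proof -
    obtain v where v: "x * free_braid w = free_braid v * x"
      using normalizes_all unfolding normalizes_def by blast
    obtain u where u: "free_braid u * free_braid w = 1" "free_braid w * free_braid u = 1"
      using free_braid_inverse by blast
    have "burau_braid (free_braid w) = burau_braid (free_braid v)"
      using arg_cong[OF v, of burau_braid] by (simp add: burau_braid_mult x)
    then have "burau_braid (free_braid (v @ u)) = burau_braid (free_braid w * free_braid u)"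
      by (simp add: free_braid_append burau_braid_mult)
    then have "free_braid v * free_braid u = 1"
      using free1[of "v @ u"] u by (simp add: free_braid_append)
    then have "free_braid v = free_braid w"
      using u by (metis mult.assoc mult_1_left mult_1_right)
    then show ?thesis using v by simp
  qed
  obtain w y where y: "y \<in> B3" "x = free_braid w * y" using braid_decompose by blast
  obtain A B C D E F where aff: "\<And>u v. affine_action x (u, v) = (A * u + B * v + E, C * u + D * v + F)"
    using affine_form by blast
  \<comment> \<open>The action is affine, so commuting with the translations a and b at the origin
    says that the linear part of \<open>x\<close> fixes (1, 0) and (1, -1).\<close>
  have "affine_action (x * fa True) (0, 0) = affine_action (fa True * x) (0, 0)"
    "affine_action (x * fb True) (0, 0) = affine_action (fb True * x) (0, 0)"
    using comm[of "[(False, True)]"] comm[of "[(True, True)]"] by simp_all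
  then have "A = 1" "C = 0" "B = 0" "D = 1"
    by (simp_all add: aff fa_def fb_def)
  then have affx: "affine_action x (u, v) = (u + E, v + F)" for u v by (simp add: aff)
  obtain E' F' where f: "\<And>u v. affine_action (free_braid w) (u, v) = (u + E', v + F')"
    using affine_free by blast
  have y_id: "affine_action y p = p" for p
  proof -
    \<comment> \<open>\<open>y\<close> is a translation, as \<open>x\<close> and the factor from F
      are, and it fixes the origin.\<close>
    obtain E2 F2 where y0: "affine_action y (u, v) = (u + E2, v + F2)" for u v
    proof (rule that[of "E - E'" "F - F'"])
      fix u v
      have "affine_action (free_braid w) (affine_action y (u, v)) = (u + E, v + F)"
        using affx[of u v] unfolding y(2) by simp
      then show "affine_action y (u, v) = (u + (E - E'), v + (F - F'))"
        by (cases "affine_action y (u, v)") (auto simp: f)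
    qed
    then show ?thesis using affine_B3_zero[OF y(1)] by (cases p) auto
  qed
  have "exp_sum y = 0"
    using exp_sum_kernel[OF x] unfolding y(2) by (simp add: exp_sum_free)
  then have "y = 1" using y_id by (intro B3_trivial[OF y(1)]) auto
  then show ?thesis using free1[of w] x y(2) by simp
qed

section \<open>Normalised unitary matrices\<close>

no_notation fps_nth (infixl "$" 75)

lemmas mat3_eq_simps = vec_eq_iff forall_3 matrix_matrix_mult_def sum_3

abbreviation lcoeff :: "'a::zero laurent \<Rightarrow> int \<Rightarrow> 'a" where
  "lcoeff \<equiv> Poly_Mapping.lookup"

type_synonym laurent_matrix = "complex laurent ^ 3 ^ 3"

abbreviation eval_matrix :: "laurent_matrix \<Rightarrow> complex ^ 3 ^ 3" where
  "eval_matrix \<equiv> map_matrix (laurent_eval (-\<i>))"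

lemma laurent_expand:
  fixes f :: "'a::comm_ring_1 laurent"
  shows "f = (\<Sum>k\<in>Poly_Mapping.keys f. lmonom (lcoeff f k) k)"
  by (rule poly_mapping_eqI)
     (simp add: lookup_sum lookup_single when_def sum.delta' not_in_keys_iff_lookup_eq_zero)

lemma lookup_monom_mult:
  fixes f :: "'a::comm_ring_1 laurent"
  shows "lcoeff (lmonom c j * f) k = c * lcoeff f (k - j)"
proof -
  have "lmonom c j * f = (\<Sum>i\<in>Poly_Mapping.keys f. lmonom (c * lcoeff f i) (j + i))"
    by (subst (1) laurent_expand[of f]) (simp add: sum_distrib_left mult_single)
  then have "lcoeff (lmonom c j * f) k =
      (\<Sum>i\<in>Poly_Mapping.keys f. lcoeff (lmonom (c * lcoeff f i) (j + i)) k)"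
    by (simp add: lookup_sum)
  also have "\<dots> = (\<Sum>i\<in>Poly_Mapping.keys f. if i = k - j then c * lcoeff f i else 0)"
    by (intro sum.cong) (auto simp: lookup_single when_def)
  finally have "lcoeff (lmonom c j * f) k =
      (\<Sum>i\<in>Poly_Mapping.keys f. if i = k - j then c * lcoeff f i else 0)" .
  then show ?thesis
    by (simp add: sum.delta' not_in_keys_iff_lookup_eq_zero)
qed

lemma lookup_bar: "lcoeff (laurent_bar f) k = cnj (lcoeff f (-k))"
proof -
  have "lcoeff (laurent_bar f) k =
      (\<Sum>i\<in>Poly_Mapping.keys f. lcoeff (lmonom (cnj (lcoeff f i)) (-i)) k)"
    by (simp add: laurent_bar_def laurent_lift_def lookup_sum)
  also have "\<dots> = (\<Sum>i\<in>Poly_Mapping.keys f. if i = -k then cnj (lcoeff f i) else 0)"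
    by (intro sum.cong) (auto simp: lookup_single when_def)
  finally have "lcoeff (laurent_bar f) k =
      (\<Sum>i\<in>Poly_Mapping.keys f. if i = -k then cnj (lcoeff f i) else 0)" .
  then show ?thesis
    by (simp add: sum.delta' not_in_keys_iff_lookup_eq_zero)
qed

definition degree_le :: "int \<Rightarrow> 'a::zero laurent \<Rightarrow> bool" where
  "degree_le n f \<longleftrightarrow> (\<forall>k>n. lcoeff f k = 0)"

abbreviation dT :: "complex laurent" where
  "dT \<equiv> lT + lTinv"

lemma degree_le_dT:
  assumes "degree_le (n + 1) (dT * f)"
  shows "degree_le n f"
proof (cases "f = 0")
  case False
  let ?K = "Poly_Mapping.keys f"
  define j where "j = Max ?K"
  have K: "finite ?K" "?K \<noteq> {}" using False by auto
  have j: "j \<in> ?K" "\<And>k. k > j \<Longrightarrow> lcoeff f k = 0"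
    unfolding j_def using Max_in[OF K] Max_less_iff[OF K]
    by (auto simp: not_in_keys_iff_lookup_eq_zero[symmetric])
  have "lcoeff (dT * f) (j + 1) = lcoeff f j"
    using j(2)[of "j + 2"] by (simp add: distrib_right lookup_add lookup_monom_mult add.commute)
  then have "j \<le> n"
    using assms j(1) unfolding degree_le_def by (metis add_le_cancel_right in_keys_iff linorder_not_le)
  then show ?thesis using j(2) unfolding degree_le_def by simp
qed (simp add: degree_le_def)

lemma dT_nonzero: "dT \<noteq> 0"
proof
  assume "dT = 0"
  then have "lcoeff dT 1 = 0" by simp
  then show False by (simp add: lookup_add lookup_single)
qed

text \<open>The powers of \<open>u = (\<i> t)\<^sup>-\<^sup>1\<close>, the associate of the uniformizer whose value at \<open>t = -\<i>\<close> is \<open>1\<close>.\<close>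

definition upow :: "int \<Rightarrow> complex laurent" where
  "upow k = lmonom ((-\<i>) powi k) (-k)"

abbreviation uu :: "complex laurent" where "uu \<equiv> upow 1"

lemma upow_add: "upow j * upow k = upow (j + k)"
  by (simp add: upow_def mult_single power_int_add)

lemmas scalar_simps = matrix_mul_assoc mat_mult_mat upow_add

lemma upow_0 [simp]: "upow 0 = 1"
  by (simp add: upow_def)

lemma upow_eq_iff [simp]: "upow j = upow k \<longleftrightarrow> j = k"
proof
  assume "upow j = upow k"
  then have "lcoeff (upow j) (-j) = lcoeff (upow k) (-j)" by simp
  then show "j = k" by (auto simp: upow_def lookup_single when_def split: if_splits)
qed simp

lemma upow_nonzero [simp]: "upow k \<noteq> 0"
  using upow_add[of k "-k"] by auto

lemma upow_dvd: "upow k dvd 1"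
  using upow_add[of k "-k"] by (metis add.right_inverse dvd_triv_left upow_0)

lemma bar_upow: "laurent_bar (upow k) = upow (-k)"
proof -
  have "cnj ((-\<i>) powi k) = (-\<i>) powi (-k)"
    by (simp add: power_int_minus_left power_int_minus flip: power_int_inverse)
  then show ?thesis by (simp add: upow_def laurent_bar_monom)
qed

lemma eval_upow [simp]: "laurent_eval (-\<i>) (upow k) = 1"
  by (simp add: upow_def laurent_eval_monom power_int_minus)

text \<open>The fractional ideal (1+i)/2 Z[i], which will contain the off-diagonal first-row entries
  of elements of H at t = -i. All values of |x|^2 are multiples of 1/2; the classification of the
  edges rests on this.\<close>

definition kernel_lattice :: "complex set" where
  "kernel_lattice = {(1 + \<i>) / 2 * (of_int m + of_int n * \<i>) |m n. True}"

lemma kernel_lattice_add: "x \<in> kernel_lattice \<Longrightarrow> y \<in> kernel_lattice \<Longrightarrow> x + y \<in> kernel_lattice"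
  unfolding kernel_lattice_def
proof clarify
  fix a b c d :: int
  show "\<exists>m n. (1 + \<i>) / 2 * (of_int a + of_int b * \<i>) + (1 + \<i>) / 2 * (of_int c + of_int d * \<i>) =
      (1 + \<i>) / 2 * (of_int m + of_int n * \<i>) \<and> True"
    by (intro exI[of _ "a + c"] exI[of _ "b + d"]) (simp add: complex_eq_iff field_simps)
qed

lemma kernel_lattice_minus: "x \<in> kernel_lattice \<Longrightarrow> - x \<in> kernel_lattice"
  unfolding kernel_lattice_def
proof clarify
  fix a b :: int
  show "\<exists>m n. - ((1 + \<i>) / 2 * (of_int a + of_int b * \<i>)) = (1 + \<i>) / 2 * (of_int m + of_int n * \<i>) \<and> True"
    by (intro exI[of _ "- a"] exI[of _ "- b"]) (simp add: complex_eq_iff field_simps)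
qed

lemma kernel_lattice_0: "0 \<in> kernel_lattice"
  unfolding kernel_lattice_def by (rule CollectI, rule exI[of _ 0], rule exI[of _ 0]) simp

lemma kernel_lattice_norm:
  assumes "x \<in> kernel_lattice"
  obtains m n where "x = (1 + \<i>) / 2 * (of_int m + of_int n * \<i>)" "x * cnj x = of_int (m * m + n * n) / 2"
proof -
  obtain m n where x: "x = (1 + \<i>) / 2 * (of_int m + of_int n * \<i>)"
    using assms unfolding kernel_lattice_def by blast
  have "x * cnj x = of_int (m * m + n * n) / 2"
    unfolding x by (simp add: complex_eq_iff field_simps)
  then show thesis using that x by blast
qed

definition row_unipotent :: "complex \<Rightarrow> complex \<Rightarrow> complex ^ 3 ^ 3" where
  "row_unipotent r s = mat3 1 r s 0 1 0 0 0 1"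

lemma row_unipotent_mult: "row_unipotent r s ** row_unipotent r' s' = row_unipotent (r + r') (s + s')"
  by (simp add: row_unipotent_def mat3_eq_simps)

lemma row_unipotent_0: "row_unipotent 0 0 = mat 1"
  by (simp add: row_unipotent_def vec_eq_iff forall_3 mat_def)

lemma row_unipotent_eq_iff: "row_unipotent r s = row_unipotent r' s' \<longleftrightarrow> r = r' \<and> s = s'"
  by (auto simp: row_unipotent_def vec_eq_iff forall_3)

text \<open>Normalised representatives of the elements of \<open>H_group\<close>.\<close>

definition kernel_matrix :: "laurent_matrix \<Rightarrow> bool" where
  "kernel_matrix A \<longleftrightarrow> invertible A \<and> bar_matrix A ** D_form ** transpose A = D_form \<and>
     (\<exists>k. det A = upow k) \<and>
     (\<exists>r\<in>kernel_lattice. \<exists>s\<in>kernel_lattice. eval_matrix A = row_unipotent r s)"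

lemma bar_matrix_mult: "bar_matrix (A ** B) = bar_matrix A ** bar_matrix B"
  by (simp add: bar_matrix_def bar.map_matrix_mult)

lemma kernel_matrix_mult:
  assumes "kernel_matrix A" "kernel_matrix B"
  shows "kernel_matrix (A ** B)"
  unfolding kernel_matrix_def
proof (intro conjI)
  show "invertible (A ** B)" using assms by (simp add: kernel_matrix_def invertible_mult)
  have "bar_matrix (A ** B) ** D_form ** transpose (A ** B) =
      bar_matrix A ** (bar_matrix B ** D_form ** transpose B) ** transpose A"
    by (simp add: bar_matrix_mult matrix_transpose_mul matrix_mul_assoc)
  then show "bar_matrix (A ** B) ** D_form ** transpose (A ** B) = D_form"
    using assms by (simp add: kernel_matrix_def)
  show "\<exists>k. det (A ** B) = upow k"
    using assms by (auto simp: kernel_matrix_def det_mul upow_add)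
  obtain r s r' s' where "r \<in> kernel_lattice" "s \<in> kernel_lattice" "r' \<in> kernel_lattice" "s' \<in> kernel_lattice"
    "eval_matrix A = row_unipotent r s"
    "eval_matrix B = row_unipotent r' s'"
    using assms by (auto simp: kernel_matrix_def)
  then show "\<exists>r\<in>kernel_lattice. \<exists>s\<in>kernel_lattice. eval_matrix (A ** B) = row_unipotent r s"
    by (metis eval.map_matrix_mult row_unipotent_mult kernel_lattice_add)
qed

lemma det_scalar: "det (mat c :: 'a::comm_ring_1 ^ 3 ^ 3) = c * c * c"
  by (simp add: det_3 mat_def)

lemma scalar_mult_mult:
  fixes A B :: "'a::comm_ring_1 ^ 3 ^ 3"
  shows "(mat a ** A) ** (mat b ** B) = mat (a * b) ** (A ** B)"
proof -
  have "(mat a ** A) ** (mat b ** B) = mat b ** ((mat a ** A) ** B)" by (rule mat_left_commute)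
  also have "\<dots> = (mat b ** mat a) ** (A ** B)" by (simp only: matrix_mul_assoc)
  finally show ?thesis by (simp add: mat_mult_mat mult.commute)
qed

lemma mat_cancel:
  fixes A B :: "'a::idom ^ 3 ^ 3"
  assumes "mat c ** A = mat c ** B" "c \<noteq> 0"
  shows "A = B"
  using assms unfolding mat_mult_left vec_eq_iff by simp

text \<open>These scalars survive the normalisation: bar inverts u, and u has the value 1 at t =
  -i.\<close>

lemma kernel_matrix_upow: "kernel_matrix (mat (upow k))"
  unfolding kernel_matrix_def
proof (intro conjI)
  show "invertible (mat (upow k) :: laurent_matrix)" by (rule invertible_scalar[OF upow_dvd])
  show "bar_matrix (mat (upow k)) ** D_form ** transpose (mat (upow k)) = D_form"
    using scalar_mult_mult[of "upow (-k)" D_form "upow k" "mat 1"]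
    by (simp add: bar_matrix_def bar.map_matrix_mat bar_upow transpose_mat upow_add)
  show "\<exists>j. det (mat (upow k) :: laurent_matrix) = upow j"
    by (auto simp: det_scalar upow_add)
  show "\<exists>r\<in>kernel_lattice. \<exists>s\<in>kernel_lattice. eval_matrix (mat (upow k)) = row_unipotent r s"
    using kernel_lattice_0 by (auto simp: eval.map_matrix_mat intro!: bexI[of _ 0] row_unipotent_0[symmetric])
qed

lemma kernel_matrix_inverse:
  assumes "kernel_matrix A" "A ** B = mat 1" "B ** A = mat 1"
  shows "kernel_matrix B"
  unfolding kernel_matrix_def
proof (intro conjI)
  show "invertible B" using assms by (auto simp: invertible_def)
  have 1: "bar_matrix B ** bar_matrix A = mat 1"
    using assms(3) by (simp add: bar_matrix_def bar.map_matrix_mat bar.one flip: bar.map_matrix_mult)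
  have 2: "transpose A ** transpose B = mat 1"
    using assms(3) by (simp add: transpose_mat flip: matrix_transpose_mul)
  have "bar_matrix B ** D_form ** transpose B =
      bar_matrix B ** (bar_matrix A ** D_form ** transpose A) ** transpose B"
    using assms(1) by (simp add: kernel_matrix_def)
  also have "\<dots> = (bar_matrix B ** bar_matrix A) ** D_form ** (transpose A ** transpose B)"
    by (simp only: matrix_mul_assoc)
  finally show "bar_matrix B ** D_form ** transpose B = D_form" by (simp add: 1 2)
  obtain k where k: "det A = upow k" using assms(1) by (auto simp: kernel_matrix_def)
  have "det A * det B = 1" using assms(2) by (metis det_mul det_I)
  then have "upow (-k) * (upow k * det B) = upow (-k)" by (simp add: k)
  then have "det B = upow (-k)" by (simp add: upow_add flip: mult.assoc)
  then show "\<exists>k. det B = upow k" by blast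
  obtain r s where rs: "r \<in> kernel_lattice" "s \<in> kernel_lattice"
    "eval_matrix A = row_unipotent r s"
    using assms by (auto simp: kernel_matrix_def)
  let ?B = "eval_matrix B"
  have "?B ** row_unipotent r s = mat 1"
    using assms(3) by (simp add: eval.map_matrix_mat eval.one flip: rs(3) eval.map_matrix_mult)
  then have "?B ** (row_unipotent r s ** row_unipotent (- r) (- s)) = row_unipotent (- r) (- s)"
    by (simp add: matrix_mul_assoc)
  then have "?B = row_unipotent (- r) (- s)"
    by (simp add: row_unipotent_mult row_unipotent_0)
  then show "\<exists>r\<in>kernel_lattice. \<exists>s\<in>kernel_lattice. ?B = row_unipotent r s"
    using rs kernel_lattice_minus by blast
qed

text \<open>The transition matrices between equal or adjacent vertices.\<close>

definition near :: "laurent_matrix \<Rightarrow> bool" where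
  "near A \<longleftrightarrow> kernel_matrix A \<and> (\<forall>i j. degree_le 0 (A $ i $ j)) \<and>
     (\<exists>B. A ** B = mat 1 \<and> B ** A = mat 1 \<and> (\<forall>i j. degree_le 1 (B $ i $ j)))"

lemma near_1: "near (mat 1)"
  unfolding near_def
proof (intro conjI allI exI[of _ "mat 1"])
  show "kernel_matrix (mat 1)" using kernel_matrix_upow[of 0] by simp
  show "degree_le 0 (mat 1 $ i $ j :: complex laurent)" "degree_le 1 (mat 1 $ i $ j :: complex laurent)" for i j
    by (auto simp: degree_le_def mat_def lookup_one)
qed simp_all

lemma degree_le_monom: "degree_le n f \<Longrightarrow> degree_le (n + k) (lmonom c k * (f :: complex laurent))"
  by (simp add: degree_le_def lookup_monom_mult)

text \<open>Reversal of an edge. It exchanges the determinants u and u^2, so only one of the two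
  orientations has to be classified.\<close>

lemma near_star:
  assumes "near A" "A ** B = mat 1" "B ** A = mat 1"
  shows "near (mat uu ** B)"
proof -
  obtain B' :: "laurent_matrix" where B': "A ** B' = mat 1" "B' ** A = mat 1" "\<And>i j. degree_le 1 (B' $ i $ j)"
    using assms(1) unfolding near_def by blast
  have "B' = B" using assms(2) B'(2) by (metis matrix_mul_assoc matrix_mul_lid matrix_mul_rid)
  have entry: "(mat c ** A) $ i $ j = c * A $ i $ j" for c i j and A :: "laurent_matrix"
    by (simp add: mat_mult_left)
  have "kernel_matrix (mat uu ** B)"
    using assms unfolding near_def
    by (blast intro: kernel_matrix_mult[OF kernel_matrix_upow] kernel_matrix_inverse)
  moreover have "degree_le 0 ((mat uu ** B) $ i $ j)" for i j
    using degree_le_monom[OF B'(3), of "-1" "-\<i>" i j] unfolding entry \<open>B' = B\<close> by (simp add: upow_def)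
  moreover have "degree_le 1 ((mat (upow (-1)) ** A) $ i $ j)" for i j
    using degree_le_monom[of 0 "A $ i $ j" 1] assms(1) unfolding entry near_def by (simp add: upow_def)
  moreover have "mat uu ** B ** (mat (upow (-1)) ** A) = mat 1"
    "mat (upow (-1)) ** A ** (mat uu ** B) = mat 1"
    by (simp_all add: scalar_mult_mult assms upow_add)
  ultimately show ?thesis unfolding near_def by blast
qed

section \<open>Classification of the transition matrices of edges\<close>

text \<open>The Laurent polynomials \<open>m + (1 - m) u\<close>, \<open>m (1 - u)\<close> and \<open>m (1 - u\<^sup>2)\<close>.\<close>

definition daff :: "complex \<Rightarrow> complex laurent" where
  "daff m = lconst m + lmonom (-\<i> * (1 - m)) (-1)"

definition oaff :: "complex \<Rightarrow> complex laurent" where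
  "oaff m = lconst m + lmonom (\<i> * m) (-1)"

definition caff :: "complex \<Rightarrow> complex laurent" where
  "caff c = lconst c + lmonom c (-2)"

lemma laurent_two_terms:
  assumes "degree_le 0 f" "degree_le 1 (laurent_bar f)"
  shows "f = lconst (lcoeff f 0) + lmonom (lcoeff f (-1)) (-1)"
proof (rule poly_mapping_eqI)
  fix k :: int
  consider "k > 0" | "k = 0" | "k = -1" | "k < -1" by linarith
  then show "lcoeff f k = lcoeff (lconst (lcoeff f 0) +
      lmonom (lcoeff f (-1)) (-1)) k"
  proof cases
    case 4
    then have "lcoeff (laurent_bar f) (-k) = 0" using assms(2) unfolding degree_le_def by simp
    then show ?thesis using 4 by (simp add: lookup_bar lookup_add lookup_single)
  qed (use assms(1) in \<open>auto simp: degree_le_def lookup_add lookup_single\<close>)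
qed

lemma laurent_const:
  assumes "degree_le 0 f" "degree_le 0 (laurent_bar f)"
  shows "f = lconst (lcoeff f 0)"
proof (rule poly_mapping_eqI)
  fix k :: int
  consider "k > 0" | "k = 0" | "k < 0" by linarith
  then show "lcoeff f k = lcoeff (lconst (lcoeff f 0)) k"
  proof cases
    case 3
    then have "lcoeff (laurent_bar f) (-k) = 0" using assms(2) unfolding degree_le_def by simp
    then show ?thesis using 3 by (simp add: lookup_bar lookup_single)
  qed (use assms(1) in \<open>auto simp: degree_le_def lookup_single\<close>)
qed

lemma laurent_single:
  assumes "degree_le 1 f" "degree_le (-1) (laurent_bar f)"
  shows "f = lmonom (lcoeff f 1) 1"
proof (rule poly_mapping_eqI)
  fix k :: int
  consider "k > 1" | "k = 1" | "k < 1" by linarith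
  then show "lcoeff f k = lcoeff (lmonom (lcoeff f 1) 1) k"
  proof cases
    case 3
    then have "lcoeff (laurent_bar f) (-k) = 0" using assms(2) unfolding degree_le_def by simp
    then show ?thesis using 3 by (simp add: lookup_bar lookup_single)
  qed (use assms(1) in \<open>auto simp: degree_le_def lookup_single\<close>)
qed

lemma bar_bar: "laurent_bar (laurent_bar f) = f"
  by (rule poly_mapping_eqI) (simp add: lookup_bar)

lemma bar_dT: "laurent_bar dT = dT"
  by (simp add: bar.add laurent_bar_monom add.commute)

lemma eval_two_terms: "laurent_eval (-\<i>) (lconst a + lmonom b (-1)) = a + \<i> * b"
  by (simp add: eval.add laurent_eval_monom power_int_minus)

lemma eval_diag: "laurent_eval (-\<i>) (lconst a + lmonom b (-1)) = 1 \<Longrightarrow> lconst a + lmonom b (-1) = daff a"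
  and eval_offdiag: "laurent_eval (-\<i>) (lconst a + lmonom b (-1)) = 0 \<Longrightarrow> lconst a + lmonom b (-1) = oaff a"
proof -
  assume "laurent_eval (-\<i>) (lconst a + lmonom b (-1)) = 1"
  then have "b = -\<i> * (1 - a)" unfolding eval_two_terms by (simp add: complex_eq_iff; argo)
  then show "lconst a + lmonom b (-1) = daff a" by (simp add: daff_def)
next
  assume "laurent_eval (-\<i>) (lconst a + lmonom b (-1)) = 0"
  then have "b = \<i> * a" unfolding eval_two_terms by (simp add: complex_eq_iff; argo)
  then show "lconst a + lmonom b (-1) = oaff a" by (simp add: oaff_def)
qed

text \<open>Unitarity gives \<open>D_form\<close> bar(A)^T = A^-1 \<open>D_form\<close>, so the
  degree bound on the inverse bounds the exponents of A from below. What survives are constants in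
  the first row, multiples of 1 + t^-2 in the first column, and two-term entries elsewhere,
  including the corner; one coefficient of the latter is fixed by the value at t = -i.\<close>

lemma near_shape:
  assumes "near A"
  obtains a r s c e m n p q where
    "A = mat3 (daff a) (lconst r) (lconst s) (caff c) (daff m) (oaff n) (caff e) (oaff p) (daff q)"
    "r \<in> kernel_lattice" "s \<in> kernel_lattice"
    "eval_matrix A = row_unipotent r s"
proof -
  obtain B :: "laurent_matrix" where B: "A ** B = mat 1" "B ** A = mat 1"
      "\<And>i j. degree_le 1 (B $ i $ j)"
    using assms unfolding near_def by blast
  have A0: "degree_le 0 (A $ i $ j)" for i j using assms unfolding near_def by blast
  obtain r' s' where rs: "r' \<in> kernel_lattice" "s' \<in> kernel_lattice"
      "eval_matrix A = row_unipotent r' s'"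
    using assms unfolding near_def kernel_matrix_def by blast
  have uni: "bar_matrix A ** D_form ** transpose A = D_form"
    using assms unfolding near_def kernel_matrix_def by blast
  have "transpose (bar_matrix A ** D_form ** transpose A) = A ** D_form ** transpose (bar_matrix A)"
    by (simp add: matrix_transpose_mul D_form_def matrix_mul_assoc transpose_def vec_eq_iff forall_3
        matrix_matrix_mult_def sum_3)
  moreover have "transpose D_form = D_form" by (simp add: D_form_def transpose_def vec_eq_iff forall_3)
  ultimately have "A ** D_form ** transpose (bar_matrix A) = D_form" unfolding uni by simp
  then have "B ** (A ** D_form ** transpose (bar_matrix A)) = B ** D_form" by simp
  then have BD: "D_form ** transpose (bar_matrix A) = B ** D_form"
    using B(2) by (simp add: matrix_mul_assoc)
  have e: "(D_form ** transpose (bar_matrix A)) $ i $ j = (B ** D_form) $ i $ j" for i j unfolding BD ..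
  have e1: "laurent_bar (A $ 1 $ 1) = B $ 1 $ 1" "laurent_bar (A $ 2 $ 1) = B $ 1 $ 2 * dT"
    "laurent_bar (A $ 3 $ 1) = B $ 1 $ 3 * dT" "dT * laurent_bar (A $ 1 $ 2) = B $ 2 $ 1"
    "dT * laurent_bar (A $ 1 $ 3) = B $ 3 $ 1"
    using e[of 1 1] e[of 1 2] e[of 1 3] e[of 2 1] e[of 3 1]
    by (simp_all add: matrix_matrix_mult_def sum_3 D_form_def transpose_def bar_matrix_def)
  have e2: "dT * laurent_bar (A $ 2 $ 2) = B $ 2 $ 2 * dT" "dT * laurent_bar (A $ 3 $ 2) = B $ 2 $ 3 * dT"
    "dT * laurent_bar (A $ 2 $ 3) = B $ 3 $ 2 * dT" "dT * laurent_bar (A $ 3 $ 3) = B $ 3 $ 3 * dT"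
    using e[of 2 2] e[of 2 3] e[of 3 2] e[of 3 3]
    by (simp_all add: matrix_matrix_mult_def sum_3 D_form_def transpose_def bar_matrix_def)
  have e3: "laurent_bar (A $ 2 $ 2) = B $ 2 $ 2" "laurent_bar (A $ 3 $ 2) = B $ 2 $ 3"
    "laurent_bar (A $ 2 $ 3) = B $ 3 $ 2" "laurent_bar (A $ 3 $ 3) = B $ 3 $ 3"
    using e2 dT_nonzero by (simp_all add: mult.commute[of _ dT])
  have entry: "laurent_eval (-\<i>) (A $ i $ j) = row_unipotent r' s' $ i $ j" for i j
    using arg_cong[OF rs(3), of "\<lambda>M. M $ i $ j"] by simp
  have diag: "A $ i $ j = daff (lcoeff (A $ i $ j) 0)"
    if "degree_le 1 (laurent_bar (A $ i $ j))" "row_unipotent r' s' $ i $ j = 1" for i j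
    using laurent_two_terms[OF A0 that(1)] eval_diag entry[of i j] that(2) by metis
  have off: "A $ i $ j = oaff (lcoeff (A $ i $ j) 0)"
    if "degree_le 1 (laurent_bar (A $ i $ j))" "row_unipotent r' s' $ i $ j = 0" for i j
    using laurent_two_terms[OF A0 that(1)] eval_offdiag entry[of i j] that(2) by metis
  have const: "A $ 1 $ j = lconst (lcoeff (A $ 1 $ j) 0)" if "degree_le 1 (dT * laurent_bar (A $ 1 $ j))" for j
    by (rule laurent_const[OF A0]) (use degree_le_dT[of 0 "laurent_bar (A $ 1 $ j)"] that in simp)
  \<comment> \<open>The entry is divisible by t + t^-1, and the degree bounds leave only multiples
    of t^-1 (t + t^-1).\<close>
  have col: "\<exists>c. A $ i $ 1 = caff c" if "laurent_bar (A $ i $ 1) = b * dT" "degree_le 1 b" for i b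
  proof -
    have A: "A $ i $ 1 = dT * laurent_bar b"
      using arg_cong[OF that(1), of laurent_bar] by (simp only: bar_bar bar.mult bar_dT mult.commute)
    then have "degree_le (-1) (laurent_bar b)"
      using A0[of i 1] degree_le_dT[of "-1" "laurent_bar b"] by simp
    then have "b = lmonom (lcoeff b 1) 1" by (rule laurent_single[OF that(2)])
    then obtain d where "b = lmonom d 1" by blast
    then have "A $ i $ 1 = caff (cnj d)" unfolding A caff_def
      by (simp add: laurent_bar_monom distrib_right mult_single)
    then show ?thesis by blast
  qed
  obtain c e where ce: "A $ 2 $ 1 = caff c" "A $ 3 $ 1 = caff e"
    using col[OF e1(2) B(3)] col[OF e1(3) B(3)] by blast
  define r where "r = lcoeff (A $ 1 $ 2) 0"
  define s where "s = lcoeff (A $ 1 $ 3) 0"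
  have r: "A $ 1 $ 2 = lconst r" "A $ 1 $ 3 = lconst s"
    unfolding r_def s_def using e1 B(3) by (intro const; simp)+
  have "laurent_eval (-\<i>) (A $ 1 $ 2) = r" "laurent_eval (-\<i>) (A $ 1 $ 3) = s"
    unfolding r by (simp_all add: laurent_eval_monom)
  then have "r = r'" "s = s'" using entry[of 1 2] entry[of 1 3] by (simp_all add: row_unipotent_def)
  show thesis
  proof (rule that)
    show "A = mat3 (daff (lcoeff (A $ 1 $ 1) 0)) (lconst r) (lconst s)
       (caff c) (daff (lcoeff (A $ 2 $ 2) 0)) (oaff (lcoeff (A $ 2 $ 3) 0))
       (caff e) (oaff (lcoeff (A $ 3 $ 2) 0)) (daff (lcoeff (A $ 3 $ 3) 0))"
      using diag[of 1 1] diag[of 2 2] diag[of 3 3] off[of 2 3] off[of 3 2] e1(1) e3 B(3)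
      by (simp add: vec_eq_iff forall_3 r ce row_unipotent_def)
  qed (use rs \<open>r = r'\<close> \<open>s = s'\<close> in auto)
qed

lemma lookup_two: "lcoeff (2 * f) k = 2 * lcoeff (f :: complex laurent) k"
  by (simp only: mult_2 lookup_add)

lemma unitary_equations:
  assumes A: "A = mat3 (daff a) (lconst r) (lconst s) (caff c) (daff m) (oaff n) (caff e) (oaff p) (daff q)"
    and uni: "bar_matrix A ** D_form ** transpose A = D_form"
  shows "a - cnj a * a = \<i> * (cnj r * r + cnj s * s)"
    and "c = \<i> * cnj r" and "e = \<i> * cnj s"
    and "(1 - cnj a) * c * \<i> + cnj r * m + cnj s * n = 0"
    and "(1 - cnj a) * e * \<i> + cnj r * p + cnj s * q = 0"
    and "m - cnj m * m - cnj n * n = \<i> * (cnj c * c)"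
    and "q - cnj q * q - cnj p * p = \<i> * (cnj e * e)"
    and "p - cnj m * p - cnj n * q = \<i> * (cnj c * e)"
    and "n - cnj q * n - cnj p * m = \<i> * (cnj e * c)"
proof -
  have e: "lcoeff ((bar_matrix A ** D_form ** transpose A) $ i $ j) k = lcoeff (D_form $ i $ j) k"
    for i j k unfolding uni ..
  note simps = A matrix_matrix_mult_def sum_3 D_form_def transpose_def bar_matrix_def daff_def oaff_def caff_def
    bar.add laurent_bar_monom algebra_simps mult_single lookup_add lookup_single when_def lookup_zero lookup_one lookup_two
  have 1: "\<i> * (1 - cnj a) * a + (cnj r * r + cnj s * s) = 0"
    using e[of 1 1 1] by (simp add: simps)
  have 2: "\<i> * (1 - cnj a) * c + (cnj r * m + cnj s * n) = 0"
    "cnj a * c + cnj r * (-\<i> * (1 - m)) + cnj s * (\<i> * n) = 0"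
    using e[of 1 2 1] e[of 1 2 0] by (simp_all add: simps)
  have 3: "\<i> * (1 - cnj a) * e + (cnj r * p + cnj s * q) = 0"
    "cnj a * e + cnj r * (\<i> * p) + cnj s * (-\<i> * (1 - q)) = 0"
    using e[of 1 3 1] e[of 1 3 0] by (simp_all add: simps)
  have 4: "cnj c * c + \<i> * (1 - cnj m) * m - \<i> * cnj n * n = 0"
    "cnj e * e + \<i> * (1 - cnj q) * q - \<i> * cnj p * p = 0"
    "cnj c * e + \<i> * (1 - cnj m) * p - \<i> * cnj n * q = 0"
    "cnj e * c + \<i> * (1 - cnj q) * n - \<i> * cnj p * m = 0"
    using e[of 2 2 2] e[of 3 3 2] e[of 2 3 2] e[of 3 2 2] by (simp_all add: simps)
  have cancel: "x = \<i> * y" if "\<i> * x + y = 0" for x y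
    using that by (simp add: complex_eq_iff; argo)
  show "a - cnj a * a = \<i> * (cnj r * r + cnj s * s)"
    using 1 by (intro cancel) (simp add: algebra_simps)
  \<comment> \<open>Adding the conditions from the coefficients of t and of t^0 in position (1, 2)
    eliminates a, m and n.\<close>
  have "(1 - cnj a) * c = \<i> * (cnj r * m + cnj s * n)" using 2(1) by (intro cancel) (simp add: algebra_simps)
  then show c: "c = \<i> * cnj r" using 2(2) by (simp add: algebra_simps)
  have "(1 - cnj a) * e = \<i> * (cnj r * p + cnj s * q)" using 3(1) by (intro cancel) (simp add: algebra_simps)
  then show "e = \<i> * cnj s" using 3(2) by (simp add: algebra_simps)
  show "(1 - cnj a) * c * \<i> + cnj r * m + cnj s * n = 0" using 2(1) by (simp add: algebra_simps)
  show "(1 - cnj a) * e * \<i> + cnj r * p + cnj s * q = 0" using 3(1) by (simp add: algebra_simps)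
  show "m - cnj m * m - cnj n * n = \<i> * (cnj c * c)" using 4(1) by (intro cancel) (simp add: algebra_simps)
  show "q - cnj q * q - cnj p * p = \<i> * (cnj e * e)" using 4(2) by (intro cancel) (simp add: algebra_simps)
  show "p - cnj m * p - cnj n * q = \<i> * (cnj c * e)" using 4(3) by (intro cancel) (simp add: algebra_simps)
  show "n - cnj q * n - cnj p * m = \<i> * (cnj e * c)" using 4(4) by (intro cancel) (simp add: algebra_simps)
qed

text \<open>The highest point of the circle |a - 1/2| = 1/2; \<open>circle_cases\<close> shows how
  it is forced as the corner entry.\<close>

abbreviation calpha :: complex where "calpha \<equiv> (1 + \<i>) / 2"

definition matK :: "laurent_matrix" where
  "matK = diag3 1 uu uu"

text \<open>For m real with m - m^2 = |n|^2 the lower block is N + (1 - N) u, where N is the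
  orthogonal projection of rank 1 with first row (m, n).\<close>

definition matP :: "complex \<Rightarrow> complex \<Rightarrow> laurent_matrix" where
  "matP m n = mat3 uu 0 0 0 (daff m) (oaff n) 0 (oaff (cnj n)) (daff (1 - m))"

definition matR1 :: "complex \<Rightarrow> laurent_matrix" where
  "matR1 r = mat3 (daff calpha) (lconst r) 0 (caff (\<i> * cnj r)) (daff calpha) 0 0 0 uu"

definition matR2 :: "complex \<Rightarrow> laurent_matrix" where
  "matR2 r = mat3 (daff calpha) 0 (lconst r) 0 uu 0 (caff (\<i> * cnj r)) 0 (daff calpha)"

definition type2 :: "laurent_matrix \<Rightarrow> bool" where
  "type2 A \<longleftrightarrow> A = matK \<or> (\<exists>m n. cnj m = m \<and> m - m * m = n * cnj n \<and> A = matP m n) \<or>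
     (\<exists>r\<in>kernel_lattice. r * cnj r = 1 / 2 \<and> (A = matR1 r \<or> A = matR2 r))"

lemma aff_simps: "daff 0 = uu" "daff 1 = 1" "oaff 0 = 0" "caff 0 = 0"
  by (simp_all add: daff_def oaff_def caff_def upow_def)

lemma lconst_mult: "lconst (a * b) = lconst a * (lconst b :: complex laurent)"
  by (simp add: mult_single)

lemma daff_alt: "daff m = lconst m + (1 - lconst m) * uu"
  and oaff_alt: "oaff m = lconst m * (1 - uu)"
  and caff_alt: "caff m = lconst m * (1 - uu * uu)"
proof -
  have "lmonom (-\<i> * (1 - m)) (-1) = lconst (1 - m) * uu" "lmonom (\<i> * m) (-1) = - (lconst m * uu)"
    "lmonom m (-2) = - (lconst m * (uu * uu))"
    by (simp_all add: upow_def mult_single mult.commute flip: single_uminus)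
  moreover have "lconst (1 - m) = 1 - lconst m" by (simp add: single_diff)
  ultimately show "daff m = lconst m + (1 - lconst m) * uu" "oaff m = lconst m * (1 - uu)"
    "caff m = lconst m * (1 - uu * uu)"
    unfolding daff_def oaff_def caff_def by (simp_all add: algebra_simps)
qed

lemma det_block: "daff m * daff (1 - m) - oaff n * oaff p = uu" if "m - m * m = n * p"
proof -
  have "lconst m - lconst m * lconst m = lconst n * lconst p"
    using arg_cong[OF that, of lconst] by (simp add: single_diff lconst_mult)
  moreover have "lconst (1 - m) = 1 - lconst m" by (simp add: single_diff)
  ultimately show ?thesis unfolding daff_alt oaff_alt by algebra
qed

lemma det_R: "daff calpha * daff calpha - lconst r * caff (\<i> * cnj r) = uu" if "r * cnj r = 1 / 2"
proof -
  have "r * (\<i> * cnj r) = calpha * calpha"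
    using that by (simp add: complex_eq_iff field_simps)
  then have 1: "lconst r * lconst (\<i> * cnj r) = lconst calpha * lconst calpha"
    by (simp only: lconst_mult[symmetric])
  have "calpha + calpha - calpha * calpha - calpha * calpha = 1" by (simp add: complex_eq_iff)
  then have "lconst (calpha + calpha - calpha * calpha - calpha * calpha) = 1" by (simp only: single_one)
  then have 2: "lconst calpha + lconst calpha - lconst calpha * lconst calpha - lconst calpha * lconst calpha = 1"
    unfolding single_diff single_add lconst_mult .
  show ?thesis unfolding daff_alt caff_alt using 1 2 by algebra
qed

lemma idempotent_cases: "a = cnj a * a \<Longrightarrow> a = 0 \<or> a = 1"
proof -
  assume a: "a = cnj a * a"
  then have "cnj a = a" by (metis complex_cnj_cnj complex_cnj_mult mult.commute)
  then show ?thesis using a by simp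
qed

text \<open>The equation puts a on the circle |a - 1/2| = 1/2 at height N/2, and the circle has
  radius 1/2.\<close>

lemma circle_cases:
  assumes a: "a - cnj a * a = \<i> * (of_int N / 2)" and N: "0 \<le> N"
  shows "N = 0 \<and> (a = 0 \<or> a = 1) \<or> N = 1 \<and> a = calpha"
proof -
  have re: "Re a = Re a * Re a + Im a * Im a" and im: "Im a = of_int N / 2"
    using arg_cong[OF a, of Re] arg_cong[OF a, of Im] by (simp_all add: algebra_simps)
  have "(Re a - 1/2)\<^sup>2 + (Im a)\<^sup>2 = 1/4" using re by (simp add: power2_eq_square algebra_simps)
  then have "(of_int N / 2 :: real)\<^sup>2 \<le> 1/4" unfolding im by (smt (verit) zero_le_power2)
  then have "(real_of_int N)\<^sup>2 \<le> 1" by (simp add: power_divide)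
  then have "N \<le> 1" by (smt (verit) of_int_1_le_iff of_int_le_1_iff one_power2 power2_le_imp_le)
  then consider "N = 0" | "N = 1" using N by linarith
  then show ?thesis
  proof cases
    case 1
    then show ?thesis using a idempotent_cases[of a] by simp
  next
    case 2
    then have ima: "Im a = 1/2" using im by simp
    moreover have "Im a * Im a = 1/4" unfolding ima by simp
    then have "(Re a - 1/2)\<^sup>2 = 0" using re by (simp add: power2_eq_square algebra_simps)
    then have "Re a = 1/2" by simp
    ultimately show ?thesis using 2 by (simp add: complex_eq_iff)
  qed
qed

text \<open>Position (1, 1) of the unitarity condition bounds |r|^2 + |s|^2 by 1/2, so by
  discreteness at most one of r and s is nonzero, and its norm is then 1/2. The other equations pin
  down the lower block. Determinant u is left unlisted, since \<open>near_star\<close> reduces it to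
  u^2.\<close>

lemma near_cases:
  assumes "near A"
  shows "A = mat 1 \<or> det A = uu \<or> det A = upow 2 \<and> type2 A \<or> A = mat uu"
proof -
  obtain a r s c e m n p q where
    A: "A = mat3 (daff a) (lconst r) (lconst s) (caff c) (daff m) (oaff n) (caff e) (oaff p) (daff q)"
    and rs: "r \<in> kernel_lattice" "s \<in> kernel_lattice" using near_shape[OF assms] by metis
  have "bar_matrix A ** D_form ** transpose A = D_form"
    using assms unfolding near_def kernel_matrix_def by blast
  note eqs = unitary_equations[OF A this]
  obtain r1 r2 s1 s2 where rn: "r * cnj r = of_int (r1 * r1 + r2 * r2) / 2" "s * cnj s = of_int (s1 * s1 + s2 * s2) / 2"
    using kernel_lattice_norm rs by metis
  define N1 where "N1 = r1 * r1 + r2 * r2"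
  define N2 where "N2 = s1 * s1 + s2 * s2"
  have N: "0 \<le> N1" "0 \<le> N2" unfolding N1_def N2_def by simp_all
  have rn: "r * cnj r = of_int N1 / 2" "s * cnj s = of_int N2 / 2" using rn by (simp_all add: N1_def N2_def)
  have "a - cnj a * a = \<i> * (of_int (N1 + N2) / 2)"
    using eqs(1) rn by (simp add: mult.commute add_divide_distrib)
  from circle_cases[OF this] N consider
    (0) "N1 = 0" "N2 = 0" "a = 0 \<or> a = 1" | (1) "N1 = 1" "N2 = 0" "a = calpha" | (2) "N1 = 0" "N2 = 1" "a = calpha"
    by linarith
  then show ?thesis
  proof cases
    case 0
    have [simp]: "r = 0" "s = 0" "c = 0" "e = 0" using 0 rn eqs(2,3) by auto
    have m: "m = cnj m * m + cnj n * n" and q: "q = cnj q * q + cnj p * p"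
      and p: "p = cnj m * p + cnj n * q" and n: "n = cnj q * n + cnj p * m"
      using eqs(6-9) by (simp_all add: algebra_simps)
    have mr: "cnj m = m" by (subst (1 2) m) (simp add: mult.commute)
    have qr: "cnj q = q" by (subst (1 2) q) (simp add: mult.commute)
    have np: "n = cnj p" using arg_cong[OF p, of cnj] n mr qr by (simp add: add.commute mult.commute)
    then have pn: "p = cnj n" by simp
    \<comment> \<open>The coefficients m, n, p, q form a hermitian idempotent, and m + q is its
      trace. Trace 1 is the case of a projection of rank 1; otherwise the idempotent is 0 or
      1.\<close>
    have nmq: "n = n * (m + q)" using n mr qr pn by (simp add: algebra_simps)
    have mm: "m - m * m = n * cnj n" using m mr by (simp add: algebra_simps)
    have det: "det A = daff a * (daff m * daff q - oaff n * oaff p)"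
      unfolding A by (simp add: det_3 aff_simps algebra_simps)
    show ?thesis
    proof (cases "m + q = 1")
      case True
      then have q1: "q = 1 - m" by (simp add: algebra_simps)
      have "det A = daff a * uu" unfolding det q1 using det_block[of m n p] mm pn by simp
      then consider "a = 1" "det A = uu" | "a = 0" "det A = upow 2"
        using 0(3) by (auto simp: aff_simps upow_add)
      then show ?thesis
      proof cases
        case 2
        then have "A = matP m n" unfolding A matP_def q1 pn by (simp add: aff_simps)
        then show ?thesis using 2 mr mm unfolding type2_def by blast
      qed simp
    next
      case False
      then have "n = 0" using nmq by simp
      then have "m = 0 \<or> m = 1" "q = 0 \<or> q = 1" using m q pn idempotent_cases by simp_all
      then have "m = 0 \<and> q = 0 \<or> m = 1 \<and> q = 1" using False by auto
      moreover have "mat c = (mat3 c 0 0 0 c 0 0 0 c :: laurent_matrix)" for c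
        by (simp add: vec_eq_iff forall_3 mat_def)
      moreover have "uu * uu = upow 2" by (simp add: upow_add)
      ultimately show ?thesis using 0(3) det unfolding A type2_def matK_def
        by (auto simp: aff_simps \<open>n = 0\<close> pn)
    qed
  next
    case 1
    have rr: "r * cnj r = 1 / 2" "r \<noteq> 0" using 1 rn by auto
    have [simp]: "s = 0" "e = 0" using 1 rn eqs(3) by auto
    have c: "c = \<i> * cnj r" by (rule eqs(2))
    have "cnj r * (m - calpha) = 0"
      using eqs(4) unfolding c 1 by (simp add: field_simps)
    then have m: "m = calpha" using rr by simp
    have p: "p = 0" using eqs(5) rr by simp
    have "cnj c * c = r * cnj r" unfolding c by (simp add: algebra_simps)
    then have "cnj n * n = 0" using eqs(6) rr(1) unfolding m by (simp add: field_simps)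
    then have n: "n = 0" by simp
    have q: "q = 0 \<or> q = 1" using eqs(7) idempotent_cases[of q] by (simp add: p)
    have A': "A = mat3 (daff calpha) (lconst r) 0 (caff (\<i> * cnj r)) (daff calpha) 0 0 0 (daff q)"
      unfolding A 1 m n p c by (simp add: aff_simps)
    then have det: "det A = (daff calpha * daff calpha - lconst r * caff (\<i> * cnj r)) * daff q"
      by (simp add: det_3 algebra_simps)
    show ?thesis using q
    proof
      assume "q = 0"
      then show ?thesis using det_R[OF rr(1)] A' det rs rr unfolding type2_def matR1_def
        by (auto simp: aff_simps upow_add)
    qed (use det det_R[OF rr(1)] in \<open>simp add: aff_simps\<close>)
  next
    case 2
    have rr: "s * cnj s = 1 / 2" "s \<noteq> 0" using 2 rn by auto
    have [simp]: "r = 0" "c = 0" using 2 rn eqs(2) by auto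
    have e: "e = \<i> * cnj s" by (rule eqs(3))
    have "cnj s * (q - calpha) = 0"
      using eqs(5) unfolding e 2 by (simp add: field_simps)
    then have q: "q = calpha" using rr by simp
    have n: "n = 0" using eqs(4) rr by simp
    have "cnj e * e = s * cnj s" unfolding e by (simp add: algebra_simps)
    then have "cnj p * p = 0" using eqs(7) rr(1) unfolding q by (simp add: field_simps)
    then have p: "p = 0" by simp
    have m: "m = 0 \<or> m = 1" using eqs(6) idempotent_cases[of m] by (simp add: n)
    have A': "A = mat3 (daff calpha) 0 (lconst s) 0 (daff m) 0 (caff (\<i> * cnj s)) 0 (daff calpha)"
      unfolding A 2 q n p e by (simp add: aff_simps)
    then have det: "det A = (daff calpha * daff calpha - lconst s * caff (\<i> * cnj s)) * daff m"
      by (simp add: det_3 algebra_simps)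
    show ?thesis using m
    proof
      assume "m = 0"
      then show ?thesis using det_R[OF rr(1)] A' det rs rr unfolding type2_def matR2_def
        by (auto simp: aff_simps upow_add)
    qed (use det det_R[OF rr(1)] in \<open>simp add: aff_simps\<close>)
  qed
qed

section \<open>The cocycle on transition matrices\<close>

definition csign :: "complex \<Rightarrow> bool" where
  "csign z \<longleftrightarrow> Re z > 0 \<or> Re z = 0 \<and> Im z > 0"

lemma csign_minus: "z \<noteq> 0 \<Longrightarrow> csign (- z) \<longleftrightarrow> \<not> csign z"
  by (auto simp: csign_def complex_eq_iff)

text \<open>
  The second disjunct only serves to choose one of the two projections \<open>N\<close>, \<open>1 - N\<close> with top left entry \<open>1/2\<close>.
\<close>

definition proj_sign :: "complex \<Rightarrow> complex \<Rightarrow> bool" where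
  "proj_sign m n \<longleftrightarrow> Re m > 1 / 2 \<or> Re m = 1 / 2 \<and> csign n"

abbreviation coeff0 :: "complex laurent \<Rightarrow> complex" where
  "coeff0 f \<equiv> lcoeff f 0"

text \<open>
  The cocycle on the matrices of determinant \<open>u\<^sup>2\<close>. In a triangle of such matrices the off-diagonal
  entries of the first row sum to \<open>0\<close>; since no three vectors of norm \<open>1/2\<close> in \<open>kernel_lattice\<close> sum to \<open>0\<close>,
  at most two of them are nonzero and these are opposite. The relations follow as \<open>Vx\<close> commutes with \<open>Wx\<close>
  and with \<open>GZ\<close>, and \<open>Wx\<close> commutes with \<open>GY\<close>.
\<close>

definition theta2 :: "laurent_matrix \<Rightarrow> gen3 free_word \<Rightarrow> gen3 free_word" where
  "theta2 A x =
     (if A $ 1 $ 2 \<noteq> 0 then Wx' (lmult (GY, csign (coeff0 (A $ 1 $ 2))) x)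
      else if A $ 1 $ 3 \<noteq> 0 then Vx' (lmult (GZ, csign (coeff0 (A $ 1 $ 3))) x)
      else if A $ 1 $ 1 = 1 then Vx' (Vx' (Wx' (Wx' x)))
      else if proj_sign (coeff0 (A $ 2 $ 2)) (coeff0 (A $ 2 $ 3)) then Vx (Vx x) else Wx (Wx x))"

definition theta2' :: "laurent_matrix \<Rightarrow> gen3 free_word \<Rightarrow> gen3 free_word" where
  "theta2' A x =
     (if A $ 1 $ 2 \<noteq> 0 then Wx (lmult (GY, \<not> csign (coeff0 (A $ 1 $ 2))) x)
      else if A $ 1 $ 3 \<noteq> 0 then Vx (lmult (GZ, \<not> csign (coeff0 (A $ 1 $ 3))) x)
      else if A $ 1 $ 1 = 1 then Vx (Vx (Wx (Wx x)))
      else if proj_sign (coeff0 (A $ 2 $ 2)) (coeff0 (A $ 2 $ 3)) then Vx' (Vx' x) else Wx' (Wx' x))"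

lemma theta2_inverse [simp]: "theta2 A (theta2' A x) = x" "theta2' A (theta2 A x) = x"
  by (auto simp: theta2_def theta2'_def)

lemma coeff0_simps [simp]: "coeff0 (daff m) = m" "coeff0 (oaff m) = m" "coeff0 (lconst m) = m"
  by (simp_all add: daff_def oaff_def lookup_add lookup_single)

lemma daff_eq_iff: "daff m = daff n \<longleftrightarrow> m = n"
  by (metis coeff0_simps(1))

lemma lconst_eq_0: "lconst r = (0 :: complex laurent) \<longleftrightarrow> r = 0"
  by (metis single_zero coeff0_simps(3))

lemma uu_neq_1: "uu \<noteq> 1"
  using upow_eq_iff[of 1 0] by simp

lemma theta2_K: "theta2 matK x = Vx' (Vx' (Wx' (Wx' x)))"
  by (simp add: theta2_def matK_def)

lemma theta2_P: "theta2 (matP m n) x = (if proj_sign m n then Vx (Vx x) else Wx (Wx x))"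
  by (simp add: theta2_def matP_def uu_neq_1)

lemma theta2_R1: "r \<noteq> 0 \<Longrightarrow> theta2 (matR1 r) x = Wx' (lmult (GY, csign r) x)"
  by (simp add: theta2_def matR1_def lconst_eq_0)

lemma theta2_R2: "r \<noteq> 0 \<Longrightarrow> theta2 (matR2 r) x = Vx' (lmult (GZ, csign r) x)"
  by (simp add: theta2_def matR2_def lconst_eq_0)

section \<open>The triangle relations for matrices of determinant u^2\<close>

lemma rotate_product:
  fixes X Y Z :: "laurent_matrix"
  assumes "invertible X" "X ** Y ** Z = mat c"
  shows "Y ** Z ** X = mat c"
proof -
  obtain X' where X': "X' ** X = mat 1" using assms(1) by (auto simp: invertible_def)
  have "X ** (Y ** Z ** X) = (X ** Y ** Z) ** X" by (simp only: matrix_mul_assoc)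
  also have "\<dots> = X ** mat c" unfolding assms(2) by (simp only: mat_mult_commute)
  finally have "X' ** (X ** (Y ** Z ** X)) = X' ** (X ** mat c)" by simp
  then show ?thesis using X' by (simp add: matrix_mul_assoc)
qed

text \<open>A lattice element of norm 1/2 is (1+i)/2 times m + n i with m^2 + n^2 = 1, so m + n is
  odd, and three odd numbers do not add up to 0.\<close>

lemma three_units:
  assumes "x \<in> kernel_lattice" "y \<in> kernel_lattice" "z \<in> kernel_lattice"
    and "x * cnj x = 1 / 2" "y * cnj y = 1 / 2" "z * cnj z = 1 / 2"
  shows "x + y + z \<noteq> 0"
proof
  assume sum: "x + y + z = 0"
  have *: "\<exists>m n. w = (1 + \<i>) / 2 * (of_int m + of_int n * \<i>) \<and> odd (m + n)"
    if w: "w \<in> kernel_lattice" "w * cnj w = 1 / 2" for w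
  proof -
    obtain m n where mn: "w = (1 + \<i>) / 2 * (of_int m + of_int n * \<i>)" "w * cnj w = of_int (m * m + n * n) / 2"
      using kernel_lattice_norm[OF w(1)] by metis
    then have "(of_int (m * m + n * n) :: complex) = of_int 1" using w(2) by simp
    then have "m * m + n * n = 1" by (simp only: of_int_eq_iff)
    then have "odd (m * m + n * n)" by simp
    then have "odd (m + n)" by simp
    then show ?thesis using mn by blast
  qed
  obtain a b c d e f where abc: "x = (1 + \<i>) / 2 * (of_int a + of_int b * \<i>)" "odd (a + b)"
    "y = (1 + \<i>) / 2 * (of_int c + of_int d * \<i>)" "odd (c + d)"
    "z = (1 + \<i>) / 2 * (of_int e + of_int f * \<i>)" "odd (e + f)"
    using *[OF assms(1,4)] *[OF assms(2,5)] *[OF assms(3,6)] by metis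
  have "(1 + \<i>) / 2 * (of_int (a + c + e) + of_int (b + d + f) * \<i>) = 0"
    using sum unfolding abc by (simp add: algebra_simps add_divide_distrib)
  then have "of_int (a + c + e) + of_int (b + d + f) * \<i> = 0"
    by (simp add: complex_eq_iff)
  then have "a + c + e = 0" "b + d + f = 0"
    by (simp_all add: complex_eq_iff flip: of_int_add)
  then have "(a + b) + (c + d) + (e + f) = 0" by simp
  moreover have "odd ((a + b) + (c + d) + (e + f))" using abc(2,4,6) by (simp only: odd_add) simp
  ultimately show False by simp
qed

definition flat2 :: "laurent_matrix \<Rightarrow> bool" where
  "flat2 A \<longleftrightarrow> A = matK \<or> (\<exists>m n. cnj m = m \<and> m - m * m = n * cnj n \<and> A = matP m n)"

text \<open>Entry (3, 3) of the product forces Z = \<open>matP m n\<close> with m = 0. The relation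
  becomes W^-1 Y^e W^-1 Y^-e W^2 = 1, valid as W and Y commute.\<close>

lemma relation_R1:
  assumes r: "r * cnj r = 1 / 2" and Z: "flat2 Z" and prod: "matR1 r ** matR1 (- r) ** Z = mat (upow 2)"
  shows "theta2 (matR1 r) (theta2 (matR1 (- r)) (theta2 Z x)) = x"
proof -
  have r0: "r \<noteq> 0" "- r \<noteq> 0" using r by auto
  have "(matR1 r ** matR1 (- r) ** Z) $ 3 $ 3 = upow 2 * Z $ 3 $ 3"
    by (simp add: matR1_def matrix_matrix_mult_def sum_3 upow_add)
  then have "upow 2 * Z $ 3 $ 3 = upow 2 * 1" unfolding prod by (simp add: mat_def)
  then have Z33: "Z $ 3 $ 3 = 1" by (simp only: mult_cancel_left upow_nonzero) simp
  then obtain m n where mn: "m - m * m = n * cnj n" "Z = matP m n"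
    using Z uu_neq_1 by (auto simp: flat2_def matK_def)
  then have "daff (1 - m) = daff 1" using Z33 by (simp add: matP_def aff_simps)
  then have "m = 0" by (simp add: daff_eq_iff)
  then have "\<not> proj_sign m n" by (simp add: proj_sign_def)
  then show ?thesis using csign_minus[OF r0(1)]
    by (simp add: theta2_R1 r0 mn(2) theta2_P)
qed

lemma relation_R2:
  assumes r: "r * cnj r = 1 / 2" and Z: "flat2 Z" and prod: "matR2 r ** matR2 (- r) ** Z = mat (upow 2)"
  shows "theta2 (matR2 r) (theta2 (matR2 (- r)) (theta2 Z x)) = x"
proof -
  have r0: "r \<noteq> 0" "- r \<noteq> 0" using r by auto
  have "(matR2 r ** matR2 (- r) ** Z) $ 2 $ 2 = upow 2 * Z $ 2 $ 2"
    by (simp add: matR2_def matrix_matrix_mult_def sum_3 upow_add)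
  then have "upow 2 * Z $ 2 $ 2 = upow 2 * 1" unfolding prod by (simp add: mat_def)
  then have Z22: "Z $ 2 $ 2 = 1" by (simp only: mult_cancel_left upow_nonzero) simp
  then obtain m n where mn: "m - m * m = n * cnj n" "Z = matP m n"
    using Z uu_neq_1 by (auto simp: flat2_def matK_def)
  then have "daff m = daff 1" using Z22 by (simp add: matP_def aff_simps)
  then have "m = 1" by (simp add: daff_eq_iff)
  then have "proj_sign m n" by (simp add: proj_sign_def)
  then show ?thesis using csign_minus[OF r0(1)]
    by (simp add: theta2_R2 r0 mn(2) theta2_P)
qed

text \<open>The product condition makes the two projections complementary, and
  \<open>proj_sign\<close> holds for exactly one of them. So one edge has the value V^2, the other
  W^2, in either order, and \<open>matK\<close> has V^-2 W^-2.\<close>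

lemma relation_flat:
  assumes m: "cnj m = m" "m - m * m = n * cnj n" and prod: "matP m n ** matP m' n' ** matK = mat (upow 2)"
  shows "theta2 (matP m n) (theta2 (matP m' n') (theta2 matK x)) = x"
proof -
  have e: "(matP m n ** matP m' n' ** matK) $ i $ j = mat (upow 2) $ i $ j" for i j unfolding prod ..
  have "uu * (daff m * daff m' + oaff n * oaff (cnj n')) = uu * uu"
    using e[of 2 2] by (simp add: matP_def matK_def matrix_matrix_mult_def sum_3 mat_def upow_add algebra_simps)
  then have 1: "daff m * daff m' + oaff n * oaff (cnj n') = uu"
    by (simp only: mult_cancel_left upow_nonzero) simp
  have "uu * (daff m * oaff n' + oaff n * daff (1 - m')) = uu * 0"
    using e[of 2 3] by (simp add: matP_def matK_def matrix_matrix_mult_def sum_3 mat_def algebra_simps)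
  then have 2: "daff m * oaff n' + oaff n * daff (1 - m') = 0"
    by (simp only: mult_cancel_left upow_nonzero) simp
  note simps = daff_def oaff_def upow_def algebra_simps mult_single lookup_add lookup_single when_def
    lookup_zero lookup_one lookup_two
  \<comment> \<open>With the blocks written N + (1 - N) u and N' + (1 - N') u, these coefficients
    express N N' = 0 and (1 - N) (1 - N') = 0.\<close>
  have c1: "m * m' + n * cnj n' = 0" "(1 - m) * (1 - m') + n * cnj n' = 0"
    using arg_cong[OF 1, of coeff0] arg_cong[OF 1, of "\<lambda>f. lcoeff f (-2)"]
    by (simp_all add: simps)
  have c2: "m * n' + n * (1 - m') = 0" "(1 - m) * n' + n * m' = 0"
    using arg_cong[OF 2, of coeff0] arg_cong[OF 2, of "\<lambda>f. lcoeff f (-2)"]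
    by (simp_all add: simps)
  have m': "m' = 1 - m" using c1 by algebra
  have n': "n' = - n" using c2 unfolding m' by algebra
  have "proj_sign (1 - m) (- n) \<longleftrightarrow> \<not> proj_sign m n"
  proof (cases "Re m = 1 / 2")
    case True
    have "n \<noteq> 0"
    proof
      assume "n = 0"
      then have "m = 0 \<or> m = 1" using m(2) by (simp add: right_diff_distrib[symmetric])
      then show False using True by auto
    qed
    then show ?thesis using True csign_minus by (simp add: proj_sign_def)
  qed (auto simp: proj_sign_def)
  then show ?thesis by (simp add: m' n' theta2_P theta2_K)
qed

lemma type2_eval:
  assumes "type2 A"
  shows "eval_matrix A = row_unipotent (coeff0 (A $ 1 $ 2)) (coeff0 (A $ 1 $ 3))"
proof -
  have "laurent_eval (-\<i>) (daff m) = 1" "laurent_eval (-\<i>) (oaff m) = 0" "laurent_eval (-\<i>) (caff m) = 0" for m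
    by (simp_all add: daff_alt oaff_alt caff_alt eval.add eval.mult eval.diff eval.one)
  then show ?thesis using assms
    by (auto simp: type2_def matK_def matP_def matR1_def matR2_def row_unipotent_def vec_eq_iff forall_3
        eval.one eval.zero laurent_eval_monom)
qed

lemma type2_cases:
  assumes "type2 A"
  obtains "flat2 A" "coeff0 (A $ 1 $ 2) = 0" "coeff0 (A $ 1 $ 3) = 0"
  | r where "r \<in> kernel_lattice" "r * cnj r = 1 / 2" "A = matR1 r" "coeff0 (A $ 1 $ 2) = r" "coeff0 (A $ 1 $ 3) = 0"
  | r where "r \<in> kernel_lattice" "r * cnj r = 1 / 2" "A = matR2 r" "coeff0 (A $ 1 $ 2) = 0" "coeff0 (A $ 1 $ 3) = r"
  using assms unfolding type2_def flat2_def
  by (elim disjE exE bexE conjE) (auto simp: matK_def matP_def matR1_def matR2_def)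

lemma relation_one_flat:
  assumes X: "type2 X" "type2 Y" and Z: "flat2 Z" and nf: "\<not> flat2 X"
    and sum: "coeff0 (X $ 1 $ 2) + coeff0 (Y $ 1 $ 2) = 0" "coeff0 (X $ 1 $ 3) + coeff0 (Y $ 1 $ 3) = 0"
    and prod: "X ** Y ** Z = mat (upow 2)"
  shows "theta2 X (theta2 Y (theta2 Z x)) = x"
  using X(1)
proof (cases rule: type2_cases)
  case 1
  then show ?thesis using nf by simp
next
  case (2 r)
  from 2 have r0: "r \<noteq> 0" by auto
  from X(2) have "Y = matR1 (- r)"
    using 2 sum r0 by (cases rule: type2_cases) (auto simp: add_eq_0_iff)
  then show ?thesis using relation_R1[OF 2(2) Z] prod 2 by simp
next
  case (3 r)
  from 3 have r0: "r \<noteq> 0" by auto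
  from X(2) have "Y = matR2 (- r)"
    using 3 sum r0 by (cases rule: type2_cases) (auto simp: add_eq_0_iff)
  then show ?thesis using relation_R2[OF 3(2) Z] prod 3 by simp
qed

lemma theta2_rotate:
  assumes "\<And>x. theta2 Y (theta2 Z (theta2 X x)) = x"
  shows "theta2 X (theta2 Y (theta2 Z x)) = x"
  by (metis assms theta2_inverse)

text \<open>The corner entry is 1 for \<open>matK\<close> and u for \<open>matP\<close>. A product
  with corner u^2 therefore contains \<open>matK\<close> exactly once, and rotation moves it to the
  end.\<close>

lemma relation_all_flat:
  assumes flat: "flat2 X" "flat2 Y" "flat2 Z" and inv: "invertible X" "invertible Y"
    and prod: "X ** Y ** Z = mat (upow 2)"
  shows "theta2 X (theta2 Y (theta2 Z x)) = x"
proof -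
  have 1: "(X ** Y ** Z) $ 1 $ 1 = X $ 1 $ 1 * Y $ 1 $ 1 * Z $ 1 $ 1"
    using flat by (auto simp: flat2_def matK_def matP_def matrix_matrix_mult_def sum_3)
  have entry: "A $ 1 $ 1 = (if A = matK then 1 else uu)" if "flat2 A" for A
    using that by (auto simp: flat2_def matK_def matP_def)
  have "X $ 1 $ 1 * Y $ 1 $ 1 * Z $ 1 $ 1 = upow 2" using 1 unfolding prod by (simp add: mat_def)
  then have "upow ((if X = matK then 0 else 1) + (if Y = matK then 0 else 1) + (if Z = matK then 0 else 1)) = upow 2"
    unfolding entry[OF flat(1)] entry[OF flat(2)] entry[OF flat(3)]
    using upow_eq_iff[of 2 0] by (simp add: upow_add split: if_splits)
  then consider "X \<noteq> matK" "Y \<noteq> matK" "Z = matK" | "X \<noteq> matK" "Z \<noteq> matK" "Y = matK" | "Y \<noteq> matK" "Z \<noteq> matK" "X = matK"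
    by (auto split: if_splits)
  then show ?thesis
  proof cases
    case 1
    then show ?thesis using flat(1,2) prod by (auto simp: flat2_def relation_flat)
  next
    case 2
    have "Z ** X ** Y = mat (upow 2)" using prod rotate_product inv by metis
    then show ?thesis using flat(1,3) 2
      by - (rule theta2_rotate, rule theta2_rotate, auto simp: flat2_def relation_flat)
  next
    case 3
    have "Y ** Z ** X = mat (upow 2)" using prod rotate_product inv by metis
    then show ?thesis using flat(2,3) 3
      by - (rule theta2_rotate, auto simp: flat2_def relation_flat)
  qed
qed

lemma sum_zero_cases:
  fixes a b c :: complex
  assumes "\<And>w. w \<in> {a, b, c} \<Longrightarrow> w = 0 \<or> w \<in> kernel_lattice \<and> w * cnj w = 1 / 2" "a + b + c = 0"
  shows "a = 0 \<or> b = 0 \<or> c = 0"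
  using three_units[of a b c] assms by blast

theorem relation_type2:
  assumes X: "type2 X" "type2 Y" "type2 Z" and inv: "invertible X" "invertible Y"
    and prod: "X ** Y ** Z = mat (upow 2)"
  shows "theta2 X (theta2 Y (theta2 Z x)) = x"
proof -
  let ?r = "\<lambda>A :: laurent_matrix. coeff0 (A $ 1 $ 2)" and ?s = "\<lambda>A :: laurent_matrix. coeff0 (A $ 1 $ 3)"
  have "eval_matrix (X ** Y ** Z) = mat 1"
    unfolding prod by (simp add: eval.map_matrix_mat)
  then have "row_unipotent (?r X + ?r Y + ?r Z) (?s X + ?s Y + ?s Z) = row_unipotent 0 0"
    by (simp add: eval.map_matrix_mult type2_eval[OF X(1)] type2_eval[OF X(2)] type2_eval[OF X(3)]
        row_unipotent_mult row_unipotent_0)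
  then have sum: "?r X + ?r Y + ?r Z = 0" "?s X + ?s Y + ?s Z = 0"
    unfolding row_unipotent_eq_iff by simp_all
  have val: "(?r A = 0 \<or> ?r A \<in> kernel_lattice \<and> ?r A * cnj (?r A) = 1 / 2) \<and>
      (?s A = 0 \<or> ?s A \<in> kernel_lattice \<and> ?s A * cnj (?s A) = 1 / 2) \<and> (?r A = 0 \<or> ?s A = 0) \<and>
      (flat2 A \<longleftrightarrow> ?r A = 0 \<and> ?s A = 0)" if "type2 A" for A
    using that
  proof (cases rule: type2_cases)
    case (2 r)
    moreover from 2 have "r \<noteq> 0" by auto
    moreover from this have "\<not> flat2 A" unfolding \<open>A = matR1 r\<close>
      by (auto simp: flat2_def matR1_def matK_def matP_def vec_eq_iff forall_3 lconst_eq_0)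
    ultimately show ?thesis by simp
  next
    case (3 r)
    moreover from 3 have "r \<noteq> 0" by auto
    moreover from this have "\<not> flat2 A" unfolding \<open>A = matR2 r\<close>
      by (auto simp: flat2_def matR2_def matK_def matP_def vec_eq_iff forall_3 lconst_eq_0)
    ultimately show ?thesis by simp
  qed auto
  have rr: "?r X = 0 \<or> ?r Y = 0 \<or> ?r Z = 0" and ss: "?s X = 0 \<or> ?s Y = 0 \<or> ?s Z = 0"
    using val X by (intro sum_zero_cases sum; auto)+
  have YZX: "Y ** Z ** X = mat (upow 2)" by (rule rotate_product[OF inv(1) prod])
  have ZXY: "Z ** X ** Y = mat (upow 2)" by (rule rotate_product[OF inv(2) YZX])
  \<comment> \<open>In each column the nonzero first-row entries cancel in pairs, and a factor that
    is not flat has exactly one of them. So 0 or 2 of the three factors are not flat.\<close>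
  consider "flat2 X" "flat2 Y" "flat2 Z" | "flat2 Z" "\<not> flat2 X" | "flat2 X" "\<not> flat2 Y" | "flat2 Y" "\<not> flat2 Z"
    using val[OF X(1)] val[OF X(2)] val[OF X(3)] sum rr ss by (smt (verit) add_0 add.right_neutral)
  then show ?thesis
  proof cases
    case 1
    then show ?thesis using relation_all_flat inv prod by blast
  next
    case 2
    then show ?thesis using relation_one_flat[OF X(1,2)] sum val[OF X(3)] prod by simp
  next
    case 3
    then show ?thesis using relation_one_flat[OF X(2,3)] sum val[OF X(1)] YZX
      by - (rule theta2_rotate, simp)
  next
    case 4
    then show ?thesis using relation_one_flat[OF X(3,1)] sum val[OF X(2)] ZXY
      by - (rule theta2_rotate, rule theta2_rotate, simp add: add.commute)
  qed
qed

text \<open>Determinant u is the other orientation, so it receives the inverse of the permutation of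
  the reversed edge; the scalars 1 and u receive the identity.\<close>

definition theta :: "laurent_matrix \<Rightarrow> gen3 free_word \<Rightarrow> gen3 free_word" where
  "theta A = (if det A = upow 2 then theta2 A else if det A = uu then theta2' (mat uu ** matrix_inv A) else id)"

lemma near_star_cases:
  assumes "near A" "det A = uu"
  obtains X where "type2 X" "invertible X" "A ** X = mat uu" "X ** A = mat uu" "theta A = theta2' X"
proof -
  obtain B where B: "A ** B = mat 1" "B ** A = mat 1"
    using assms(1) by (auto simp: near_def kernel_matrix_def invertible_def)
  have inv: "matrix_inv A = B" by (rule matrix_inv_unique[OF B])
  let ?X = "mat uu ** B"
  have near: "near ?X" by (rule near_star[OF assms(1) B])
  have "det A * det B = 1" using B(1) by (metis det_mul det_I)
  then have "uu * det ?X = uu * upow 2"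
    using assms(2) upow_add by (simp add: det_mul det_scalar upow_add)
  then have det: "det ?X = upow 2" by (simp only: mult_cancel_left upow_nonzero) simp
  then have "type2 ?X"
    using near_cases[OF near] upow_eq_iff[of 2 1] upow_eq_iff[of 2 0] upow_eq_iff[of 2 3]
    by (auto simp: det_scalar upow_add)
  moreover have "A ** ?X = mat uu" by (simp add: mat_left_commute B)
  moreover have "?X ** A = mat uu" by (simp add: B flip: matrix_mul_assoc)
  moreover have "theta A = theta2' ?X" using assms(2) by (simp add: theta_def inv)
  moreover have "invertible ?X" using near by (simp add: near_def kernel_matrix_def)
  ultimately show thesis using that by blast
qed

lemma near_det_cases:
  assumes "near A"
  obtains (scalar) k where "A = mat (upow k)" "theta A = id" "det A = upow (3 * k)"
  | (star) X where "det A = upow 1" "type2 X" "invertible X" "A ** X = mat uu" "X ** A = mat uu" "theta A = theta2' X"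
  | (type2) "det A = upow 2" "type2 A" "theta A = theta2 A"
proof -
  have d: "det (mat 1 :: laurent_matrix) = upow 0" "det (mat uu :: laurent_matrix) = upow 3"
    by (simp_all add: det_scalar upow_add)
  have t: "theta (mat 1) = id" "theta (mat uu) = id"
    unfolding theta_def d by (simp_all only: upow_eq_iff) simp_all
  from near_cases[OF assms] show thesis
  proof (elim disjE conjE)
    assume "A = mat 1"
    then show thesis using scalar[of 0] d t by simp
  next
    assume "det A = uu"
    then show thesis using near_star_cases[OF assms] star by metis
  next
    assume "det A = upow 2" "type2 A"
    then show thesis using type2 by (simp add: theta_def)
  next
    assume "A = mat uu"
    then show thesis using scalar[of 1] d t by simp
  qed
qed

lemma theta_1: "theta (mat 1) = id"
  using upow_eq_iff[of 0 2] upow_eq_iff[of 0 1] by (simp add: theta_def)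

lemma det_scalar_upow: "det (mat (upow k) ** (A :: laurent_matrix)) = upow (3 * k) * det A"
  by (simp add: det_mul det_scalar upow_add)

text \<open>Scaling by u^k shifts the exponent of the determinant by 3k. The exponents 1 and 2 leave
  only k = 0; multiples of 3 occur only for scalars, where \<open>theta\<close> is trivial.\<close>

lemma theta_upow_eq:
  assumes "near A" "near B" "A = mat (upow k) ** B"
  shows "theta A = theta B"
proof -
  have deg: "\<exists>i. det C = upow i \<and> (3 dvd i \<and> theta C = id \<or> i \<in> {1, 2})" if "near C" for C
    using that by (cases rule: near_det_cases) auto
  obtain i j where ij: "det A = upow i" "3 dvd i \<and> theta A = id \<or> i \<in> {1, 2}"
    "det B = upow j" "3 dvd j \<and> theta B = id \<or> j \<in> {1, 2}"
    using deg[OF assms(1)] deg[OF assms(2)] by blast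
  have "i = 3 * k + j"
    using ij(1,3) unfolding assms(3) det_scalar_upow by (simp add: upow_add)
  then have "theta A = id \<and> theta B = id \<or> k = 0" using ij(2,4) by auto presburger+
  then show ?thesis using assms(3) by auto
qed

lemma theta_opposite:
  assumes near: "near A" "near B" and prod: "A ** B = mat (upow m)"
  shows "theta A \<circ> theta B = id"
proof -
  have deg: "a + b = 3 * m" if "det A = upow a" "det B = upow b" for a b
    using arg_cong[OF prod, of det] that by (simp add: det_mul det_scalar upow_add)
  show ?thesis
    using near(1)
  proof (cases rule: near_det_cases)
    case A: (scalar k)
    have "mat (upow k) ** B = mat (upow k) ** (mat (upow (m - k)) ** mat 1)"
      using prod A by (simp add: mat_mult_mat upow_add)
    then have "theta B = theta (mat 1)"
      by (rule theta_upow_eq[OF near(2) near_1 mat_cancel[OF _ upow_nonzero]])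
    then show ?thesis using A theta_1 by simp
  next
    case A: (star X)
    show ?thesis
      using near(2)
    proof (cases rule: near_det_cases)
      case (scalar k)
      with deg[OF A(1) scalar(3)] show ?thesis by presburger
    next
      case (star Y)
      with deg[OF A(1) star(1)] show ?thesis by presburger
    next
      case type2
      have "m = 1" using deg[OF A(1) type2(1)] by presburger
      then have "X ** (A ** B) = mat uu ** X" using prod by (simp only: mat_mult_commute)
      then have "mat uu ** B = mat uu ** X" using A(5) by (simp add: matrix_mul_assoc)
      then have "B = X" by (rule mat_cancel) simp
      then show ?thesis using A(6) type2(3) by (simp add: fun_eq_iff)
    qed
  next
    case A: type2
    show ?thesis
      using near(2)
    proof (cases rule: near_det_cases)
      case (scalar k)
      with deg[OF A(1) scalar(3)] show ?thesis by presburger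
    next
      case (star Y)
      have "m = 1" using deg[OF A(1) star(1)] by presburger
      then have "A ** (B ** Y) = mat uu ** Y" using prod by (simp add: matrix_mul_assoc)
      then have "mat uu ** A = mat uu ** Y" unfolding star(4) mat_mult_commute[of A] .
      then have "A = Y" by (rule mat_cancel) simp
      then show ?thesis using A(3) star(6) by (simp add: fun_eq_iff)
    next
      case type2
      with deg[OF A(1) type2(1)] show ?thesis by presburger
    qed
  qed
qed

text \<open>Determinants leave two patterns without scalars, u u = u^2 and u^2 u^2 = u^3 u.
  Reversing the edges of determinant u turns both into three matrices of determinant u^2 with
  product \<open>mat (upow 2)\<close>, the situation of \<open>relation_type2\<close>.\<close>

theorem theta_mult:
  assumes near: "near A" "near B" "near C" and prod: "A ** B = mat (upow m) ** C"
  shows "theta A \<circ> theta B = theta C"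
proof -
  have deg: "a + b = 3 * m + c" if "det A = upow a" "det B = upow b" "det C = upow c" for a b c
    using arg_cong[OF prod, of det] that by (simp add: det_mul det_scalar upow_add)
  consider k where "A = mat (upow k)" "theta A = id" | k where "B = mat (upow k)" "theta B = id"
    | k where "C = mat (upow k)" "theta C = id"
    | X Y where "det A = upow 1" "type2 X" "invertible X" "X ** A = mat uu" "theta A = theta2' X"
      "det B = upow 1" "type2 Y" "invertible Y" "Y ** B = mat uu" "theta B = theta2' Y"
      "det C = upow 2" "type2 C" "theta C = theta2 C"
    | Z where "det A = upow 2" "type2 A" "theta A = theta2 A" "det B = upow 2" "type2 B" "theta B = theta2 B"
      "det C = upow 1" "type2 Z" "C ** Z = mat uu" "theta C = theta2' Z"
  proof -
    note cases_of = that
    from near(1) show thesis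
    proof (cases rule: near_det_cases)
      case A: (star X)
      from near(2) show thesis
      proof (cases rule: near_det_cases)
        case B: (star Y)
        from near(3) show thesis
        proof (cases rule: near_det_cases)
          case (star Z)
          with deg[OF A(1) B(1) star(1)] show thesis by presburger
        next
          case type2
          then show thesis using cases_of(4) A B by blast
        qed (use cases_of(3) in blast)
      next
        case B: type2
        from near(3) show thesis
        proof (cases rule: near_det_cases)
          case (star Z)
          with deg[OF A(1) B(1) star(1)] show thesis by presburger
        next
          case type2
          with deg[OF A(1) B(1) type2(1)] show thesis by presburger
        qed (use cases_of(3) in blast)
      qed (use cases_of(2) in blast)
    next
      case A: type2
      from near(2) show thesis
      proof (cases rule: near_det_cases)
        case B: (star Y)
        from near(3) show thesis
        proof (cases rule: near_det_cases)
          case (star Z)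
          with deg[OF A(1) B(1) star(1)] show thesis by presburger
        next
          case type2
          with deg[OF A(1) B(1) type2(1)] show thesis by presburger
        qed (use cases_of(3) in blast)
      next
        case B: type2
        from near(3) show thesis
        proof (cases rule: near_det_cases)
          case (star Z)
          then show thesis using cases_of(5) A B by blast
        next
          case type2
          with deg[OF A(1) B(1) type2(1)] show thesis by presburger
        qed (use cases_of(3) in blast)
      qed (use cases_of(2) in blast)
    qed (use cases_of(1) in blast)
  qed
  then show ?thesis
  proof cases
    case (1 k)
    then have "mat (upow k) ** B = mat (upow k) ** (mat (upow (m - k)) ** C)"
      using prod by (simp add: scalar_simps)
    then have "theta B = theta C"
      by (rule theta_upow_eq[OF near(2,3) mat_cancel[OF _ upow_nonzero]])
    then show ?thesis using 1 by simp
  next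
    case (2 k)
    then have "mat (upow k) ** A = mat (upow k) ** (mat (upow (m - k)) ** C)"
      using prod by (simp add: mat_mult_commute[of A] scalar_simps)
    then have "theta A = theta C"
      by (rule theta_upow_eq[OF near(1,3) mat_cancel[OF _ upow_nonzero]])
    then show ?thesis using 2 by simp
  next
    case (3 k)
    then show ?thesis using theta_opposite[OF near(1,2), of "m + k"] prod by (simp add: mat_mult_mat upow_add)
  next
    case (4 X Y)
    have "m = 0" using deg[OF 4(1,6,11)] by presburger
    then have "C = A ** B" using prod by simp
    then have "Y ** X ** C = Y ** (X ** A) ** B" by (simp add: matrix_mul_assoc)
    also have "\<dots> = mat (upow 2)"
      using 4(4,9) by (simp add: mat_mult_commute[of Y] mat_mult_mat upow_add flip: matrix_mul_assoc)
    finally have "theta2 Y (theta2 X (theta2 C x)) = x" for x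
      using 4(2,3,7,8,12) relation_type2 by blast
    then have "theta2 C x = theta2' X (theta2' Y x)" for x by (metis theta2_inverse)
    then show ?thesis using 4(5,10,13) by (simp add: fun_eq_iff)
  next
    case (5 Z)
    have "m = 1" using deg[OF 5(1,4,7)] by presburger
    then have "A ** B ** Z = mat uu ** (C ** Z)" using prod by (simp add: matrix_mul_assoc)
    also have "\<dots> = mat (upow 2)" using 5(9) by (simp add: mat_mult_mat upow_add)
    finally have "theta2 A (theta2 B (theta2 Z x)) = x" for x
      using 5(2,5,8) near(1,2) relation_type2 unfolding near_def kernel_matrix_def by blast
    then have "theta2 A (theta2 B x) = theta2' Z x" for x by (metis theta2_inverse)
    then show ?thesis using 5(3,6,10) by (simp add: fun_eq_iff)
  qed
qed

section \<open>The valuation ring\<close>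

lemma val_ring_iff:
  "f \<in> val_ring \<longleftrightarrow> (\<exists>p q. q \<noteq> 0 \<and> Polynomial.degree p \<le> Polynomial.degree q \<and> f = Fraction_Field.Fract p q)"
proof
  assume f: "f \<in> val_ring"
  obtain p q where pq: "f = Fraction_Field.Fract p q" "q \<noteq> 0" by (cases f) auto
  show "\<exists>p q. q \<noteq> 0 \<and> Polynomial.degree p \<le> Polynomial.degree q \<and> f = Fraction_Field.Fract p q"
  proof (cases "p = 0")
    case True
    then show ?thesis using pq by (intro exI[of _ 0] exI[of _ q]) simp
  next
    case False
    then have "f \<noteq> 0" using pq by (simp add: eq_fract Zero_fract_def)
    then show ?thesis using f pq v_inf_Fract[OF False pq(2)]
      by (intro exI[of _ p] exI[of _ q]) (simp add: val_ring_def)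
  qed
next
  assume "\<exists>p q. q \<noteq> 0 \<and> Polynomial.degree p \<le> Polynomial.degree q \<and> f = Fraction_Field.Fract p q"
  then obtain p q where pq: "q \<noteq> 0" "Polynomial.degree p \<le> Polynomial.degree q" "f = Fraction_Field.Fract p q"
    by blast
  show "f \<in> val_ring"
  proof (cases "p = 0")
    case True
    then show ?thesis using pq by (simp add: val_ring_def eq_fract Zero_fract_def)
  next
    case False
    then show ?thesis using pq v_inf_Fract[OF False pq(1)] by (simp add: val_ring_def)
  qed
qed

lemma val_ring_0: "0 \<in> val_ring"
  by (simp add: val_ring_def)

lemma val_ring_mult:
  assumes "f \<in> val_ring" "g \<in> val_ring"
  shows "f * g \<in> val_ring"
proof -
  obtain p q p' q' where pq: "q \<noteq> 0" "Polynomial.degree p \<le> Polynomial.degree q" "f = Fraction_Field.Fract p q"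
    "q' \<noteq> 0" "Polynomial.degree p' \<le> Polynomial.degree q'" "g = Fraction_Field.Fract p' q'"
    using assms unfolding val_ring_iff by metis
  have "Polynomial.degree (p * p') \<le> Polynomial.degree (q * q')"
    using pq degree_mult_le[of p p'] by (simp add: degree_mult_eq)
  then show ?thesis unfolding val_ring_iff using pq by (intro exI[of _ "p * p'"] exI[of _ "q * q'"]) simp
qed

lemma val_ring_add:
  assumes "f \<in> val_ring" "g \<in> val_ring"
  shows "f + g \<in> val_ring"
proof -
  obtain p q p' q' where pq: "q \<noteq> 0" "Polynomial.degree p \<le> Polynomial.degree q" "f = Fraction_Field.Fract p q"
    "q' \<noteq> 0" "Polynomial.degree p' \<le> Polynomial.degree q'" "g = Fraction_Field.Fract p' q'"
    using assms unfolding val_ring_iff by metis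
  have "Polynomial.degree (p * q' + p' * q) \<le> Polynomial.degree (q * q')"
    using pq degree_mult_le[of p q'] degree_mult_le[of p' q]
    by (intro degree_add_le) (simp_all add: degree_mult_eq)
  then show ?thesis unfolding val_ring_iff using pq
    by (intro exI[of _ "p * q' + p' * q"] exI[of _ "q * q'"]) simp
qed

lemma val_ring_const: "to_fract [:c:] \<in> val_ring"
  unfolding val_ring_iff by (rule exI[of _ "[:c:]"], rule exI[of _ 1]) (simp add: to_fract_def)

lemma val_ring_1: "1 \<in> val_ring"
  using val_ring_const[of 1] by (simp add: pCons_one)

lemma inverse_rT: "inverse rT = Fraction_Field.Fract 1 [:0, 1:]"
  by (simp add: to_fract_def)

lemma val_ring_inverse_rT: "inverse rT \<in> val_ring"
  unfolding val_ring_iff inverse_rT by (rule exI[of _ 1], rule exI[of _ "[:0, 1:]"]) simp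

lemma val_ring_power: "f \<in> val_ring \<Longrightarrow> f ^ n \<in> val_ring"
  by (induction n) (auto intro: val_ring_1 val_ring_mult)

lemma val_ring_sum: "(\<And>i. i \<in> I \<Longrightarrow> f i \<in> val_ring) \<Longrightarrow> sum f I \<in> val_ring"
  by (induction I rule: infinite_finite_induct) (auto intro: val_ring_0 val_ring_add)

lemma val_ring_powi: "k \<le> 0 \<Longrightarrow> rT powi k \<in> val_ring"
  by (auto simp: power_int_def intro: val_ring_power val_ring_inverse_rT val_ring_1)

lemma val_ring_laurent:
  assumes "degree_le 0 f"
  shows "laurent_to_rat f \<in> val_ring"
  unfolding laurent_to_rat_def laurent_lift_def
proof (rule val_ring_sum)
  fix k assume "k \<in> Poly_Mapping.keys f"
  then have "k \<le> 0" using assms unfolding degree_le_def by (metis in_keys_iff not_le)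
  then show "to_fract [:lcoeff f k:] * rT powi k \<in> val_ring"
    by (intro val_ring_mult val_ring_const val_ring_powi)
qed

lemma degree_le_val_ring:
  assumes "laurent_to_rat f \<in> val_ring"
  shows "degree_le 0 f"
proof (rule ccontr)
  assume neg: "\<not> degree_le 0 f"
  then have f: "f \<noteq> 0" by (auto simp: degree_le_def)
  let ?K = "Poly_Mapping.keys f"
  define n where "n = Max ?K"
  have K: "finite ?K" "?K \<noteq> {}" using f by auto
  have n: "n \<in> ?K" "\<And>k. k > n \<Longrightarrow> lcoeff f k = 0"
    unfolding n_def using Max_in[OF K] Max_less_iff[OF K]
    by (auto simp: not_in_keys_iff_lookup_eq_zero[symmetric])
  have "n > 0" using neg n(2) unfolding degree_le_def by (meson not_le order.strict_trans2)
  define c where "c = lcoeff f n"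
  have c: "c \<noteq> 0" using n(1) by (simp add: c_def in_keys_iff)
  \<comment> \<open>Multiplication by t^(1-n), which lies in the valuation ring, moves the top
    exponent to 1; removing c t leaves degree at most 0. So c t itself would lie in the valuation
    ring.\<close>
  define g where "g = lmonom 1 (1 - n) * f - lmonom c 1"
  have "degree_le 0 g"
    unfolding degree_le_def
  proof (intro allI impI)
    fix k :: int assume "0 < k"
    then consider "k = 1" | "k > 1" by linarith
    then show "lcoeff g k = 0"
      by cases (use n(2)[of "k - (1 - n)"] in \<open>auto simp: g_def lookup_minus lookup_monom_mult lookup_single c_def when_def add.commute\<close>)
  qed
  then have "laurent_to_rat g \<in> val_ring" by (rule val_ring_laurent)
  moreover have "laurent_to_rat (lmonom 1 (1 - n) * f) \<in> val_ring"
    unfolding to_rat.mult laurent_to_rat_monom using \<open>n > 0\<close>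
    by (intro val_ring_mult assms val_ring_const val_ring_powi) simp
  moreover have "laurent_to_rat (lmonom c 1) = laurent_to_rat (lmonom 1 (1 - n) * f) + to_fract [:-1:] * laurent_to_rat g"
  proof -
    have "to_fract [:-1:] = (-1 :: ratfun)"
      using const_add[of "-1" 1] by (simp add: pCons_one eq_neg_iff_add_eq_0)
    then show ?thesis by (simp add: g_def to_rat.diff)
  qed
  ultimately have "laurent_to_rat (lmonom c 1) \<in> val_ring"
    by (metis val_ring_add val_ring_mult val_ring_const)
  moreover have "laurent_to_rat (lmonom c 1) = Fraction_Field.Fract [:0, c:] 1"
    unfolding laurent_to_rat_monom by (simp add: to_fract_def)
  ultimately show False
    using v_inf_Fract[of "[:0, c:]" 1] c by (auto simp: val_ring_def eq_fract Zero_fract_def)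
qed

lemma val_ring_laurent_iff: "laurent_to_rat f \<in> val_ring \<longleftrightarrow> degree_le 0 f"
  using val_ring_laurent degree_le_val_ring by blast

lemma degree_le_0_mult:
  "degree_le 0 f \<Longrightarrow> degree_le 0 g \<Longrightarrow> degree_le 0 (f * (g :: complex laurent))"
  unfolding val_ring_laurent_iff[symmetric] to_rat.mult by (rule val_ring_mult)

lemma degree_le_0_add: "degree_le 0 f \<Longrightarrow> degree_le 0 g \<Longrightarrow> degree_le 0 (f + g)"
  by (simp add: degree_le_def lookup_add)

lemma degree_le_0_diff: "degree_le 0 f \<Longrightarrow> degree_le 0 g \<Longrightarrow> degree_le 0 (f - (g :: complex laurent))"
  by (simp add: degree_le_def lookup_minus)

lemma normalize_by_power:
  assumes "f \<noteq> (0 :: ratfun)"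
  obtains k where "f * rT powi k \<in> val_ring" "inverse (f * rT powi k) \<in> val_ring"
proof -
  obtain p q where pq: "f = Fraction_Field.Fract p q" "q \<noteq> 0" by (cases f) auto
  then have p: "p \<noteq> 0" using assms by (auto simp: eq_fract Zero_fract_def)
  have mon: "rT ^ n = Fraction_Field.Fract (Polynomial.monom 1 n) 1" for n
    by (induction n) (simp_all add: to_fract_def One_fract_def pCons_one flip: monom_0, simp add: monom_Suc pCons_one)
  have unit: "Fraction_Field.Fract a b \<in> val_ring \<and> inverse (Fraction_Field.Fract a b) \<in> val_ring"
    if "a \<noteq> 0" "b \<noteq> 0" "Polynomial.degree a = Polynomial.degree b" for a b :: "complex poly"
  proof
    show "Fraction_Field.Fract a b \<in> val_ring"
      unfolding val_ring_iff by (rule exI[of _ a], rule exI[of _ b]) (use that in simp)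
    show "inverse (Fraction_Field.Fract a b) \<in> val_ring"
      unfolding val_ring_iff by (rule exI[of _ b], rule exI[of _ a]) (use that in simp)
  qed
  show thesis
  proof (cases "Polynomial.degree p \<le> Polynomial.degree q")
    case True
    define n where "n = Polynomial.degree q - Polynomial.degree p"
    have "f * rT powi int n = Fraction_Field.Fract (p * Polynomial.monom 1 n) q"
      by (simp add: pq mon)
    moreover have "Polynomial.degree (p * Polynomial.monom 1 n) = Polynomial.degree q"
      using p True by (simp add: degree_mult_eq degree_monom_eq n_def)
    ultimately show thesis using that[of "int n"] unit[of "p * Polynomial.monom 1 n" q] p pq by simp
  next
    case False
    define n where "n = Polynomial.degree p - Polynomial.degree q"
    have "f * rT powi (- int n) = Fraction_Field.Fract p (q * Polynomial.monom 1 n)"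
      by (simp add: pq mon power_int_minus)
    moreover have "Polynomial.degree (q * Polynomial.monom 1 n) = Polynomial.degree p"
      using pq False by (simp add: degree_mult_eq degree_monom_eq n_def)
    ultimately show thesis using that[of "- int n"] unit[of p "q * Polynomial.monom 1 n"] p pq by simp
  qed
qed

section \<open>Closed edge paths in the building\<close>

definition lattice_vertex :: "laurent_matrix \<Rightarrow> (ratfun ^ 3) set set" where
  "lattice_vertex G = homothety_class (lattice_of (rat_matrix G))"

lemma rat_matrix_mat: "rat_matrix (mat c) = mat (laurent_to_rat c)"
  by (simp add: rat_matrix_def to_rat.map_matrix_mat)

lemma vertex_act_base: "vertex_act (proj G) base_vertex = lattice_vertex G"
  by (simp add: base_vertex_def lattice_vertex_def vertex_act_proj)

lemma lattice_vertex_upow: "lattice_vertex (mat (upow k) ** G) = lattice_vertex G"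
proof -
  have "proj (mat (upow k) ** G) = proj G" unfolding proj_eq_iff using upow_dvd by blast
  then show ?thesis by (metis vertex_act_base)
qed

lemma homothety_member:
  assumes "L \<in> lattice_vertex G"
  obtains c where "c \<noteq> 0" "\<And>v. v \<in> L \<longleftrightarrow> (\<exists>x. (\<forall>i. x $ i \<in> val_ring) \<and> v = c *s (rat_matrix G *v x))"
proof -
  obtain c where c: "c \<noteq> 0" "L = (\<lambda>v. c *s v) ` lattice_of (rat_matrix G)"
    using assms by (auto simp: lattice_vertex_def homothety_class_def)
  then have "v \<in> L \<longleftrightarrow> (\<exists>x. (\<forall>i. x $ i \<in> val_ring) \<and> v = c *s (rat_matrix G *v x))" for v
    by (auto simp: lattice_of_def)
  then show thesis using that c(1) by blast
qed

lemma axis_val_ring: "axis j 1 $ i \<in> val_ring"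
  by (simp add: axis_def val_ring_0 val_ring_1)

lemma inclusion_entries:
  assumes L: "\<And>v. v \<in> L \<longleftrightarrow> (\<exists>x. (\<forall>i. x $ i \<in> val_ring) \<and> v = c *s (rat_matrix G *v x))"
    and L': "\<And>v. v \<in> L' \<longleftrightarrow> (\<exists>x. (\<forall>i. x $ i \<in> val_ring) \<and> v = c' *s (rat_matrix G' *v x))"
    and sub: "(\<lambda>v. d *s v) ` L' \<subseteq> L" and c: "c \<noteq> 0" and H: "H ** G = mat 1"
  shows "d * c' / c * laurent_to_rat ((H ** G') $ i $ j) \<in> val_ring"
proof -
  have "c' *s (rat_matrix G' *v axis j 1) \<in> L'" unfolding L' using axis_val_ring by blast
  then have "d *s (c' *s (rat_matrix G' *v axis j 1)) \<in> L" using sub by blast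
  then obtain x where x: "\<And>i. x $ i \<in> val_ring" "d *s (c' *s (rat_matrix G' *v axis j 1)) = c *s (rat_matrix G *v x)"
    unfolding L by blast
  have "x = rat_matrix (H ** G) *v x" by (simp add: H rat_matrix_mat to_rat.one)
  also have "\<dots> = rat_matrix H *v (rat_matrix G *v x)"
    by (simp add: rat_matrix_mult matrix_vector_mul_assoc)
  also have "rat_matrix G *v x = (1 / c) *s (c *s (rat_matrix G *v x))"
    using c by (simp add: vector_smult_assoc)
  also have "\<dots> = (d * c' / c) *s (rat_matrix G' *v axis j 1)"
    unfolding x(2)[symmetric] by (simp add: vector_smult_assoc mult.commute)
  finally have "x = (d * c' / c) *s (rat_matrix (H ** G') *v axis j 1)"
    by (simp add: matrix_vector_mult_scaleR rat_matrix_mult matrix_vector_mul_assoc vec.scale)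
  then have "x $ i = d * c' / c * laurent_to_rat ((H ** G') $ i $ j)"
    by (simp add: matrix_vector_mul_component axis_def matrix_vector_mult_def rat_matrix_def if_distrib
        sum.delta' cong: if_cong)
  then show ?thesis using x(1) by metis
qed

text \<open>The quotient of the two homothety factors is a unit times a power of t, and that power
  is absorbed into u^k. The parameter \<open>e\<close> is 1 for adjacent vertices and 0 for equal
  ones.\<close>

lemma transition_matrix:
  assumes G: "kernel_matrix G" "kernel_matrix G'"
    and L: "L \<in> lattice_vertex G" "L' \<in> lattice_vertex G'"
    and sub: "(\<lambda>v. inverse rT powi e *s v) ` L \<subseteq> L'" "L' \<subseteq> L"
  obtains A B k where "kernel_matrix A" "G ** A = mat (upow k) ** G'" "A ** B = mat 1" "B ** A = mat 1"
    "\<And>i j. degree_le 0 (A $ i $ j)" "\<And>i j. degree_le e (B $ i $ j)"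
proof -
  obtain c where c: "c \<noteq> 0" "\<And>v. v \<in> L \<longleftrightarrow> (\<exists>x. (\<forall>i. x $ i \<in> val_ring) \<and> v = c *s (rat_matrix G *v x))"
    using homothety_member[OF L(1)] by metis
  obtain c' where c': "c' \<noteq> 0" "\<And>v. v \<in> L' \<longleftrightarrow> (\<exists>x. (\<forall>i. x $ i \<in> val_ring) \<and> v = c' *s (rat_matrix G' *v x))"
    using homothety_member[OF L(2)] by metis
  obtain H where H: "G ** H = mat 1" "H ** G = mat 1"
    using G(1) by (auto simp: kernel_matrix_def invertible_def)
  obtain H' where H': "G' ** H' = mat 1" "H' ** G' = mat 1"
    using G(2) by (auto simp: kernel_matrix_def invertible_def)
  define f where "f = c' / c"
  have f: "f \<noteq> 0" using c c' by (simp add: f_def)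
  obtain k where k: "f * rT powi k \<in> val_ring" "inverse (f * rT powi k) \<in> val_ring"
    using normalize_by_power[OF f] by blast
  have e1: "f * laurent_to_rat ((H ** G') $ i $ j) \<in> val_ring" for i j
    using inclusion_entries[OF c(2) c'(2) _ c(1) H(2), of 1] sub(2) by (simp add: f_def)
  have e2: "inverse rT powi e / f * laurent_to_rat ((H' ** G) $ i $ j) \<in> val_ring" for i j
    using inclusion_entries[OF c'(2) c(2) sub(1) c'(1) H'(2)] by (simp add: f_def)
  have rT: "rT \<noteq> 0" by simp
  let ?A = "mat (upow k) ** (H ** G')" and ?B = "mat (upow (-k)) ** (H' ** G)"
  have entry: "(mat c ** A) $ i $ j = c * A $ i $ j" for c i j and A :: "laurent_matrix"
    by (simp add: mat_mult_left)
  show thesis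
  proof (rule that)
    show "kernel_matrix ?A"
      by (intro kernel_matrix_mult kernel_matrix_upow G(2)) (rule kernel_matrix_inverse[OF G(1) H])
    show "G ** ?A = mat (upow k) ** G'"
    proof -
      have "G ** (H ** G') = G'" by (simp add: matrix_mul_assoc H)
      then show ?thesis by (simp only: mat_left_commute)
    qed
    have *: "(H ** G') ** (H' ** G) = mat 1" "(H' ** G) ** (H ** G') = mat 1"
    proof -
      have "(H ** G') ** (H' ** G) = H ** (G' ** H') ** G" "(H' ** G) ** (H ** G') = H' ** (G ** H) ** G'"
        by (simp_all only: matrix_mul_assoc)
      then show "(H ** G') ** (H' ** G) = mat 1" "(H' ** G) ** (H ** G') = mat 1" by (simp_all add: H H')
    qed
    then show "?A ** ?B = mat 1" "?B ** ?A = mat 1" by (simp_all add: scalar_mult_mult upow_add)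
    fix i j
    have "laurent_to_rat (?A $ i $ j) = to_fract [:(-\<i>) powi k:] * (inverse (f * rT powi k) * (f * laurent_to_rat ((H ** G') $ i $ j)))"
      unfolding entry to_rat.mult upow_def laurent_to_rat_monom using f rT by (simp add: power_int_minus)
    then show "degree_le 0 (?A $ i $ j)"
      unfolding val_ring_laurent_iff[symmetric] by (simp only:) (intro val_ring_mult val_ring_const k e1)
    have "laurent_to_rat (lmonom 1 (- e) * ?B $ i $ j) =
        to_fract [:(-\<i>) powi (-k):] * ((f * rT powi k) * (inverse rT powi e / f * laurent_to_rat ((H' ** G) $ i $ j)))"
      unfolding entry to_rat.mult upow_def laurent_to_rat_monom using f rT
      by (simp add: power_int_minus power_int_inverse pCons_one field_simps)
    then have "degree_le 0 (lmonom 1 (- e) * ?B $ i $ j)"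
      unfolding val_ring_laurent_iff[symmetric] by (simp only:) (intro val_ring_mult val_ring_const k e2)
    then have "degree_le (0 + e) (lmonom 1 e * (lmonom 1 (- e) * ?B $ i $ j))" by (rule degree_le_monom)
    then show "degree_le e (?B $ i $ j)" by (simp add: mult_single flip: mult.assoc)
  qed
qed

lemma near_transition:
  assumes G: "kernel_matrix G" "kernel_matrix G'"
    and L: "L \<in> lattice_vertex G" "L' \<in> lattice_vertex G'"
    and sub: "(\<lambda>v. inverse rT *s v) ` L \<subseteq> L'" "L' \<subseteq> L"
  obtains A k where "near A" "G ** A = mat (upow k) ** G'"
proof -
  obtain A B k where "kernel_matrix A" "G ** A = mat (upow k) ** G'" "A ** B = mat 1" "B ** A = mat 1"
    "\<And>i j. degree_le 0 (A $ i $ j)" "\<And>i j. degree_le 1 (B $ i $ j)"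
    by (rule transition_matrix[OF G L, of 1]) (use sub in auto)
  then show thesis using that unfolding near_def by blast
qed

lemma degree_le_det: "(\<And>i j. degree_le 0 (A $ i $ j)) \<Longrightarrow> degree_le 0 (det (A :: laurent_matrix))"
  unfolding det_3 by (intro degree_le_0_add degree_le_0_diff degree_le_0_mult)

lemma degree_le_upow: "degree_le 0 (upow k) \<Longrightarrow> 0 \<le> k"
  unfolding degree_le_def upow_def by (auto simp: lookup_single when_def dest!: spec[of _ "- k"])

text \<open>A transition matrix that is integral together with its inverse has determinant 1, and
  the classification then leaves only scalars. Hence a vertex determines its normalised matrix up to
  powers of u, and the cocycle can be defined on vertices.\<close>

lemma lattice_vertex_eq:
  assumes G: "kernel_matrix G" "kernel_matrix G'" and eq: "lattice_vertex G = lattice_vertex G'"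
  obtains k where "G' = mat (upow k) ** G"
proof -
  let ?L = "lattice_of (rat_matrix G)"
  have L: "?L \<in> lattice_vertex G" "?L \<in> lattice_vertex G'"
    unfolding eq[symmetric] by (simp_all add: lattice_vertex_def homothety_class_self)
  obtain A B k where A: "kernel_matrix A" "G ** A = mat (upow k) ** G'" "A ** B = mat 1" "B ** A = mat 1"
    "\<And>i j. degree_le 0 (A $ i $ j)" "\<And>i j. degree_le 0 (B $ i $ j)"
    by (rule transition_matrix[OF G L, of 0]) auto
  have "near A" unfolding near_def using A degree_le_def
    by (metis (no_types, lifting) order.strict_trans zero_less_one)
  have det: "det A * det B = 1" using A(3) by (metis det_mul det_I)
  have pos: False if "det A = upow d" "0 < d" for d
  proof -
    have "upow (- d) * (upow d * det B) = upow (- d)" using det that by simp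
    then have "det B = upow (- d)" by (simp add: upow_add flip: mult.assoc)
    then show False using degree_le_upow[of "- d"] degree_le_det[of B] A(6) that(2) by simp
  qed
  obtain d where "A = mat (upow d)"
    by (rule near_det_cases[OF \<open>near A\<close>]) (use pos in force)+
  then have "mat (upow k) ** G' = mat (upow k) ** (mat (upow (d - k)) ** G)"
    using A(2) by (simp add: mat_mult_commute[of G] scalar_simps)
  then show thesis using that mat_cancel upow_nonzero by blast
qed

lemma lattice_of_subset:
  assumes "\<And>i j. laurent_to_rat (A $ i $ j) \<in> val_ring"
  shows "lattice_of (rat_matrix (G ** A)) \<subseteq> lattice_of (rat_matrix G)"
proof
  fix v assume "v \<in> lattice_of (rat_matrix (G ** A))"
  then obtain x where x: "\<And>i. x $ i \<in> val_ring" "v = rat_matrix (G ** A) *v x"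
    by (auto simp: lattice_of_def)
  have "v = rat_matrix G *v (rat_matrix A *v x)"
    unfolding x(2) by (simp add: rat_matrix_mult matrix_vector_mul_assoc)
  moreover have "(rat_matrix A *v x) $ i \<in> val_ring" for i
    unfolding matrix_vector_mult_def rat_matrix_def using assms x(1)
    by (auto intro!: val_ring_sum val_ring_mult)
  ultimately show "v \<in> lattice_of (rat_matrix G)" unfolding lattice_of_def by blast
qed

lemma scaled_lattice: "(\<lambda>v. laurent_to_rat c *s v) ` lattice_of (rat_matrix G) = lattice_of (rat_matrix (mat c ** G))"
proof -
  have "laurent_to_rat c *s (rat_matrix G *v x) = rat_matrix (mat c ** G) *v x" for x
    unfolding rat_matrix_scalar
    by (simp add: matrix_vector_mult_def mat_mult_left vec_eq_iff sum_distrib_left mult.assoc)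
  then show ?thesis unfolding lattice_of_def by (auto simp: image_iff) metis+
qed

lemma inverse_rT_laurent: "inverse rT = laurent_to_rat lTinv"
  by (simp add: laurent_to_rat_monom pCons_one)

lemma homothety_class_scaled:
  assumes "c \<noteq> 0"
  shows "homothety_class ((\<lambda>v. c *s v) ` L) = homothety_class L"
proof -
  have "(\<lambda>v. d *s v) ` (\<lambda>v. c *s v) ` L = (\<lambda>v. (d * c) *s v) ` L" for d
    by (auto simp: image_image vector_smult_assoc)
  then have "homothety_class ((\<lambda>v. c *s v) ` L) = {(\<lambda>v. (d * c) *s v) ` L |d. d \<noteq> 0}"
    unfolding homothety_class_def by simp
  also have "\<dots> = homothety_class L"
  proof -
    have "\<exists>e. (\<lambda>v. (d * c) *s v) ` L = (\<lambda>v. e *s v) ` L \<and> e \<noteq> 0" if "d \<noteq> 0" for d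
      using that assms by (intro exI[of _ "d * c"]) simp
    moreover have "\<exists>e. (\<lambda>v. d *s v) ` L = (\<lambda>v. (e * c) *s v) ` L \<and> e \<noteq> 0" if "d \<noteq> 0" for d
      using that assms by (intro exI[of _ "d / c"]) simp
    ultimately show ?thesis unfolding homothety_class_def by blast
  qed
  finally show ?thesis .
qed

lemma near_adjacent:
  assumes A: "near A" and neq: "lattice_vertex G \<noteq> lattice_vertex (G ** A)"
  shows "building_adjacent (lattice_vertex G) (lattice_vertex (G ** A))"
    and "building_adjacent (lattice_vertex (G ** A)) (lattice_vertex G)"
proof -
  let ?p = "\<lambda>L. (\<lambda>v. inverse rT *s v) ` L"
  define L where "L = lattice_of (rat_matrix G)"
  define L' where "L' = lattice_of (rat_matrix (G ** A))"
  obtain B :: "laurent_matrix" where B: "A ** B = mat 1" "B ** A = mat 1" "\<And>i j. degree_le 1 (B $ i $ j)"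
    using A unfolding near_def by blast
  have mem: "L \<in> lattice_vertex G" "L' \<in> lattice_vertex (G ** A)" "?p L \<in> lattice_vertex G"
    unfolding L_def L'_def lattice_vertex_def
    by (auto simp: homothety_class_self) (auto simp: homothety_class_def)
  have "L' \<subseteq> L"
    unfolding L_def L'_def using A by (intro lattice_of_subset) (simp add: near_def val_ring_laurent_iff)
  moreover have "?p L \<subseteq> L'"
  proof -
    have "?p L = lattice_of (rat_matrix (G ** A ** (mat lTinv ** B)))"
      unfolding L_def inverse_rT_laurent scaled_lattice
      by (simp add: mat_left_commute B flip: matrix_mul_assoc)
    also have "\<dots> \<subseteq> L'"
      unfolding L'_def
    proof (rule lattice_of_subset)
      fix i j
      have "degree_le (1 + -1) (lTinv * B $ i $ j)" by (rule degree_le_monom[OF B(3)])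
      then show "laurent_to_rat ((mat lTinv ** B) $ i $ j) \<in> val_ring"
        by (simp add: val_ring_laurent_iff mat_mult_left)
    qed
    finally show ?thesis .
  qed
  moreover have "L' \<noteq> L" using neq unfolding L_def L'_def lattice_vertex_def by metis
  moreover have "?p L \<noteq> L'"
    using neq homothety_class_scaled[of "inverse rT" L] unfolding L_def L'_def lattice_vertex_def by fastforce
  ultimately have sub: "L' \<subset> L" "?p L \<subset> L'" by auto
  show "building_adjacent (lattice_vertex G) (lattice_vertex (G ** A))"
    unfolding building_adjacent_def using neq mem sub by blast
  have "inj (\<lambda>v :: ratfun ^ 3. inverse rT *s v)"
    by (rule injI) (simp add: vec_eq_iff)
  \<comment> \<open>The opposite adjacency uses the representatives L' and t^-1 L.\<close>
  then have "?p L' \<subset> ?p L" using sub(1) by (simp add: inj_image_subset_iff psubset_eq inj_image_eq_iff)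
  then show "building_adjacent (lattice_vertex (G ** A)) (lattice_vertex G)"
    unfolding building_adjacent_def using neq mem sub by blast
qed

lemma lattice_vertex_building: "kernel_matrix G \<Longrightarrow> lattice_vertex G \<in> building_vertices"
  unfolding building_vertices_def is_lattice_def lattice_vertex_def kernel_matrix_def rat_matrix_def
  using to_rat.invertible by blast

section \<open>The cocycle along a path given by its transition matrices\<close>

fun matrix_list_prod :: "('a::comm_ring_1 ^ 3 ^ 3) list \<Rightarrow> 'a ^ 3 ^ 3" where
  "matrix_list_prod [] = mat 1"
| "matrix_list_prod (A # As) = A ** matrix_list_prod As"

fun theta_list :: "(laurent_matrix) list \<Rightarrow> gen3 free_word \<Rightarrow> gen3 free_word" where
  "theta_list [] = id"
| "theta_list (A # As) = theta A \<circ> theta_list As"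

lemma matrix_list_prod_append: "matrix_list_prod (xs @ ys) = matrix_list_prod xs ** matrix_list_prod ys"
  by (induction xs) (simp_all add: matrix_mul_assoc)

lemma theta_list_append: "theta_list (xs @ ys) = theta_list xs \<circ> theta_list ys"
  by (induction xs) (simp_all add: comp_assoc)

definition kernel_subgroup :: "(laurent_matrix) set set \<Rightarrow> bool" where
  "kernel_subgroup S \<longleftrightarrow> subgroup S PGL3 \<and> (\<forall>h\<in>S. \<exists>A. kernel_matrix A \<and> h = proj A)"

theorem closed_path_trivial:
  assumes S: "kernel_subgroup S" and sc: "simply_connected_space (realization (Delta S))"
    and As: "\<And>A. A \<in> set As \<Longrightarrow> near A \<and> proj A \<in> S"
    and closed: "matrix_list_prod As = mat (upow k)"
  shows "theta_list As = id"
proof -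
  have sub: "subgroup S PGL3" using S by (simp add: kernel_subgroup_def)
  define V where "V = lattice_vertex ` {G. kernel_matrix G \<and> proj G \<in> S}"
  have V: "(\<lambda>g. vertex_act g base_vertex) ` S = V"
  proof -
    have "S = proj ` {G. kernel_matrix G \<and> proj G \<in> S}"
      using S unfolding kernel_subgroup_def by auto
    then have "(\<lambda>g. vertex_act g base_vertex) ` S = (\<lambda>G. vertex_act (proj G) base_vertex) ` {G. kernel_matrix G \<and> proj G \<in> S}"
      by (metis (no_types, lifting) image_image image_cong)
    then show ?thesis unfolding V_def vertex_act_base .
  qed
  \<comment> \<open>One normalised matrix per vertex. By \<open>lattice_vertex_eq\<close> any other
    choice differs by a power of u, to which \<open>theta\<close> is blind.\<close>
  define g where "g v = (SOME G. kernel_matrix G \<and> lattice_vertex G = v)" for v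
  have g: "kernel_matrix (g v)" "lattice_vertex (g v) = v" if "v \<in> V" for v
    using that someI_ex[of "\<lambda>G. kernel_matrix G \<and> lattice_vertex G = v"] unfolding V_def g_def by auto
  \<comment> \<open>The diagonal is set to the identity outright, because
    \<open>simply_connected_cocycle\<close> asks for this at every argument, also outside V.\<close>
  define \<phi> where "\<phi> v w = (if v = w then id else theta (SOME A. near A \<and> (\<exists>k. g v ** A = mat (upow k) ** g w)))" for v w
  have cancel: "A = mat (upow (l - k)) ** A'"
    if v: "v \<in> V" and eq: "g v ** A = mat (upow l) ** W" "g v ** A' = mat (upow k) ** W" for v l k and A A' W :: "laurent_matrix"
  proof -
    obtain H where H: "H ** g v = mat 1" using g(1)[OF v] by (auto simp: kernel_matrix_def invertible_def)
    have "H ** (g v ** A) = mat (upow l) ** (H ** W)" "H ** (g v ** A') = mat (upow k) ** (H ** W)"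
      unfolding eq by (rule mat_left_commute)+
    then show ?thesis using H by (simp add: scalar_simps)
  qed
  have \<phi>: "\<phi> v w = theta A" if "v \<in> V" "near A" "g v ** A = mat (upow l) ** g w" for v w A l
  proof (cases "v = w")
    case True
    have "A = mat (upow (l - 0)) ** mat 1"
      by (rule cancel[OF that(1), of _ _ "g v"]) (use that True in auto)
    then have "theta A = theta (mat 1)" by (rule theta_upow_eq[OF that(2) near_1])
    then show ?thesis using True theta_1 by (simp add: \<phi>_def)
  next
    case False
    let ?B = "SOME A. near A \<and> (\<exists>k. g v ** A = mat (upow k) ** g w)"
    have "\<exists>A. near A \<and> (\<exists>k. g v ** A = mat (upow k) ** g w)" using that by blast
    then have "near ?B \<and> (\<exists>k. g v ** ?B = mat (upow k) ** g w)" by (rule someI_ex)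
    then obtain k where "near ?B" "g v ** ?B = mat (upow k) ** g w" by blast
    then have "theta ?B = theta A" using theta_upow_eq[OF _ that(2) cancel[OF that(1) _ that(3)]] by blast
    then show ?thesis using False by (simp add: \<phi>_def)
  qed
  have edge: "\<exists>A l. near A \<and> g v ** A = mat (upow l) ** g w" if "\<sigma> \<in> Delta S" "v \<in> \<sigma>" "w \<in> \<sigma>" for \<sigma> v w
  proof (cases "v = w")
    case True
    have "g v ** mat 1 = mat (upow 0) ** g w" using True by simp
    then show ?thesis using near_1 by blast
  next
    case False
    have vw: "v \<in> V" "w \<in> V" "building_adjacent v w"
      using that False unfolding Delta_def V full_subcomplex_def building_def by auto
    obtain L L' where L: "L \<in> v" "L' \<in> w" "(\<lambda>v. inverse rT *s v) ` L \<subset> L'" "L' \<subset> L"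
      using vw(3) unfolding building_adjacent_def by blast
    obtain A l where "near A" "g v ** A = mat (upow l) ** g w"
      by (rule near_transition[of "g v" "g w" L L']) (use L vw g in auto)
    then show ?thesis by blast
  qed
  define G where "G i = matrix_list_prod (take i As)" for i
  define x where "x i = lattice_vertex (G i)" for i
  have near_i: "near (As ! i)" "proj (As ! i) \<in> S" if "i < length As" for i using As that by auto
  have G_Suc: "G (Suc i) = G i ** As ! i" if "i < length As" for i
    using that by (simp add: G_def take_Suc_conv_app_nth matrix_list_prod_append)
  have G: "kernel_matrix (G i) \<and> proj (G i) \<in> S" if "i \<le> length As" for i
    using that
  proof (induction i)
    case 0
    have "proj (mat 1) \<in> S" using subgroup.one_closed[OF sub] by (simp add: proj_one)
    then show ?case using kernel_matrix_upow[of 0] by (simp add: G_def)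
  next
    case (Suc i)
    then have "kernel_matrix (G i)" "proj (G i) \<in> S" "kernel_matrix (As ! i)"
      using near_i[of i] by (auto simp: near_def)
    moreover from this have "proj (G i) \<otimes>\<^bsub>PGL3\<^esub> proj (As ! i) = proj (G i ** As ! i)"
      by (intro proj_mult) (simp_all add: kernel_matrix_def)
    ultimately show ?case
      using subgroup.m_closed[OF sub] near_i[of i] Suc.prems G_Suc[of i] kernel_matrix_mult by (metis Suc_le_eq)
  qed
  have xV: "x i \<in> V" if "i \<le> length As" for i using G[OF that] unfolding x_def V_def by blast
  have "chain_prod \<phi> x (length As) = id"
  proof (rule simply_connected_cocycle[OF sc])
    show "finite \<sigma>" if "\<sigma> \<in> Delta S" for \<sigma>
      using that by (simp add: Delta_def full_subcomplex_def building_def)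
    show "\<phi> a a = id" for a by (simp add: \<phi>_def)
    show "\<phi> a b \<circ> \<phi> b c = \<phi> a c" if \<sigma>: "\<sigma> \<in> Delta S" "a \<in> \<sigma>" "b \<in> \<sigma>" "c \<in> \<sigma>" for \<sigma> a b c
    proof -
      obtain A l where A: "near A" "g a ** A = mat (upow l) ** g b" using edge \<sigma> by blast
      obtain B m where B: "near B" "g b ** B = mat (upow m) ** g c" using edge \<sigma> by blast
      obtain C n where C: "near C" "g a ** C = mat (upow n) ** g c" using edge \<sigma> by blast
      have V: "a \<in> V" "b \<in> V" using \<sigma> unfolding Delta_def V full_subcomplex_def by auto
      have "g a ** (A ** B) = mat (upow l) ** (g b ** B)" using A(2) by (simp add: matrix_mul_assoc)
      also have "\<dots> = mat (upow (l + m)) ** g c" unfolding B(2) by (simp add: scalar_simps)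
      finally have "A ** B = mat (upow (l + m - n)) ** C" by (rule cancel[OF V(1) _ C(2)])
      then have "theta A \<circ> theta B = theta C" by (rule theta_mult[OF A(1) B(1) C(1)])
      then show ?thesis using \<phi>[OF V(1) A] \<phi>[OF V(2) B] \<phi>[OF V(1) C] by simp
    qed
    show "\<exists>\<sigma>\<in>Delta S. x i \<in> \<sigma> \<and> x (Suc i) \<in> \<sigma>" if i: "i < length As" for i
    proof (rule bexI[of _ "{x i, x (Suc i)}"])
      have "x i \<in> building_vertices" "x (Suc i) \<in> building_vertices"
        unfolding x_def using G[of i] G[of "Suc i"] i by (auto intro: lattice_vertex_building)
      moreover have "building_adjacent (x i) (x (Suc i)) \<and> building_adjacent (x (Suc i)) (x i)" if "x i \<noteq> x (Suc i)"
        using near_adjacent[OF near_i(1)[OF i], of "G i"] that unfolding x_def G_Suc[OF i] by blast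
      moreover have "card {x i, x (Suc i)} \<le> 3" by (simp add: card_insert_if)
      ultimately show "{x i, x (Suc i)} \<in> Delta S"
        using xV[of i] xV[of "Suc i"] i unfolding Delta_def V full_subcomplex_def building_def by auto
    qed simp
    show "x (length As) = x 0"
      using lattice_vertex_upow[of k "mat 1"] closed by (simp add: x_def G_def)
  qed
  moreover have "chain_prod \<phi> x i = theta_list (take i As)" if "i \<le> length As" for i
    using that
  proof (induction i)
    case (Suc i)
    then have i: "i < length As" by simp
    have "kernel_matrix (G i)" "kernel_matrix (G (Suc i))" using G i by (simp_all add: Suc_leI)
    then obtain a b where ab: "g (x i) = mat (upow a) ** G i" "g (x (Suc i)) = mat (upow b) ** G (Suc i)"
      using g xV i lattice_vertex_eq[of "G i" "g (x i)"] lattice_vertex_eq[of "G (Suc i)" "g (x (Suc i))"]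
      by (metis Suc_leI less_imp_le_nat x_def)
    have "g (x i) ** As ! i = mat (upow (a - b)) ** g (x (Suc i))"
      unfolding ab G_Suc[OF i] by (simp add: scalar_simps)
    then have "\<phi> (x i) (x (Suc i)) = theta (As ! i)" using \<phi> near_i i xV by simp
    then show ?case using Suc i by (simp add: take_Suc_conv_app_nth theta_list_append)
  qed simp
  ultimately show ?thesis by simp
qed

section \<open>The generators of the subgroup\<close>

definition unit4 :: "complex \<Rightarrow> bool" where
  "unit4 z \<longleftrightarrow> z \<in> {1, -1, \<i>, -\<i>}"

lemma unit4_norm: "unit4 z \<Longrightarrow> z * cnj z = 1"
  by (auto simp: unit4_def)

text \<open>The matrices \<open>1 \<oplus> q\<close> with \<open>q\<close> in the quaternion group generated by \<open>P_mat\<close> and \<open>Q_mat\<close>.\<close>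

definition qmat :: "bool \<Rightarrow> complex \<Rightarrow> laurent_matrix" where
  "qmat s z = (if s then mat3 1 0 0 0 0 (lconst z) 0 (lconst (- cnj z)) 0
                    else diag3 1 (lconst z) (lconst (cnj z)))"

definition qmat' :: "bool \<Rightarrow> complex \<Rightarrow> laurent_matrix" where
  "qmat' s z = (if s then mat3 1 0 0 0 0 (lconst (- z)) 0 (lconst (cnj z)) 0
                     else diag3 1 (lconst (cnj z)) (lconst z))"

lemma qmat_inverse:
  assumes "unit4 z"
  shows "qmat s z ** qmat' s z = mat 1" "qmat' s z ** qmat s z = mat 1"
  using unit4_norm[OF assms]
  by (simp_all add: qmat_def qmat'_def mat3_eq_simps mat_def mult_single mult.commute)

lemma qmat_unitary:
  assumes "unit4 z"
  shows "bar_matrix (qmat s z) ** D_form ** transpose (qmat s z) = D_form"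
  using unit4_norm[OF assms]
  by (simp add: qmat_def mat3_eq_simps transpose_def bar_matrix_def
      D_form_def bar_simps mult_single algebra_simps)

lemma det_qmat: "unit4 z \<Longrightarrow> det (qmat s z) = 1"
  using unit4_norm[of z] by (simp add: qmat_def det_3 mult_single single_uminus)

lemma eval_qmat_conj:
  assumes "unit4 z"
  shows "eval_matrix (qmat s z) ** row_unipotent a b ** eval_matrix (qmat' s z) =
    (if s then row_unipotent (b * cnj z) (- (a * z)) else row_unipotent (a * cnj z) (b * z))"
  using unit4_norm[OF assms]
  by (simp add: qmat_def qmat'_def row_unipotent_def mat3_eq_simps
      eval.zero eval.one laurent_eval_monom mult.commute)

lemma kernel_lattice_unit4:
  assumes "unit4 z" "r \<in> kernel_lattice"
  shows "r * z \<in> kernel_lattice"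
proof -
  obtain m n where r: "r = (1 + \<i>) / 2 * (of_int m + of_int n * \<i>)"
    using assms(2) unfolding kernel_lattice_def by blast
  have "r * \<i> = (1 + \<i>) / 2 * (of_int (- n) + of_int m * \<i>)"
    unfolding r by (simp add: complex_eq_iff field_simps)
  then have i: "r * \<i> \<in> kernel_lattice" unfolding kernel_lattice_def by blast
  show ?thesis using assms kernel_lattice_minus[OF i] kernel_lattice_minus[OF assms(2)] i
    by (auto simp: unit4_def)
qed

lemma unit4_cnj: "unit4 z \<Longrightarrow> unit4 (cnj z)"
  by (auto simp: unit4_def)

text \<open>The quaternion matrices are unitary but in general not unipotent at t = -i. They still
  normalise the kernel matrices, because the lattice is stable under multiplication by i.\<close>

lemma kernel_matrix_qconj:
  assumes z: "unit4 z" and A: "kernel_matrix A"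
  shows "kernel_matrix (qmat s z ** A ** qmat' s z)"
  unfolding kernel_matrix_def
proof (intro conjI)
  let ?q = "qmat s z" and ?q' = "qmat' s z"
  have "invertible ?q" "invertible ?q'" using qmat_inverse[OF z] by (auto simp: invertible_def)
  then show "invertible (?q ** A ** ?q')" using A by (simp add: kernel_matrix_def invertible_mult)
  have 1: "bar_matrix ?q' ** bar_matrix ?q = mat 1" "transpose ?q ** transpose ?q' = mat 1"
    using qmat_inverse(2)[OF z, of s]
    by (simp_all add: bar_matrix_def bar.map_matrix_mat bar.one transpose_mat
        flip: bar.map_matrix_mult matrix_transpose_mul)
  have q': "bar_matrix ?q' ** D_form ** transpose ?q' = D_form"
  proof -
    have "bar_matrix ?q' ** D_form ** transpose ?q' =
        (bar_matrix ?q' ** bar_matrix ?q) ** D_form ** (transpose ?q ** transpose ?q')"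
      unfolding qmat_unitary[OF z, of s, symmetric, THEN arg_cong[of _ _ "\<lambda>M. bar_matrix ?q' ** M ** transpose ?q'"]]
      by (simp only: matrix_mul_assoc)
    then show ?thesis by (simp add: 1)
  qed
  have "bar_matrix (?q ** A ** ?q') ** D_form ** transpose (?q ** A ** ?q') =
      bar_matrix ?q ** (bar_matrix A ** (bar_matrix ?q' ** D_form ** transpose ?q') ** transpose A) ** transpose ?q"
    by (simp add: bar_matrix_mult matrix_transpose_mul matrix_mul_assoc)
  also have "\<dots> = D_form"
    unfolding q' using A qmat_unitary[OF z] by (simp add: kernel_matrix_def)
  finally show "bar_matrix (?q ** A ** ?q') ** D_form ** transpose (?q ** A ** ?q') = D_form" .
  have "det ?q * det ?q' = 1" using qmat_inverse(1)[OF z] by (metis det_mul det_I)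
  then have "det (?q ** A ** ?q') = det A" by (simp add: det_mul algebra_simps det_qmat[OF z])
  then show "\<exists>k. det (?q ** A ** ?q') = upow k" using A by (simp add: kernel_matrix_def)
  obtain a b where ab: "a \<in> kernel_lattice" "b \<in> kernel_lattice"
    "eval_matrix A = row_unipotent a b" using A by (auto simp: kernel_matrix_def)
  have "eval_matrix (?q ** A ** ?q') =
     (if s then row_unipotent (b * cnj z) (- (a * z)) else row_unipotent (a * cnj z) (b * z))"
    using eval_qmat_conj[OF z, of s a b] by (simp add: eval.map_matrix_mult ab(3))
  then show "\<exists>a\<in>kernel_lattice. \<exists>b\<in>kernel_lattice. eval_matrix (?q ** A ** ?q') = row_unipotent a b"
    using kernel_lattice_unit4[OF z ab(1)] kernel_lattice_unit4[OF z ab(2)]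
      kernel_lattice_unit4[OF unit4_cnj[OF z] ab(1)] kernel_lattice_unit4[OF unit4_cnj[OF z] ab(2)]
      kernel_lattice_minus[of "a * z"] by (cases s) (simp; blast)+
qed

lemma degree_le_const: "degree_le n f \<Longrightarrow> degree_le n (lconst c * (f :: complex laurent))"
  using degree_le_monom[of n f 0 c] by simp

lemma degree_le_const': "degree_le n f \<Longrightarrow> degree_le n ((f :: complex laurent) * lconst c)"
  using degree_le_const[of n f c] by (simp add: mult.commute)

lemma degree_le_qconj:
  assumes "\<And>i j. degree_le n (A $ i $ j)"
  shows "degree_le n ((qmat s z ** A ** qmat' s z) $ i $ j)"
proof -
  have "\<forall>i j. degree_le n ((qmat s z ** A ** qmat' s z) $ i $ j)"
    unfolding forall_3 using assms
    by (cases s) (simp_all add: qmat_def qmat'_def matrix_matrix_mult_def sum_3 degree_le_const degree_le_const')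
  then show ?thesis by blast
qed

lemma near_qconj:
  assumes z: "unit4 z" and A: "near A"
  shows "near (qmat s z ** A ** qmat' s z)"
proof -
  obtain B :: "laurent_matrix" where B: "A ** B = mat 1" "B ** A = mat 1" "\<And>i j. degree_le 1 (B $ i $ j)"
    using A unfolding near_def by blast
  let ?q = "qmat s z" and ?q' = "qmat' s z"
  have *: "(?q ** X ** ?q') ** (?q ** Y ** ?q') = ?q ** (X ** Y) ** ?q'" for X Y
  proof -
    have "(?q ** X ** ?q') ** (?q ** Y ** ?q') = ?q ** X ** (?q' ** ?q) ** Y ** ?q'"
      by (simp only: matrix_mul_assoc)
    then show ?thesis using qmat_inverse(2)[OF z, of s] by (simp add: matrix_mul_assoc)
  qed
  have "(?q ** A ** ?q') ** (?q ** B ** ?q') = mat 1" "(?q ** B ** ?q') ** (?q ** A ** ?q') = mat 1"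
    unfolding * B using qmat_inverse(1)[OF z, of s] by simp_all
  then show ?thesis
    unfolding near_def using A B(3) degree_le_qconj kernel_matrix_qconj[OF z] by (metis near_def)
qed

lemma calpha_simps:
  "calpha * cnj calpha = 1 / 2" "-\<i> * (1 - calpha) = - calpha" "calpha \<in> kernel_lattice"
proof -
  show "calpha * cnj calpha = 1 / 2" "-\<i> * (1 - calpha) = - calpha"
    by (simp_all add: complex_eq_iff)
  show "calpha \<in> kernel_lattice"
    unfolding kernel_lattice_def by (rule CollectI, rule exI[of _ 1], rule exI[of _ 0]) simp
qed

lemma near_R1: "near (matR1 calpha)"
proof -
  obtain x y :: "complex laurent" where xy: "x = lT" "y = lTinv" by blast
  define a where "a = lconst calpha"
  define b where "b = lconst (cnj calpha)"
  define c where "c = lconst \<i>"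
  have "lconst (2 :: complex) = 2" by (metis single_numeral)
  moreover have "2 * (calpha * cnj calpha) = 1" using calpha_simps(1) by simp
  ultimately have ab: "2 * (a * b) = 1"
    unfolding a_def b_def by (metis lconst_mult single_one)
  have "\<i> * cnj calpha = calpha" by (simp add: complex_eq_iff)
  then have cb: "c * b = a" unfolding a_def b_def c_def by (metis lconst_mult)
  have cc: "c * c = -1" unfolding c_def by (simp add: mult_single single_uminus)
  have xy1: "x * y = 1" unfolding xy by (rule T_Tinv)
  have u: "uu = - c * y" "upow (-1) = c * x"
    by (simp_all add: upow_def c_def xy mult_single power_int_minus flip: single_uminus)
  have d: "daff calpha = a * (1 - y)"
    unfolding daff_def calpha_simps(2) a_def xy by (simp only: single_uminus right_diff_distrib mult_single mult_1_right) simp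
  have e: "caff (\<i> * cnj calpha) = a * (1 + y * y)"
    unfolding caff_def \<open>\<i> * cnj calpha = calpha\<close> a_def xy by (simp add: distrib_left mult_single)
  have R: "matR1 calpha = mat3 (a * (1 - y)) a 0 (a * (1 + y * y)) (a * (1 - y)) 0 0 0 (- c * y)"
    unfolding matR1_def d e u a_def[symmetric] ..
  \<comment> \<open>Unitarity dictates the inverse, \<open>D_form\<close> bar(A)^T
    \<open>D_form\<close>^-1; its entry b x is written -c a x, since b = -c a.\<close>
  let ?B = "mat3 (b * (1 - x)) (- c * a * x) 0 (b * (x + y)) (b * (1 - x)) 0 0 0 (c * x)"
  have inv: "matR1 calpha ** ?B = mat 1" "?B ** matR1 calpha = mat 1"
    unfolding R mat3_eq_simps mat_def
    by (simp_all, (use ab cb cc xy1 in algebra)+)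
  have bar: "laurent_bar x = y" "laurent_bar y = x" "laurent_bar a = b" "laurent_bar b = a" "laurent_bar c = - c"
    by (simp_all add: xy a_def b_def c_def laurent_bar_monom flip: single_uminus)
  have "kernel_matrix (matR1 calpha)"
    unfolding kernel_matrix_def
  proof (intro conjI)
    show "invertible (matR1 calpha)" using inv by (auto simp: invertible_def)
    show "bar_matrix (matR1 calpha) ** D_form ** transpose (matR1 calpha) = D_form"
      unfolding R D_form_def mat3_eq_simps transpose_def bar_matrix_def
      by (fold xy, simp add: bar bar.add bar.mult bar.minus bar.diff bar.zero bar.one, intro conjI,
          (use ab cb cc xy1 in algebra)+)
    have "det (matR1 calpha) = (daff calpha * daff calpha - lconst calpha * caff (\<i> * cnj calpha)) * uu"
      unfolding matR1_def by (simp add: det_3 algebra_simps)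
    then show "\<exists>k. det (matR1 calpha) = upow k" using det_R[OF calpha_simps(1)] by (auto simp: upow_add)
    have "type2 (matR1 calpha)" unfolding type2_def using calpha_simps by blast
    moreover have "coeff0 (matR1 calpha $ 1 $ 2) = calpha" "coeff0 (matR1 calpha $ 1 $ 3) = 0"
      by (simp_all add: matR1_def)
    ultimately have "eval_matrix (matR1 calpha) = row_unipotent calpha 0"
      using type2_eval by metis
    then show "\<exists>r\<in>kernel_lattice. \<exists>s\<in>kernel_lattice. eval_matrix (matR1 calpha) = row_unipotent r s"
      using calpha_simps(3) kernel_lattice_0 by blast
  qed
  moreover have "degree_le 0 (matR1 calpha $ i $ j)" for i j
  proof -
    have "\<forall>i j. degree_le 0 (matR1 calpha $ i $ j)"
      unfolding forall_3 matR1_def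
      by (auto simp: degree_le_def daff_def caff_def upow_def lookup_add lookup_single when_def)
    then show ?thesis by blast
  qed
  moreover have "degree_le 1 (?B $ i $ j)" for i j
  proof -
    have "\<forall>i j. degree_le 1 (?B $ i $ j)"
      unfolding forall_3 a_def b_def c_def xy
      by (simp add: right_diff_distrib distrib_left mult_single flip: single_uminus)
         (auto simp: degree_le_def lookup_add lookup_minus lookup_single when_def)
    then show ?thesis by blast
  qed
  ultimately show ?thesis unfolding near_def using inv by blast
qed

lemma degree_le_simps:
  "degree_le n (upow k) \<longleftrightarrow> - k \<le> n" "0 \<le> n \<Longrightarrow> degree_le n 1" "degree_le n 0"
  by (auto simp: degree_le_def upow_def lookup_single when_def lookup_one)

lemma matP_diag: "matP 1 0 = diag3 uu 1 uu" "matP 0 0 = diag3 uu uu 1"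
  by (simp_all add: matP_def aff_simps)

lemma near_P: "near (matP 1 0)" "near (matP 0 0)"
proof -
  have *: "near (diag3 uu f g)" if fg: "f = 1 \<and> g = uu \<or> f = uu \<and> g = 1" for f g
  proof -
    have b: "laurent_bar uu * uu = 1" by (simp add: bar_upow upow_add)
    have inv: "diag3 uu f g ** diag3 (upow (-1)) (laurent_bar f) (laurent_bar g) = mat 1"
      "diag3 (upow (-1)) (laurent_bar f) (laurent_bar g) ** diag3 uu f g = mat 1"
      using fg by (auto simp: mat3_eq_simps mat_def bar_upow upow_add bar.one)
    have "kernel_matrix (diag3 uu f g)"
      unfolding kernel_matrix_def
    proof (intro conjI)
      show "invertible (diag3 uu f g)" using inv by (auto simp: invertible_def)
      show "bar_matrix (diag3 uu f g) ** D_form ** transpose (diag3 uu f g) = D_form"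
        using fg b unfolding D_form_def mat3_eq_simps transpose_def bar_matrix_def
        by (auto simp: bar.zero bar.one mult.left_commute mult.commute[of _ uu] simp flip: mult.assoc)
      show "\<exists>k. det (diag3 uu f g) = upow k" using fg by (auto simp: det_3 upow_add)
      have "eval_matrix (diag3 uu f g) = row_unipotent 0 0"
        using fg by (auto simp: row_unipotent_def vec_eq_iff forall_3 eval.one eval.zero)
      then show "\<exists>r\<in>kernel_lattice. \<exists>s\<in>kernel_lattice. eval_matrix (diag3 uu f g) = row_unipotent r s"
        using kernel_lattice_0 by blast
    qed
    moreover have "\<forall>i j. degree_le 0 (diag3 uu f g $ i $ j)"
      using fg unfolding forall_3 by (auto simp: degree_le_simps)
    moreover have "\<forall>i j. degree_le 1 (diag3 (upow (-1)) (laurent_bar f) (laurent_bar g) $ i $ j)"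
      using fg unfolding forall_3 by (auto simp: bar_upow bar.one degree_le_simps)
    ultimately show ?thesis unfolding near_def using inv by blast
  qed
  show "near (matP 1 0)" "near (matP 0 0)" unfolding matP_diag by (rule *; simp)+
qed

lemma qmat_R1:
  assumes "unit4 z"
  shows "qmat s z ** matR1 calpha = (if s then matR2 (- (calpha * z)) else matR1 (calpha * cnj z)) ** qmat s z"
proof -
  have c: "caff (w * v) = lconst w * caff v" for w v by (simp add: caff_alt lconst_mult mult.assoc)
  show "qmat s z ** matR1 calpha = (if s then matR2 (- (calpha * z)) else matR1 (calpha * cnj z)) ** qmat s z"
  proof (cases s)
    case True
    have "lconst (- (calpha * z)) * lconst (- cnj z) = lconst calpha"
      unfolding lconst_mult[symmetric] minus_mult_minus using unit4_norm[OF assms] by (simp add: mult.assoc)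
    moreover have "caff (\<i> * cnj (- (calpha * z))) = lconst (- cnj z) * caff (\<i> * cnj calpha)"
      by (simp add: mult.commute mult.left_commute flip: c)
    ultimately show ?thesis using True
      by (simp add: qmat_def matR1_def matR2_def mat3_eq_simps mult.commute)
  next
    case False
    have "lconst (calpha * cnj z) * lconst z = lconst calpha"
      unfolding lconst_mult[symmetric] using unit4_norm[OF assms] by (simp add: mult.assoc mult.commute[of "cnj z"])
    moreover have "caff (\<i> * cnj (calpha * cnj z)) = lconst z * caff (\<i> * cnj calpha)"
      by (simp add: mult.commute mult.left_commute flip: c)
    ultimately show ?thesis using False
      by (simp add: qmat_def matR1_def mat3_eq_simps mult.commute)
  qed
qed

text \<open>The conjugate of \<open>matR1 calpha\<close> by \<open>qmat s z\<close>, see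
  \<open>qmat_conj_Rmat\<close>. The flag tells whether the off-diagonal entry of the first row
  stands in the third or the second column.\<close>

definition Rmat :: "bool \<Rightarrow> complex \<Rightarrow> laurent_matrix" where
  "Rmat s z = (if s then matR2 (- (calpha * z)) else matR1 (calpha * cnj z))"

definition Pmat :: "bool \<Rightarrow> laurent_matrix" where
  "Pmat s = matP (if s then 1 else 0) 0"

lemma qmat_Rmat: "unit4 z \<Longrightarrow> qmat s z ** matR1 calpha = Rmat s z ** qmat s z"
  using qmat_R1 by (simp add: Rmat_def)

lemma qmat_Pmat: "qmat s z ** Pmat t = Pmat (s \<noteq> t) ** qmat s z"
  by (cases s; cases t)
     (simp_all add: Pmat_def matP_diag qmat_def mat3_eq_simps mult.commute)

lemma qmat_conj_Rmat: "unit4 z \<Longrightarrow> qmat s z ** matR1 calpha ** qmat' s z = Rmat s z"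
  using qmat_inverse(1)[of z s] by (simp add: qmat_Rmat flip: matrix_mul_assoc)

lemma qmat_conj_Pmat: "unit4 z \<Longrightarrow> qmat s z ** Pmat t ** qmat' s z = Pmat (s \<noteq> t)"
  using qmat_inverse(1)[of z s] by (simp add: qmat_Pmat flip: matrix_mul_assoc)

lemma near_Rmat: "unit4 z \<Longrightarrow> near (Rmat s z)"
  by (metis near_qconj near_R1 qmat_conj_Rmat)

lemma near_Pmat: "near (Pmat s)"
  using near_P by (simp add: Pmat_def)

lemma near_invertible: "near A \<Longrightarrow> invertible A"
  by (simp add: near_def kernel_matrix_def)

lemma u_matrix_qmat: "u_matrix P_mat = qmat True 1" "u_matrix Q_mat = qmat False \<i>" "u_matrix R_mat = qmat True \<i>"
  by (simp_all add: u_matrix_def P_mat_def Q_mat_def R_mat_def qmat_def)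

lemma conj_by_u_qmat:
  assumes z: "unit4 z" and u: "u_matrix a = qmat s z" and A: "invertible A"
  shows "conj_by_u a (proj A) = proj (qmat s z ** A ** qmat' s z)"
proof -
  have inv: "invertible (qmat s z)" "invertible (qmat' s z)"
    using qmat_inverse[OF z] by (auto simp: invertible_def)
  show ?thesis
    unfolding conj_by_u_def u_class_def u proj_inv[OF qmat_inverse[OF z]] using inv A
    by (simp add: proj_mult invertible_mult)
qed

lemma proj_scalar: "c dvd 1 \<Longrightarrow> proj (mat c ** A) = proj A"
  unfolding proj_eq_iff by blast

lemma k_infinity_Pmat: "k_infinity = proj (Pmat True)"
proof -
  have "uu * lmonom \<i> 1 = 1" by (simp add: upow_def mult_single)
  then have "Pmat True = mat uu ** diag3 1 (lmonom \<i> 1) 1"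
    by (simp add: Pmat_def matP_diag mat_mult_left vec_eq_iff forall_3)
  then show ?thesis unfolding k_infinity_def by (simp add: proj_scalar[OF upow_dvd])
qed

lemma k_one_Rmat: "k_one = proj (matR1 calpha)"
proof -
  define r :: complex where "r = 1 / complex_of_real (sqrt 2)"
  have r2: "2 * (r * r) = 1" unfolding r_def by (simp flip: of_real_mult)
  \<comment> \<open>The inverse of (1+i)/sqrt 2, so that the scalar w u turns the last diagonal
    entry into u.\<close>
  define w where "w = (1 - \<i>) * r"
  let ?K = "k_one_left ** diag3 1 1 (lconst ((1 + \<i>) / sqrt 2))"
  have "r * r = 2 * (r * r) / 2" by simp
  then have rr: "r * r = 1 / 2" by (simp only: r2)
  have wr: "w * r = (1 - \<i>) / 2" by (simp add: w_def mult.assoc rr)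
  have ww: "w * ((1 + \<i>) * r) = 1"
  proof -
    have "w * ((1 + \<i>) * r) = ((1 - \<i>) * (1 + \<i>)) * (r * r)" by (simp only: w_def ac_simps)
    also have "(1 - \<i>) * (1 + \<i>) = 2" by (simp add: algebra_simps)
    finally show ?thesis using rr by simp
  qed
  have K: "?K = mat3 (lconst r * (1 - lT)) (lconst r * (- lT)) 0
       (lconst r * (-(lTinv + lT))) (lconst r * (1 - lT)) 0 0 0 (lconst ((1 + \<i>) * r))"
    unfolding k_one_left_def r_def by (simp add: mat3_eq_simps)
  have c: "lconst w * uu * (lconst r * f) = lmonom (- calpha) (-1) * f" for f
  proof -
    have "(1 - \<i>) / 2 * (- \<i>) = - calpha" by (simp add: complex_eq_iff)
    then have "lconst ((1 - \<i>) / 2) * uu = lmonom (- calpha) (-1)" by (simp add: upow_def mult_single)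
    then have "(lconst w * lconst r) * uu = lmonom (- calpha) (-1)" by (simp only: wr flip: lconst_mult)
    moreover have "lconst w * uu * (lconst r * f) = (lconst w * lconst r) * uu * f" by (simp only: ac_simps)
    ultimately show ?thesis by simp
  qed
  have d: "daff calpha = lconst calpha + lmonom (- calpha) (-1)"
    unfolding daff_def calpha_simps(2) ..
  have "\<i> * cnj calpha = calpha" by (simp add: complex_eq_iff)
  then have e: "caff (\<i> * cnj calpha) = lconst calpha + lmonom calpha (-2)" by (simp add: caff_def)
  have 1: "lmonom (- calpha) (-1) * (1 - lT) = daff calpha" "lmonom (- calpha) (-1) * (- lT) = lconst calpha"
    "lmonom (- calpha) (-1) * (- (lTinv + lT)) = caff (\<i> * cnj calpha)"
    unfolding d e by (simp_all only: single_uminus right_diff_distrib distrib_left mult_single mult_1_right mult_minus_left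
        mult_minus_right minus_minus minus_add_distrib) (simp_all add: add.commute)
  have 2: "lconst w * uu * lconst ((1 + \<i>) * r) = uu"
  proof -
    have "lconst w * uu * lconst ((1 + \<i>) * r) = (lconst w * lconst ((1 + \<i>) * r)) * uu"
      by (simp only: ac_simps)
    then show ?thesis by (simp add: ww flip: lconst_mult)
  qed
  have "mat (lconst w * uu) ** ?K = matR1 calpha"
    unfolding K mat_mult_left matR1_def vec_eq_iff forall_3 by (simp add: c 1 2 del: mult_minus_right minus_add_distrib)
  moreover have "lconst w * uu dvd 1"
  proof -
    have "lconst w * lconst ((1 + \<i>) * r) = 1" using ww by (simp add: mult_single)
    then have "lconst w dvd 1" by (metis dvd_triv_left)
    then show ?thesis using upow_dvd[of 1] by (metis mult_dvd_mono mult_1)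
  qed
  ultimately show ?thesis unfolding k_one_def by (metis proj_scalar)
qed

lemma H_group_subgroup: "subgroup H_group PGL3"
  unfolding H_group_def
proof (rule group.generate_is_subgroup[OF group_PGL3])
  have "H_gens \<subseteq> H_group" unfolding H_group_def by (auto intro: generate.incl)
  then show "H_gens \<subseteq> carrier PGL3"
    using H_group_unipotent_kernel subgroup.subset[OF subgroup_unipotent_kernel] by blast
qed

lemma H_gens_eq:
  "H_gens = {proj (Pmat True), proj (Pmat False), proj (Rmat False 1), proj (Rmat True 1), proj (Rmat False \<i>), proj (Rmat True \<i>)}"
proof -
  have u: "unit4 1" "unit4 \<i>" by (simp_all add: unit4_def)
  have "conj_by_u P_mat k_infinity = proj (Pmat False)"
    unfolding k_infinity_Pmat conj_by_u_qmat[OF u(1) u_matrix_qmat(1) near_invertible[OF near_Pmat]] qmat_conj_Pmat[OF u(1)]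
    by simp
  moreover have "k_one = proj (Rmat False 1)" by (simp add: k_one_Rmat Rmat_def)
  moreover have "conj_by_u P_mat k_one = proj (Rmat True 1)" "conj_by_u Q_mat k_one = proj (Rmat False \<i>)"
    "conj_by_u R_mat k_one = proj (Rmat True \<i>)"
    unfolding k_one_Rmat conj_by_u_qmat[OF u(1) u_matrix_qmat(1) near_invertible[OF near_R1]]
      conj_by_u_qmat[OF u(2) u_matrix_qmat(2) near_invertible[OF near_R1]]
      conj_by_u_qmat[OF u(2) u_matrix_qmat(3) near_invertible[OF near_R1]] qmat_conj_Rmat[OF u(1)] qmat_conj_Rmat[OF u(2)]
    by simp_all
  ultimately show ?thesis unfolding H_gens_def k_infinity_Pmat by simp
qed

lemma kernel_subgroup_H: "kernel_subgroup H_group"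
  unfolding kernel_subgroup_def
proof (intro conjI ballI H_group_subgroup)
  have gen: "\<exists>A. kernel_matrix A \<and> h = proj A" if "h \<in> H_gens" for h
  proof -
    have "kernel_matrix (Pmat s)" "kernel_matrix (Rmat s 1)" "kernel_matrix (Rmat s \<i>)" for s
      using near_Pmat[of s] near_Rmat[of 1 s] near_Rmat[of \<i> s] by (auto simp: near_def unit4_def)
    then show ?thesis using that unfolding H_gens_eq by blast
  qed
  fix h assume "h \<in> H_group"
  then show "\<exists>A. kernel_matrix A \<and> h = proj A"
    unfolding H_group_def
  proof (induction rule: generate.induct)
    case one
    show ?case using kernel_matrix_upow[of 0] by (auto simp: proj_one)
  next
    case (incl h)
    then show ?case by (rule gen)
  next
    case (inv h)
    then obtain A where A: "kernel_matrix A" "h = proj A" using gen by blast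
    then obtain B where B: "A ** B = mat 1" "B ** A = mat 1" by (auto simp: kernel_matrix_def invertible_def)
    then show ?case using kernel_matrix_inverse[OF A(1) B] proj_inv[OF B] A(2) by auto
  next
    case (eng h1 h2)
    then obtain A B where "kernel_matrix A" "h1 = proj A" "kernel_matrix B" "h2 = proj B" by blast
    then show ?case using kernel_matrix_mult[of A B] proj_mult[of A B] by (auto simp: kernel_matrix_def)
  qed
qed

definition step :: "laurent_matrix \<Rightarrow> bool" where
  "step A \<longleftrightarrow> near A \<and> proj A \<in> H_group"

lemma step_star:
  assumes "step A"
  obtains B where "step B" "A ** B = mat uu" "B ** A = mat uu" "theta A \<circ> theta B = id" "theta B \<circ> theta A = id"
proof -
  have A: "near A" "proj A \<in> H_group" using assms by (auto simp: step_def)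
  obtain C where C: "A ** C = mat 1" "C ** A = mat 1"
    using near_invertible[OF A(1)] by (auto simp: invertible_def)
  let ?B = "mat uu ** C"
  have near: "near ?B" by (rule near_star[OF A(1) C])
  have "proj ?B = inv\<^bsub>PGL3\<^esub> proj A" by (simp add: proj_scalar[OF upow_dvd] proj_inv[OF C])
  then have "step ?B" using near subgroup.m_inv_closed[OF H_group_subgroup A(2)] by (simp add: step_def)
  moreover have AB: "A ** ?B = mat uu" "?B ** A = mat uu"
    by (simp add: mat_left_commute C, simp add: C flip: matrix_mul_assoc)
  moreover have "theta A \<circ> theta ?B = id" "theta ?B \<circ> theta A = id"
    using theta_mult[OF A(1) near near_1, of 1] theta_mult[OF near A(1) near_1, of 1] AB theta_1 by simp_all
  ultimately show thesis using that by blast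
qed

lemma proj_in_H_mult: "proj A \<in> H_group \<Longrightarrow> proj B \<in> H_group \<Longrightarrow> invertible A \<Longrightarrow> invertible B \<Longrightarrow> proj (A ** B) \<in> H_group"
  using subgroup.m_closed[OF H_group_subgroup, of "proj A" "proj B"] by (simp add: proj_mult)

lemma step_Pmat: "step (Pmat s)"
proof -
  have "proj (Pmat s) \<in> H_gens" by (cases s) (simp_all add: H_gens_eq)
  then show ?thesis by (simp add: step_def near_Pmat H_group_def generate.incl)
qed

text \<open>The generators contain \<open>Rmat s z\<close> only for z = 1 and z = i; this relation
  puts \<open>Rmat s (- z)\<close> into H as well. One case is computed, and conjugation by
  \<open>qmat s z\<close> gives the others.\<close>

lemma Rmat_opposite:
  assumes "unit4 z"
  shows "Rmat s z ** Rmat s (- z) ** Pmat s = mat (upow 2)"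
proof -
  have base: "Rmat False 1 ** Rmat False (- 1) ** Pmat False = mat (upow 2)"
  proof -
    have a: "lconst calpha + lconst calpha - lconst calpha * lconst calpha - lconst calpha * lconst calpha = 1"
    proof -
      have "calpha + calpha - calpha * calpha - calpha * calpha = 1" by (simp add: complex_eq_iff)
      then have "lconst (calpha + calpha - calpha * calpha - calpha * calpha) = 1" by (simp only: single_one)
      then show ?thesis unfolding single_diff single_add lconst_mult .
    qed
    have b: "\<i> * cnj calpha = calpha" "\<i> * cnj (- calpha) = - calpha" by (simp_all add: complex_eq_iff)
    have m: "lconst (- calpha) = - (lconst calpha :: complex laurent)" by (simp add: single_uminus)
    have u2: "upow 2 = uu * uu" by (simp add: upow_add)
    have R: "Rmat False 1 = mat3 (daff calpha) (lconst calpha) 0 (caff calpha) (daff calpha) 0 0 0 uu"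
      "Rmat False (- 1) = mat3 (daff calpha) (- lconst calpha) 0 (- caff calpha) (daff calpha) 0 0 0 uu"
      using b m by (simp_all add: Rmat_def matR1_def caff_alt)
    have P: "Pmat False = diag3 uu uu 1" by (simp add: Pmat_def matP_diag)
    show ?thesis
      unfolding R P u2 daff_alt caff_alt mat3_eq_simps mat_def
      by (simp_all, (use a in algebra)+)
  qed
  have R: "qmat s z ** Rmat False 1 = Rmat s z ** qmat s z"
    using qmat_Rmat[OF assms, of s] by (simp add: Rmat_def)
  have R': "qmat s z ** Rmat False (- 1) = Rmat s (- z) ** qmat s z"
  proof -
    have "Rmat False (- 1) = qmat False (- 1) ** matR1 calpha ** qmat' False (- 1)"
      by (rule qmat_conj_Rmat[symmetric]) (simp add: unit4_def)
    moreover have "qmat s z ** qmat False (- 1) = qmat s (- z)" "qmat' False (- 1) = qmat False (- 1)"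
       "qmat s (- z) ** qmat False (- 1) = qmat s z"
      by (cases s; simp add: qmat_def qmat'_def mat3_eq_simps mult_single)+
    moreover have "unit4 (- z)" using assms by (auto simp: unit4_def)
    ultimately show ?thesis using qmat_Rmat[of "- z" s] by (metis matrix_mul_assoc)
  qed
  have P: "qmat s z ** Pmat False = Pmat s ** qmat s z" using qmat_Pmat[of s z False] by simp
  have "(Rmat s z ** Rmat s (- z) ** Pmat s) ** qmat s z = qmat s z ** (Rmat False 1 ** Rmat False (- 1) ** Pmat False)"
    using R R' P by (metis matrix_mul_assoc)
  also have "\<dots> = mat (upow 2) ** qmat s z" unfolding base by (rule mat_mult_commute)
  finally have "(Rmat s z ** Rmat s (- z) ** Pmat s) ** qmat s z ** qmat' s z = mat (upow 2) ** qmat s z ** qmat' s z"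
    by simp
  then show ?thesis using qmat_inverse(1)[OF assms, of s] by (simp flip: matrix_mul_assoc)
qed

lemma step_Rmat:
  assumes "unit4 z"
  shows "step (Rmat s z)"
proof -
  have base: "proj (Rmat s z) \<in> H_group" if "z \<in> {1, \<i>}" for z
  proof -
    have "proj (Rmat s z) \<in> H_gens" using that by (cases s) (auto simp: H_gens_eq)
    then show ?thesis by (simp add: H_group_def generate.incl)
  qed
  have "proj (Rmat s (- z)) \<in> H_group" if z: "z \<in> {1, \<i>}" for z
  proof -
    have u: "unit4 z" "unit4 (- z)" using z by (auto simp: unit4_def)
    have s: "step (Rmat s z)" "step (Pmat s)"
      using near_Rmat[OF u(1)] base[OF z] step_Pmat by (simp_all add: step_def)
    obtain A where A: "step A" "A ** Rmat s z = mat uu" using step_star[OF s(1)] by metis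
    obtain B where B: "step B" "Pmat s ** B = mat uu" using step_star[OF s(2)] by metis
    have "A ** (Rmat s z ** Rmat s (- z) ** Pmat s) ** B = (A ** Rmat s z) ** Rmat s (- z) ** (Pmat s ** B)"
      by (simp only: matrix_mul_assoc)
    then have "A ** mat (upow 2) ** B = mat uu ** Rmat s (- z) ** mat uu"
      unfolding Rmat_opposite[OF u(1)] A(2) B(2) .
    then have "mat (upow 2) ** (A ** B) = mat (upow 2) ** Rmat s (- z)"
      by (simp add: mat_mult_commute[of A] mat_mult_commute[of "mat uu ** Rmat s (- z)"] scalar_simps)
    then have "A ** B = Rmat s (- z)" by (rule mat_cancel) simp
    moreover have "proj (A ** B) \<in> H_group"
      using A(1) B(1) near_invertible by (intro proj_in_H_mult) (auto simp: step_def)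
    ultimately show ?thesis by simp
  qed
  from base this[of 1] this[of \<i>] show ?thesis using assms near_Rmat[OF assms, of s]
    by (auto simp: step_def unit4_def)
qed

section \<open>The edge path of a word\<close>

interpretation int_to_complex: laurent_ring_hom "laurent_lift (\<lambda>k c. lmonom (complex_of_int c) k)"
  by (rule laurent_ring_hom_lift) (simp_all add: single_add mult_single)

definition complex_matrix :: "int laurent ^ 3 ^ 3 \<Rightarrow> laurent_matrix" where
  "complex_matrix A = map_matrix (laurent_lift (\<lambda>k c. lmonom (complex_of_int c) k)) A"

text \<open>The columns are the fixed vector of \<open>s1 s3\<^sup>-\<^sup>1\<close>, \<open>e\<^sub>1\<close> and \<open>t e\<^sub>3\<close>.\<close>

definition burau_basis :: "laurent_matrix" where
  "burau_basis = mat3 1 1 0 (1 + lT) 0 0 lT 0 lT"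

definition free_matrix_a :: "laurent_matrix" where
  "free_matrix_a = diag3 1 (- lT) (- lTinv)"

definition free_matrix_b :: "laurent_matrix" where
  "free_matrix_b = mat3 (1 - lT - lTinv) (1 - lT) 0
                        0 0 1
                        ((lT + lTinv) * (1 - lTinv)) (lT + lTinv - 1) 0"

lemma complex_matrix_mult: "complex_matrix (A ** B) = complex_matrix A ** complex_matrix B"
  by (simp add: complex_matrix_def int_to_complex.map_matrix_mult)

lemma complex_matrix_1: "complex_matrix (mat 1) = mat 1"
  by (simp add: complex_matrix_def int_to_complex.map_matrix_mat int_to_complex.one)

lemma burau_gen_inverse:
  "matrix_inv (burau_gen Sigma2) = mat3 1 0 0 1 (-lTinv) lTinv 0 0 1"
  "matrix_inv (burau_gen Sigma3) = mat3 1 0 0 0 1 0 0 1 (-lTinv)"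
  by (rule matrix_inv_unique;
      simp add: mat3_eq_simps mat_def mult_single)+

lemma complex_matrix_mat3:
  "complex_matrix (mat3 a b c d e f g h i) = (let F = laurent_lift (\<lambda>k c. lmonom (complex_of_int c) k) in
     mat3 (F a) (F b) (F c) (F d) (F e) (F f) (F g) (F h) (F i))"
  by (simp add: complex_matrix_def vec_eq_iff forall_3 Let_def)

lemma mat3_eqI:
  "A $ 1 $ 1 = B $ 1 $ 1 \<Longrightarrow> A $ 1 $ 2 = B $ 1 $ 2 \<Longrightarrow> A $ 1 $ 3 = B $ 1 $ 3 \<Longrightarrow>
   A $ 2 $ 1 = B $ 2 $ 1 \<Longrightarrow> A $ 2 $ 2 = B $ 2 $ 2 \<Longrightarrow> A $ 2 $ 3 = B $ 2 $ 3 \<Longrightarrow>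
   A $ 3 $ 1 = B $ 3 $ 1 \<Longrightarrow> A $ 3 $ 2 = B $ 3 $ 2 \<Longrightarrow> A $ 3 $ 3 = B $ 3 $ 3 \<Longrightarrow> A = (B :: 'a ^ 3 ^ 3)"
  by (simp add: vec_eq_iff forall_3)

lemma mat3_mult_entry:
  "(A ** B) $ i $ j = A $ i $ 1 * B $ 1 $ j + A $ i $ 2 * B $ 2 $ j + A $ i $ 3 * (B :: 'a::comm_ring_1 ^ 3 ^ 3) $ 3 $ j"
  by (simp add: matrix_matrix_mult_def sum_3)

lemma complex_burau_gen:
  "complex_matrix (burau_gen Sigma1) = mat3 (-lT) 1 0 0 1 0 0 0 1"
  "complex_matrix (burau_gen Sigma2) = mat3 1 0 0 lT (-lT) 1 0 0 1"
  "complex_matrix (matrix_inv (burau_gen Sigma2)) = mat3 1 0 0 1 (-lTinv) lTinv 0 0 1"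
  "complex_matrix (matrix_inv (burau_gen Sigma3)) = mat3 1 0 0 0 1 0 0 1 (-lTinv)"
  unfolding burau_gen_inverse unfolding burau_gen.simps complex_matrix_mat3 Let_def
  by (simp_all add: int_to_complex.zero int_to_complex.one int_to_complex.minus laurent_lift_monom)

lemma burau_a: "complex_matrix (burau_braid (fa True)) ** burau_basis = burau_basis ** free_matrix_a"
proof -
  have F: "complex_matrix (burau_braid (fa True)) =
      complex_matrix (burau_gen Sigma1) ** complex_matrix (matrix_inv (burau_gen Sigma3))"
    by (simp only: fa_def if_True if_False burau_braid_mult burau_braid_sigma burau_letter_def fst_conv snd_conv complex_matrix_mult)
  show ?thesis
    unfolding F complex_burau_gen burau_basis_def free_matrix_a_def
    by (intro mat3_eqI; simp add: mat3_mult_entry algebra_simps mult_single)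
qed

lemma burau_b: "complex_matrix (burau_braid (fb True)) ** burau_basis = burau_basis ** free_matrix_b"
proof -
  obtain x y :: "complex laurent" where xy: "x = lT" "y = lTinv" by blast
  have xy1: "x * y = 1" unfolding xy by (rule T_Tinv)
  have F: "complex_matrix (burau_braid (fb True)) = complex_matrix (burau_gen Sigma2) **
      (complex_matrix (burau_gen Sigma1) ** complex_matrix (matrix_inv (burau_gen Sigma3))) **
      complex_matrix (matrix_inv (burau_gen Sigma2))"
    by (simp only: fa_def fb_def if_True if_False burau_braid_mult burau_braid_sigma burau_letter_def fst_conv snd_conv complex_matrix_mult)
  show ?thesis
    unfolding F complex_burau_gen burau_basis_def free_matrix_b_def xy[symmetric]
    by (intro mat3_eqI; simp add: mat3_mult_entry; use xy1 in \<open>simp add: algebra_simps\<close>)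
qed

text \<open>At t = -i the matrix of a is diag(1, i, -i), so Q is the factor to split off. The rest
  is a product of two edges, the second being u times the inverse of
  \<open>Pmat False\<close>.\<close>

lemma free_matrix_a_decompose:
  "mat uu ** free_matrix_a = qmat False \<i> ** (Pmat True ** diag3 1 1 uu)"
proof -
  have "uu * (- lT) = lconst \<i>" "uu * (- lTinv) = lconst (- \<i>) * (uu * uu)"
    by (simp_all add: upow_def mult_single flip: single_uminus)
  then show ?thesis
    unfolding mat_mult_left free_matrix_a_def Pmat_def qmat_def
    by (intro mat3_eqI; simp add: mat3_mult_entry matP_diag)
qed

text \<open>At t = -i the lower block of b is P and the first row is (1, 1+i, 0). The entry 1+i is
  twice the contribution \<open>calpha\<close> of one edge \<open>matR1 calpha\<close>; this
  doubling is the source of the squares of Y and Z.\<close>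

lemma free_matrix_b_decompose:
  "mat (upow 2) ** free_matrix_b = qmat True 1 ** (Pmat False ** (matR1 calpha ** matR1 calpha))"
proof -
  obtain x y :: "complex laurent" where xy: "x = lT" "y = lTinv" by blast
  define a where "a = lconst calpha"
  define c where "c = lconst \<i>"
  have xy1: "x * y = 1" unfolding xy by (rule T_Tinv)
  have cc: "c * c = -1" unfolding c_def by (simp add: mult_single single_uminus)
  have "lconst (2 :: complex) = 2" by (metis single_numeral)
  moreover have "2 * (calpha * calpha) = \<i>" by (simp add: complex_eq_iff)
  ultimately have aa: "2 * (a * a) = c" unfolding a_def c_def by (metis lconst_mult)
  have u: "uu = - c * y" "upow 2 = - y * y"
    by (simp_all add: upow_def c_def xy mult_single power_int_minus single_uminus power2_eq_square)
  have d: "daff calpha = a * (1 - y)"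
    unfolding daff_def calpha_simps(2) a_def xy
    by (simp only: single_uminus right_diff_distrib mult_single mult_1_right) simp
  have "\<i> * cnj calpha = calpha" by (simp add: complex_eq_iff)
  then have e: "caff (\<i> * cnj calpha) = a * (1 + y * y)"
    unfolding caff_def a_def xy by (simp add: distrib_left mult_single)
  have R: "matR1 calpha = mat3 (a * (1 - y)) a 0 (a * (1 + y * y)) (a * (1 - y)) 0 0 0 (- c * y)"
    unfolding matR1_def d e u a_def[symmetric] ..
  have P: "Pmat False = diag3 (- c * y) (- c * y) 1" by (simp add: Pmat_def matP_diag u)
  have Q: "qmat True 1 = mat3 1 0 0 0 0 1 0 (-1) 0" by (simp add: qmat_def single_uminus)
  show ?thesis
    unfolding R P Q u mat_mult_left free_matrix_b_def xy[symmetric]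
    by (intro mat3_eqI; simp add: mat3_mult_entry; use xy1 cc aa in algebra)
qed

lemma qmat_mult:
  "qmat s z ** qmat False \<i> = qmat s (if s then - \<i> * z else \<i> * z)"
  "qmat s z ** qmat True 1 = qmat (\<not> s) (if s then - z else z)"
  by (cases s; simp add: qmat_def mat3_eq_simps mult_single single_uminus mult.commute)+

lemma step_inverse_diag:
  obtains X where "step X" "X = (if s then diag3 1 uu 1 else diag3 1 1 uu)" "theta (Pmat s) \<circ> theta X = id" "theta X \<circ> theta (Pmat s) = id"
    "Pmat s ** X = mat uu"
proof -
  obtain X where X: "step X" "Pmat s ** X = mat uu" "X ** Pmat s = mat uu" "theta (Pmat s) \<circ> theta X = id" "theta X \<circ> theta (Pmat s) = id"
    using step_star[OF step_Pmat] by metis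
  let ?Y = "if s then diag3 1 uu 1 else diag3 1 1 uu"
  have Y: "Pmat s ** ?Y = mat uu"
    by (cases s) (simp_all add: Pmat_def matP_diag mat3_eq_simps mat_def)
  have "mat uu ** X = mat uu ** ?Y"
    using arg_cong[OF Y, of "\<lambda>Z. X ** Z"] unfolding mat_mult_commute[of X] matrix_mul_assoc X(3) ..
  then have "X = ?Y" by (rule mat_cancel) simp
  then show thesis using that X by blast
qed

lemma det_Pmat: "det (Pmat s) = upow 2"
  by (cases s) (simp_all add: Pmat_def matP_diag det_3 upow_add)

lemma theta_Pmat: "theta (Pmat s) x = (if s then Vx (Vx x) else Wx (Wx x))"
proof -
  have "theta (Pmat s) = theta2 (Pmat s)" unfolding theta_def det_Pmat by simp
  then show ?thesis by (simp add: Pmat_def theta2_P proj_sign_def)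
qed

text \<open>The exponent depends on the sign of the first-row entry and is left open, as
  \<open>block_letter\<close> allows both.\<close>

lemma theta_Rmat:
  assumes "unit4 z"
  obtains e where "\<And>x. theta (Rmat s z) x = (if s then Vx' (lmult (GZ, e) x) else Wx' (lmult (GY, e) x))"
proof -
  have "det (Rmat s z) = det (matR1 calpha)"
  proof -
    have "det (qmat s z) * det (qmat' s z) = 1" using qmat_inverse(1)[OF assms] by (metis det_mul det_I)
    then show ?thesis unfolding qmat_conj_Rmat[OF assms, symmetric] det_mul by (simp add: det_qmat[OF assms])
  qed
  also have "\<dots> = (daff calpha * daff calpha - lconst calpha * caff (\<i> * cnj calpha)) * uu"
    unfolding matR1_def by (simp add: det_3 algebra_simps)
  also have "\<dots> = upow 2" unfolding det_R[OF calpha_simps(1)] by (simp add: upow_add)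
  finally have "theta (Rmat s z) = theta2 (Rmat s z)" by (simp add: theta_def)
  moreover have "calpha * w \<noteq> 0" if "unit4 w" for w using that by (auto simp: unit4_def complex_eq_iff)
  ultimately show thesis
    using that[of "csign (if s then - (calpha * z) else calpha * cnj z)"] assms unit4_cnj[OF assms]
    by (simp add: Rmat_def theta2_R1 theta2_R2)
qed

text \<open>The path consists of the edge \<open>Pmat (\<not> s)\<close> and the reversal of an edge
  \<open>Pmat s\<close>, so its value is V^2 W^-2 = D^2 or W^2 V^-2 = D^-2.\<close>

lemma positive_step_a:
  obtains As k m where "\<And>A. A \<in> set As \<Longrightarrow> step A"
    "mat (upow k) ** (qmat s z ** free_matrix_a) = matrix_list_prod As ** qmat s (if s then - \<i> * z else \<i> * z)"
    "block_letter s (False, True) m" "theta_list As = (\<lambda>x. lmult m (lmult m x))"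
proof -
  let ?z = "if s then - \<i> * z else \<i> * z"
  obtain X where X: "step X" "X = (if s then diag3 1 uu 1 else diag3 1 1 uu)" "theta (Pmat s) \<circ> theta X = id"
    using step_inverse_diag[of s] by metis
  have comm: "qmat s ?z ** diag3 1 1 uu = X ** qmat s ?z"
    unfolding X(2) by (cases s) (simp_all add: qmat_def mat3_eq_simps mult.commute)
  have "mat uu ** (qmat s z ** free_matrix_a) = qmat s z ** (mat uu ** free_matrix_a)"
    by (rule mat_left_commute[symmetric])
  also have "\<dots> = (qmat s z ** qmat False \<i>) ** Pmat True ** diag3 1 1 uu"
    unfolding free_matrix_a_decompose by (simp only: matrix_mul_assoc)
  also have "\<dots> = Pmat (\<not> s) ** (qmat s ?z ** diag3 1 1 uu)"
    unfolding qmat_mult(1) using qmat_Pmat[of s ?z True] by (simp flip: matrix_mul_assoc)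
  also have "\<dots> = matrix_list_prod [Pmat (\<not> s), X] ** qmat s ?z"
    unfolding comm by (simp add: matrix_mul_assoc)
  finally have 1: "mat uu ** (qmat s z ** free_matrix_a) = matrix_list_prod [Pmat (\<not> s), X] ** qmat s ?z" .
  have X_eq: "theta (Pmat s) (theta X x) = x" for x using X(3) by (simp add: fun_eq_iff)
  have 2: "theta_list [Pmat (\<not> s), X] = (\<lambda>x. lmult (GD, \<not> s) (lmult (GD, \<not> s) x))"
  proof
    fix x
    show "theta_list [Pmat (\<not> s), X] x = lmult (GD, \<not> s) (lmult (GD, \<not> s) x)"
    proof (cases s)
      case True
      then have "theta X x = Vx' (Vx' x)" using X_eq[of x] unfolding theta_Pmat by (metis V_inv(2))
      then show ?thesis using True by (simp add: theta_Pmat VW_D del: V_W)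
    next
      case False
      then have "theta X x = Wx' (Wx' x)" using X_eq[of x] unfolding theta_Pmat by (metis twist_twist'(1))
      then show ?thesis using False by (simp add: theta_Pmat VW_D del: V_W)
    qed
  qed
  show thesis
  proof (rule that[OF _ 1 _ 2])
    show "step A" if "A \<in> set [Pmat (\<not> s), X]" for A using that step_Pmat X(1) by auto
  qed (simp add: block_letter_def)
qed

text \<open>The edges P, R, R have the value W^2 (W^-1 Y^e)^2 = Y^(2e), since W commutes with Y; for
  the other flag V and Z take these places.\<close>

lemma positive_step_b:
  assumes z: "unit4 z"
  obtains As k m where "\<And>A. A \<in> set As \<Longrightarrow> step A"
    "mat (upow k) ** (qmat s z ** free_matrix_b) = matrix_list_prod As ** qmat (\<not> s) (if s then - z else z)"
    "block_letter s (True, True) m" "theta_list As = (\<lambda>x. lmult m (lmult m x))"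
proof -
  let ?z = "if s then - z else z"
  have z': "unit4 ?z" using z by (auto simp: unit4_def)
  obtain e where e: "\<And>x. theta (Rmat (\<not> s) ?z) x = (if \<not> s then Vx' (lmult (GZ, e) x) else Wx' (lmult (GY, e) x))"
    using theta_Rmat[OF z'] by metis
  let ?R = "Rmat (\<not> s) ?z" and ?P = "Pmat (\<not> s)" and ?q = "qmat (\<not> s) ?z"
  have "mat (upow 2) ** (qmat s z ** free_matrix_b) = qmat s z ** (mat (upow 2) ** free_matrix_b)"
    by (rule mat_left_commute[symmetric])
  also have "\<dots> = (qmat s z ** qmat True 1) ** Pmat False ** matR1 calpha ** matR1 calpha"
    unfolding free_matrix_b_decompose by (simp only: matrix_mul_assoc)
  also have "\<dots> = ?P ** (?q ** matR1 calpha) ** matR1 calpha"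
    unfolding qmat_mult(2) using qmat_Pmat[of "\<not> s" ?z False] by (simp flip: matrix_mul_assoc)
  also have "\<dots> = ?P ** (?R ** ?q) ** matR1 calpha"
    by (simp only: qmat_Rmat[OF z'])
  also have "\<dots> = ?P ** ?R ** (?q ** matR1 calpha)"
    by (simp only: matrix_mul_assoc)
  also have "\<dots> = ?P ** ?R ** (?R ** ?q)"
    by (simp only: qmat_Rmat[OF z'])
  also have "\<dots> = matrix_list_prod [?P, ?R, ?R] ** ?q"
    by (simp add: matrix_mul_assoc)
  finally have 1: "mat (upow 2) ** (qmat s z ** free_matrix_b) = matrix_list_prod [?P, ?R, ?R] ** ?q" .
  show thesis
  proof (rule that[OF _ 1])
    show "step A" if "A \<in> set [?P, ?R, ?R]" for A using that step_Pmat step_Rmat[OF z'] by auto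
    show "block_letter s (True, True) (if s then GY else GZ, e)" by (simp add: block_letter_def)
    show "theta_list [?P, ?R, ?R] = (\<lambda>x. lmult (if s then GY else GZ, e) (lmult (if s then GY else GZ, e) x))"
      using e by (cases s) (simp_all add: fun_eq_iff theta_Pmat)
  qed
qed

lemma step_list_inverse:
  assumes "\<And>A. A \<in> set As \<Longrightarrow> step A"
  obtains Bs k where "\<And>B. B \<in> set Bs \<Longrightarrow> step B" "matrix_list_prod Bs ** matrix_list_prod As = mat (upow k)"
    "theta_list Bs \<circ> theta_list As = id"
proof -
  have "\<exists>Bs k. (\<forall>B\<in>set Bs. step B) \<and> matrix_list_prod Bs ** matrix_list_prod As = mat (upow k) \<and>
      theta_list Bs \<circ> theta_list As = id"
    using assms
  proof (induction As)
    case Nil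
    show ?case by (intro exI[of _ "[]"] exI[of _ 0]) simp
  next
    case (Cons A As)
    obtain Bs k where Bs: "\<forall>B\<in>set Bs. step B" "matrix_list_prod Bs ** matrix_list_prod As = mat (upow k)"
      "theta_list Bs \<circ> theta_list As = id"
      using Cons.IH[OF Cons.prems[OF list.set_intros(2)]] by blast
    obtain B where B: "step B" "B ** A = mat uu" "theta B \<circ> theta A = id"
      using step_star[of A] Cons.prems by (metis list.set_intros(1))
    have "matrix_list_prod (Bs @ [B]) ** matrix_list_prod (A # As) =
        matrix_list_prod Bs ** (B ** A) ** matrix_list_prod As"
      by (simp add: matrix_list_prod_append matrix_mul_assoc)
    also have "\<dots> = mat (upow (1 + k))"
      unfolding B(2) mat_mult_commute[of "matrix_list_prod Bs"]
      using Bs(2) by (simp add: mat_mult_mat upow_add flip: matrix_mul_assoc)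
    finally have 1: "matrix_list_prod (Bs @ [B]) ** matrix_list_prod (A # As) = mat (upow (1 + k))" .
    have "theta_list (Bs @ [B]) \<circ> theta_list (A # As) = theta_list Bs \<circ> (theta B \<circ> theta A) \<circ> theta_list As"
      by (simp add: theta_list_append comp_assoc)
    also have "\<dots> = id" unfolding B(3) by (simp add: Bs(3))
    finally have "theta_list (Bs @ [B]) \<circ> theta_list (A # As) = id" .
    moreover have "\<forall>B'\<in>set (Bs @ [B]). step B'" using Bs(1) B(1) by auto
    ultimately show ?case using 1 by blast
  qed
  then show thesis using that by blast
qed

definition free_letter :: "bool \<times> bool \<Rightarrow> laurent_matrix" where
  "free_letter l = (let A = (if fst l then free_matrix_b else free_matrix_a) in if snd l then A else matrix_inv A)"

text \<open>The parameter of the quaternion factor after it has passed a letter b, if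
  \<open>c\<close> holds, or a letter a; compare \<open>qmat_mult\<close>.\<close>

definition next_phase :: "bool \<Rightarrow> bool \<Rightarrow> complex \<Rightarrow> complex" where
  "next_phase c s z = (if c then if s then - z else z else if s then - \<i> * z else \<i> * z)"

lemma unit4_next_phase: "unit4 z \<Longrightarrow> unit4 (next_phase c s z)"
  by (auto simp: unit4_def next_phase_def)

lemma next_phase_surj: "unit4 z \<Longrightarrow> \<exists>z0. unit4 z0 \<and> next_phase c s z0 = z"
  by (rule exI[of _ "if c then if s then - z else z else if s then \<i> * z else - \<i> * z"])
     (auto simp: unit4_def next_phase_def)

lemma positive_step:
  assumes "unit4 z"
  obtains As k m where "\<And>A. A \<in> set As \<Longrightarrow> step A"
    "mat (upow k) ** (qmat s z ** free_letter (c, True)) = matrix_list_prod As ** qmat (s \<noteq> c) (next_phase c s z)"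
    "block_letter s (c, True) m" "theta_list As = (\<lambda>x. lmult m (lmult m x))"
proof (cases c)
  case True
  obtain As k m where "\<And>A. A \<in> set As \<Longrightarrow> step A"
    "mat (upow k) ** (qmat s z ** free_matrix_b) = matrix_list_prod As ** qmat (\<not> s) (if s then - z else z)"
    "block_letter s (True, True) m" "theta_list As = (\<lambda>x. lmult m (lmult m x))"
    using positive_step_b[OF assms, of s] by metis
  then show thesis using True by (intro that) (auto simp: free_letter_def next_phase_def)
next
  case False
  obtain As k m where "\<And>A. A \<in> set As \<Longrightarrow> step A"
    "mat (upow k) ** (qmat s z ** free_matrix_a) = matrix_list_prod As ** qmat s (if s then - \<i> * z else \<i> * z)"
    "block_letter s (False, True) m" "theta_list As = (\<lambda>x. lmult m (lmult m x))"
    using positive_step_a[of s z] by metis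
  then show thesis using False by (intro that) (auto simp: free_letter_def next_phase_def)
qed

lemma qmat_False_1: "qmat False 1 = mat 1"
  by (simp add: qmat_def vec_eq_iff forall_3 mat_def)

lemma invertible_matrix_list_prod: "(\<And>A. A \<in> set As \<Longrightarrow> step A) \<Longrightarrow> invertible (matrix_list_prod As)"
  by (induction As) (auto simp: step_def near_invertible invertible_mult invertible_scalar)

lemma invertible_qmat: "unit4 z \<Longrightarrow> invertible (qmat s z)"
  using qmat_inverse[of z s] by (auto simp: invertible_def)

text \<open>The positive letter is invertible because, up to scalars and quaternion matrices, it is
  a product of edges.\<close>

lemma free_letter_inverse:
  "free_letter (c, True) ** free_letter (c, False) = mat 1" "free_letter (c, False) ** free_letter (c, True) = mat 1"
proof -
  let ?A = "free_letter (c, True)"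
  have u: "unit4 1" by (simp add: unit4_def)
  obtain As k m where 1: "mat (upow k) ** (qmat False 1 ** ?A) = matrix_list_prod As ** qmat (False \<noteq> c) (next_phase c False 1)"
    and As: "\<And>A. A \<in> set As \<Longrightarrow> step A"
    using positive_step[OF u, of False c] by metis
  have "invertible (mat (upow k) ** ?A)"
    using 1 invertible_matrix_list_prod[of As] As invertible_qmat[OF unit4_next_phase[OF u]]
    by (simp add: invertible_mult qmat_False_1)
  then have "invertible (mat (upow (- k)) ** (mat (upow k) ** ?A))"
    by (rule invertible_mult[OF invertible_scalar[OF upow_dvd]])
  then have "invertible ?A" by (simp add: scalar_simps)
  then obtain B where B: "?A ** B = mat 1" "B ** ?A = mat 1" by (auto simp: invertible_def)
  moreover have "free_letter (c, False) = matrix_inv ?A" by (simp add: free_letter_def)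
  ultimately show "?A ** free_letter (c, False) = mat 1" "free_letter (c, False) ** ?A = mat 1"
    by (simp_all add: matrix_inv_unique[OF B])
qed

lemma letter_step:
  assumes z: "unit4 z"
  obtains As k z' m where "unit4 z'" "\<And>A. A \<in> set As \<Longrightarrow> step A"
    "qmat s z ** free_letter l = mat (upow k) ** (matrix_list_prod As ** qmat (s \<noteq> fst l) z')"
    "block_letter s l m" "theta_list As = (\<lambda>x. lmult m (lmult m x))"
proof -
  obtain c e where l: "l = (c, e)" by (cases l)
  show thesis
  proof (cases e)
    case True
    obtain As k m where As: "\<And>A. A \<in> set As \<Longrightarrow> step A"
      "mat (upow k) ** (qmat s z ** free_letter (c, True)) = matrix_list_prod As ** qmat (s \<noteq> c) (next_phase c s z)"
      "block_letter s (c, True) m" "theta_list As = (\<lambda>x. lmult m (lmult m x))"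
      using positive_step[OF z, of s c] by metis
    have "mat (upow (- k)) ** (mat (upow k) ** (qmat s z ** free_letter (c, True))) = qmat s z ** free_letter (c, True)"
      by (simp add: scalar_simps)
    then have "qmat s z ** free_letter (c, True) = mat (upow (- k)) ** (matrix_list_prod As ** qmat (s \<noteq> c) (next_phase c s z))"
      unfolding As(2) ..
    then show thesis using As(1,3,4) True l unit4_next_phase[OF z]
      by (intro that[of "next_phase c s z" As "- k" m]) simp_all
  next
    case False
    \<comment> \<open>An inverse letter reverses the path of the positive one. Here
      \<open>s0\<close>, and below \<open>z0\<close>, is the state from which the positive letter
      leads to \<open>s\<close> and \<open>z\<close>.\<close>
    define s0 where "s0 = (s \<noteq> c)"
    have s: "s = (s0 \<noteq> c)" by (auto simp: s0_def)
    obtain z0 where z0: "unit4 z0" "next_phase c s0 z0 = z" using next_phase_surj[OF z] by blast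
    obtain As k m where As: "\<And>A. A \<in> set As \<Longrightarrow> step A"
      "mat (upow k) ** (qmat s0 z0 ** free_letter (c, True)) = matrix_list_prod As ** qmat s z"
      "block_letter s0 (c, True) m" "theta_list As = (\<lambda>x. lmult m (lmult m x))"
      using positive_step[OF z0(1), of s0 c] unfolding z0(2) s[symmetric] by metis
    obtain Bs j where Bs: "\<And>B. B \<in> set Bs \<Longrightarrow> step B" "matrix_list_prod Bs ** matrix_list_prod As = mat (upow j)"
      "theta_list Bs \<circ> theta_list As = id"
      using step_list_inverse[of As] As(1) by metis
    let ?F = "free_letter (c, True)" and ?F' = "free_letter (c, False)" and ?B = "matrix_list_prod Bs"
    have "mat (upow j) ** (qmat s z ** ?F') = ?B ** (matrix_list_prod As ** qmat s z) ** ?F'"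
      using Bs(2) by (simp add: matrix_mul_assoc)
    also have "\<dots> = ?B ** (mat (upow k) ** (qmat s0 z0 ** ?F)) ** ?F'" unfolding As(2) ..
    also have "\<dots> = mat (upow k) ** (?B ** qmat s0 z0 ** (?F ** ?F'))"
      unfolding mat_left_commute[of ?B] by (simp only: matrix_mul_assoc)
    also have "\<dots> = mat (upow k) ** (?B ** qmat s0 z0)" by (simp add: free_letter_inverse)
    finally have "mat (upow (- j)) ** (mat (upow j) ** (qmat s z ** ?F')) = mat (upow (- j)) ** (mat (upow k) ** (?B ** qmat s0 z0))"
      by simp
    then have 1: "qmat s z ** ?F' = mat (upow (k - j)) ** (?B ** qmat s0 z0)"
      by (simp add: scalar_simps)
    have 2: "theta_list Bs = (\<lambda>x. lmult (letter_inv m) (lmult (letter_inv m) x))"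
    proof
      fix x
      have "theta_list Bs (theta_list As (lmult (letter_inv m) (lmult (letter_inv m) x))) =
          lmult (letter_inv m) (lmult (letter_inv m) x)"
        using Bs(3) by (simp add: fun_eq_iff)
      then show "theta_list Bs x = lmult (letter_inv m) (lmult (letter_inv m) x)"
        using lmult_inv[of "letter_inv m"] by (simp add: As(4))
    qed
    have "block_letter s (c, False) (letter_inv m)"
      using As(3) unfolding s by (cases c; auto simp: block_letter_def letter_inv_def split: if_splits)
    then show thesis using z0(1) Bs(1) 1 2 False l
      by (intro that[of z0 Bs "k - j" "letter_inv m"]) (simp_all add: s0_def)
  qed
qed

primrec free_matrix :: "(bool \<times> bool) list \<Rightarrow> laurent_matrix" where
  "free_matrix [] = mat 1"
| "free_matrix (l # w) = free_letter l ** free_matrix w"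

text \<open>The quaternion factor travels to the right through the word. Its flag flips at each
  letter b, which exchanges the roles of Y and Z and agrees with the flag of
  \<open>block_image\<close>.\<close>

lemma word_path:
  assumes "unit4 z"
  shows "\<exists>As k s' z'. unit4 z' \<and> (\<forall>A\<in>set As. step A) \<and>
    qmat s z ** free_matrix w = mat (upow k) ** (matrix_list_prod As ** qmat s' z') \<and>
    block_image s w (theta_list As word_Nil)"
  using assms
proof (induction w arbitrary: s z)
  case Nil
  show ?case using Nil
    by (intro exI[of _ "[]"] exI[of _ 0] exI[of _ s] exI[of _ z]) (simp add: block_image.intros)
next
  case (Cons l w)
  obtain As k z' m where As: "unit4 z'" "\<And>A. A \<in> set As \<Longrightarrow> step A"
    "qmat s z ** free_letter l = mat (upow k) ** (matrix_list_prod As ** qmat (s \<noteq> fst l) z')"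
    "block_letter s l m" "theta_list As = (\<lambda>x. lmult m (lmult m x))"
    using letter_step[OF Cons.prems, of s l] by metis
  obtain Bs j s'' z'' where Bs: "unit4 z''" "\<forall>B\<in>set Bs. step B"
    "qmat (s \<noteq> fst l) z' ** free_matrix w = mat (upow j) ** (matrix_list_prod Bs ** qmat s'' z'')"
    "block_image (s \<noteq> fst l) w (theta_list Bs word_Nil)"
    using Cons.IH[OF As(1)] by metis
  have "qmat s z ** free_matrix (l # w) = (qmat s z ** free_letter l) ** free_matrix w"
    by (simp add: matrix_mul_assoc)
  also have "\<dots> = mat (upow k) ** (matrix_list_prod As ** (qmat (s \<noteq> fst l) z' ** free_matrix w))"
    unfolding As(3) by (simp only: matrix_mul_assoc)
  also have "\<dots> = mat (upow k) ** (mat (upow j) ** (matrix_list_prod As ** (matrix_list_prod Bs ** qmat s'' z'')))"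
    unfolding Bs(3) mat_left_commute[of "matrix_list_prod As"] ..
  also have "\<dots> = mat (upow (k + j)) ** (matrix_list_prod (As @ Bs) ** qmat s'' z'')"
    by (simp add: matrix_list_prod_append scalar_simps)
  finally have 1: "qmat s z ** free_matrix (l # w) = mat (upow (k + j)) ** (matrix_list_prod (As @ Bs) ** qmat s'' z'')" .
  have "block_image s (l # w) (theta_list (As @ Bs) word_Nil)"
    using block_image.intros(2)[OF As(4) Bs(4)] by (simp add: theta_list_append As(5))
  then show ?case using 1 As(2) Bs(1,2)
    by (intro exI[of _ "As @ Bs"] exI[of _ "k + j"] exI[of _ s''] exI[of _ z'']) auto
qed

lemma complex_burau_free:
  "complex_matrix (burau_braid (free_braid w)) ** burau_basis = burau_basis ** free_matrix w"
proof (induction w)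
  case Nil
  show ?case by (simp add: complex_matrix_1)
next
  case (Cons l w)
  have pos: "complex_matrix (burau_braid (if c then fb True else fa True)) ** burau_basis = burau_basis ** free_letter (c, True)" for c
    using burau_a burau_b by (simp add: free_letter_def)
  have letter: "complex_matrix (burau_braid (if c then fb e else fa e)) ** burau_basis = burau_basis ** free_letter (c, e)" for c e
  proof (cases e)
    case False
    let ?X = "complex_matrix (burau_braid (if c then fb True else fa True))"
    let ?Y = "complex_matrix (burau_braid (if c then fb False else fa False))"
    have "(if c then fb False else fa False) * (if c then fb True else fa True) = 1"
      using fa_cancel[of False] fb_cancel[of False] by simp
    then have YX: "?Y ** ?X = mat 1"
      by (metis complex_matrix_mult burau_braid_mult burau_braid_1 complex_matrix_1)
    have "?Y ** (?X ** burau_basis) ** free_letter (c, False) = ?Y ** (burau_basis ** free_letter (c, True)) ** free_letter (c, False)"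
      unfolding pos ..
    moreover have "?Y ** (?X ** burau_basis) ** free_letter (c, False) = burau_basis ** free_letter (c, False)"
      by (simp add: matrix_mul_assoc YX)
    moreover have "?Y ** (burau_basis ** free_letter (c, True)) ** free_letter (c, False) = ?Y ** burau_basis"
      by (simp add: free_letter_inverse flip: matrix_mul_assoc)
    ultimately show ?thesis using False by simp
  next
    case True
    then show ?thesis using pos[of c] by (cases c) simp_all
  qed
  have "complex_matrix (burau_braid (free_braid (l # w))) ** burau_basis =
     complex_matrix (burau_braid (if fst l then fb (snd l) else fa (snd l))) ** (complex_matrix (burau_braid (free_braid w)) ** burau_basis)"
    by (simp add: burau_braid_mult complex_matrix_mult matrix_mul_assoc)
  also have "\<dots> = burau_basis ** free_letter l ** free_matrix w"
    unfolding Cons.IH using letter[of "fst l" "snd l"] by (simp add: matrix_mul_assoc)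
  finally show ?case by (simp add: matrix_mul_assoc)
qed

lemma burau_basis_cancel:
  assumes "burau_basis = burau_basis ** A"
  shows "A = mat 1"
proof -
  \<comment> \<open>The adjugate up to sign. The determinant of the basis is t (1 + t) up to sign:
    not a unit, but it can be cancelled.\<close>
  let ?N = "mat3 0 lT 0 (lT * (1 + lT)) (- lT) 0 0 (- lT) (1 + lT) :: laurent_matrix"
  have N: "?N ** burau_basis = mat (lT * (1 + lT))"
    unfolding burau_basis_def by (intro mat3_eqI; simp add: mat3_mult_entry mat_def algebra_simps)
  have "lT * (1 + lT) \<noteq> (0 :: complex laurent)"
  proof
    assume "lT * (1 + lT) = (0 :: complex laurent)"
    then have "lcoeff (lT * (1 + lT) :: complex laurent) 1 = 0" by (simp only: lookup_zero)
    then show False by (simp only: distrib_left mult_single lookup_add mult_1_right) (simp add: lookup_single)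
  qed
  moreover have "mat (lT * (1 + lT)) ** A = mat (lT * (1 + lT)) ** mat 1"
    using arg_cong[OF assms, of "\<lambda>X. ?N ** X"] by (simp add: N matrix_mul_assoc)
  ultimately show ?thesis by (metis mat_cancel)
qed

theorem free_kernel_trivial:
  assumes sc: "simply_connected_space (realization (Delta H_group))"
    and w: "reduced w" "burau_braid (free_braid w) = mat 1"
  shows "w = []"
proof -
  have "burau_basis = burau_basis ** free_matrix w"
    using complex_burau_free[of w] w(2) by (simp add: complex_matrix_1)
  then have 1: "free_matrix w = mat 1" by (rule burau_basis_cancel)
  have u: "unit4 1" by (simp add: unit4_def)
  obtain As k s' z' where As: "unit4 z'" "\<forall>A\<in>set As. step A"
    "qmat False 1 ** free_matrix w = mat (upow k) ** (matrix_list_prod As ** qmat s' z')"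
    "block_image False w (theta_list As word_Nil)"
    using word_path[OF u, of False w] by metis
  let ?M = "matrix_list_prod As"
  have "mat (upow (- k)) ** mat 1 = mat (upow (- k)) ** (mat (upow k) ** (?M ** qmat s' z'))"
    using As(3) by (simp add: 1 qmat_False_1)
  then have eq: "?M ** qmat s' z' = mat (upow (- k))"
    by (simp add: scalar_simps)
  have "kernel_matrix ?M"
    using As(2) kernel_matrix_upow[of 0]
    by (induction As) (auto simp: step_def near_def intro: kernel_matrix_mult)
  then obtain a b where "eval_matrix ?M = row_unipotent a b" by (auto simp: kernel_matrix_def)
  then have "row_unipotent a b ** eval_matrix (qmat s' z') = mat 1"
    using arg_cong[OF eq, of "eval_matrix"] by (simp add: eval.map_matrix_mult eval.map_matrix_mat)
  then have entry: "(row_unipotent a b ** eval_matrix (qmat s' z')) $ i $ j = mat 1 $ i $ j" for i j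
    by simp
  \<comment> \<open>At t = -i the product of the edges is unipotent, so the leftover quaternion
    factor is the identity and the path closes up to a scalar.\<close>
  have "\<not> s' \<and> z' = 1"
    using entry[of 2 2] by (auto simp: row_unipotent_def qmat_def mat3_mult_entry mat_def eval.zero laurent_eval_monom split: if_splits)
  then have "?M = mat (upow (- k))" using eq by (simp add: qmat_False_1)
  then have "theta_list As = id"
    using closed_path_trivial[OF kernel_subgroup_H sc, of As] As(2) by (auto simp: step_def)
  then show ?thesis using As(4) w(1) block_image_Nil by simp
qed

theorem theorem1p5:
  assumes "simply_connected_space (realization (Delta H_group))"
  shows "burau \<in> mon B4 GL3"
  proof (rule burau_injectiveI)
  fix x :: braid assume x: "burau_braid x = mat 1"
  show "x = 1"
  proof (rule burau_faithful_if_free[OF _ x])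
    fix w assume "reduced w" "burau_braid (free_braid w) = mat 1"
    then show "w = []" by (rule free_kernel_trivial[OF assms])
  qed
qed

end
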